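(* Let $d,N\in\mathbb{N}$ and $p\ge1$. Then $\widetilde{\mathcal{KR}}_p$ induces the $p$-adapted weak topology on $\mathcal{P}_p((\mathbb{R}^d)^N)$. That is, for $\mu,\mu_n\in\mathcal{P}_p((\mathbb{R}^d)^N)$, $n\in\mathbb{N}$, we have $\widetilde{\mathcal{KR}}_p(\mu_n,\mu)\to0$ if and only if $\mathcal{AW}_p(\mu_n,\mu)\to0$.
   Context: $|x|_p^p:=\sum_i|x_i|^p$ (sum over all real coordinates), $\mathcal{P}_p((\mathbb{R}^d)^N)$ is the set of Borel probability measures on $(\mathbb{R}^d)^N$ with finite $p$-th moment, $\Pi(\mu,\nu)$ is the set of couplings of $\mu$ and $\nu$, and $\mathcal{W}_p$ is the $p$-Wasserstein distance on $\mathcal{P}_p(\mathbb{R}^d)$ with cost $|x-y|_p^p$. For $\mu\in\mathcal{P}_p((\mathbb{R}^d)^N)$ write its successive disintegration as $\mu(dx)=\mu_1(dx_1)\mu_2^{x_1}(dx_2)\cdots\mu_N^{x_1,\dots,x_{N-1}}(dx_N)$ with $x_k\in\mathbb{R}^d$; for $\pi\in\Pi(\mu,\nu)$ write $\pi=\pi_1(dx_1,dy_1)\,\pi_2^{x_1,y_1}(dx_2,dy_2)\cdots$ with $x_k,y_k\in\mathbb{R}^d$. $\pi\in\Pi(\mu,\nu)$ is bicausal, $\pi\in\Pi_{\rm bc}(\mu,\nu)$, if $\pi$-a.s., for all $k\le N$, $\pi_k^{x_1,\dots,x_{k-1},y_1,\dots,y_{k-1}}$ is a coupling of $\mu_k^{x_1,\dots,x_{k-1}}$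 and $\nu_k^{y_1,\dots,y_{k-1}}$. $\pi\in\Pi(\mu,\nu)$ is triangular optimal, $\pi\in\Pi_{\rm to}(\mu,\nu)$, if $\pi$-a.s., for all $k\le N$, $\pi_k^{x_1,\dots,x_{k-1},y_1,\dots,y_{k-1}}$ is a $\mathcal{W}_p$-optimal coupling between $\mu_k^{x_1,\dots,x_{k-1}}$ and $\nu_k^{y_1,\dots,y_{k-1}}$. $\widetilde{\mathcal{KR}}_p(\mu,\nu):=\sup_{\pi\in\Pi_{\rm to}(\mu,\nu)}\big(\int|x-y|_p^p\,d\pi(x,y)\big)^{1/p}$ and $\mathcal{AW}_p(\mu,\nu):=\inf_{\pi\in\Pi_{\rm bc}(\mu,\nu)}\big(\int|x-y|_p^p\,d\pi(x,y)\big)^{1/p}$. The $p$-adapted weak topology is the topology induced by $\mathcal{AW}_p$. *)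

theory Defs
  imports "HOL-Probability.Probability"
begin

text \<open>
  The path space $(\mathbb{R}^d)^N$ is the product measurable space over the time indices
  \<open>0, \<dots>, N - 1\<close>, so its elements are extensional functions on \<open>{0..<N}\<close>; its product
  sigma-algebra is the Borel sigma-algebra, since all factors are second countable.
  Time \<open>k\<close> here is time \<open>k + 1\<close> in the usual 1-based numbering.
\<close>

abbreviation path_space :: "'a measure \<Rightarrow> nat \<Rightarrow> (nat \<Rightarrow> 'a) measure" where
  "path_space S N \<equiv> PiM {0..<N} (\<lambda>_. S)"

definition pnorm_pow :: "real \<Rightarrow> real ^ 'd::finite \<Rightarrow> real" where
  "pnorm_pow p v = (\<Sum>i\<in>UNIV. \<bar>v $ i\<bar> powr p)"

definition path_pnorm_pow :: "real \<Rightarrow> nat \<Rightarrow> (nat \<Rightarrow> real ^ 'd::finite) \<Rightarrow> real" where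
  "path_pnorm_pow p N x = (\<Sum>k<N. pnorm_pow p (x k))"

definition P_p :: "real \<Rightarrow> nat \<Rightarrow> (nat \<Rightarrow> real ^ 'd::finite) measure set" where
  "P_p p N = {\<mu>. prob_space \<mu> \<and> sets \<mu> = sets (path_space borel N) \<and>
     (\<integral>\<^sup>+ x. ennreal (path_pnorm_pow p N x) \<partial>\<mu>) < \<infinity>}"

definition couplings :: "'a measure \<Rightarrow> 'b measure \<Rightarrow> ('a \<times> 'b) measure set" where
  "couplings \<mu> \<nu> = {\<gamma>. sets \<gamma> = sets (\<mu> \<Otimes>\<^sub>M \<nu>) \<and> distr \<gamma> \<mu> fst = \<mu> \<and> distr \<gamma> \<nu> snd = \<nu>}"

definition ennroot :: "real \<Rightarrow> ennreal \<Rightarrow> ennreal" where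
  "ennroot p c = (if c = \<infinity> then \<infinity> else ennreal (enn2real c powr (1 / p)))"

definition transport_cost ::
    "real \<Rightarrow> ((real ^ 'd::finite) \<times> (real ^ 'd)) measure \<Rightarrow> ennreal" where
  "transport_cost p \<gamma> = ennroot p (\<integral>\<^sup>+ (x, y). ennreal (pnorm_pow p (x - y)) \<partial>\<gamma>)"

definition wasserstein ::
    "real \<Rightarrow> (real ^ 'd::finite) measure \<Rightarrow> (real ^ 'd) measure \<Rightarrow> ennreal" where
  "wasserstein p \<mu> \<nu> = (INF \<gamma> \<in> couplings \<mu> \<nu>. transport_cost p \<gamma>)"

definition optimal_couplings ::
    "real \<Rightarrow> (real ^ 'd::finite) measure \<Rightarrow> (real ^ 'd) measure
      \<Rightarrow> ((real ^ 'd) \<times> (real ^ 'd)) measure set" where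
  "optimal_couplings p \<mu> \<nu> = {\<gamma> \<in> couplings \<mu> \<nu>. transport_cost p \<gamma> = wasserstein p \<mu> \<nu>}"

text \<open>
  \<open>disintegration S N \<mu> \<kappa>\<close> says
  $\mu(dx) = \kappa_0(dx_0)\,\kappa_1^{x_0}(dx_1)\cdots\kappa_{N-1}^{x_0,\dots,x_{N-2}}(dx_{N-1})$,
  where the history $(x_0,\dots,x_{k-1})$ is passed to \<open>\<kappa> k\<close> as an extensional function on
  \<open>{0..<k}\<close>. The locale predicate requires each \<open>\<kappa> k\<close> to be a Markov kernel from
  \<open>path_space S k\<close> to \<open>S\<close>, and \<open>C\<close> composes the kernels of the times \<open>0, \<dots>, N - 1\<close>.
  The kernels \<open>\<kappa> k\<close> with \<open>k \<ge> N\<close> play no role.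
\<close>

definition disintegration ::
    "'a measure \<Rightarrow> nat \<Rightarrow> (nat \<Rightarrow> 'a) measure \<Rightarrow> (nat \<Rightarrow> (nat \<Rightarrow> 'a) \<Rightarrow> 'a measure) \<Rightarrow> bool" where
  "disintegration S N \<mu> \<kappa> \<longleftrightarrow>
     Ionescu_Tulcea \<kappa> (\<lambda>_. S) \<and> \<mu> = Ionescu_Tulcea.C \<kappa> (\<lambda>_. S) 0 N (\<lambda>_. undefined)"

definition zip_path :: "nat \<Rightarrow> (nat \<Rightarrow> 'a) \<times> (nat \<Rightarrow> 'b) \<Rightarrow> nat \<Rightarrow> 'a \<times> 'b" where
  "zip_path N = (\<lambda>(x, y). \<lambda>k\<in>{0..<N}. (x k, y k))"

text \<open>
  Disintegrations are unique only up to null sets, but the conditions below hold for all versions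
  as soon as they hold for one, whence the existential quantifiers. A coupling of path laws is
  disintegrated as the law of the path $k \mapsto (x_k, y_k)$.
\<close>

definition bicausal_couplings ::
    "nat \<Rightarrow> (nat \<Rightarrow> real ^ 'd::finite) measure \<Rightarrow> (nat \<Rightarrow> real ^ 'd) measure
      \<Rightarrow> ((nat \<Rightarrow> real ^ 'd) \<times> (nat \<Rightarrow> real ^ 'd)) measure set" where
  "bicausal_couplings N \<mu> \<nu> = {\<pi> \<in> couplings \<mu> \<nu>. \<exists>\<kappa>\<mu> \<kappa>\<nu> \<kappa>\<pi>.
     disintegration borel N \<mu> \<kappa>\<mu> \<and> disintegration borel N \<nu> \<kappa>\<nu> \<and>
     disintegration (borel \<Otimes>\<^sub>M borel) N
       (distr \<pi> (path_space (borel \<Otimes>\<^sub>M borel) N) (zip_path N)) \<kappa>\<pi> \<and>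
     (AE (x, y) in \<pi>. \<forall>k<N.
        \<kappa>\<pi> k (zip_path k (x, y)) \<in>
          couplings (\<kappa>\<mu> k (restrict x {0..<k})) (\<kappa>\<nu> k (restrict y {0..<k})))}"

definition triangular_optimal_couplings ::
    "real \<Rightarrow> nat \<Rightarrow> (nat \<Rightarrow> real ^ 'd::finite) measure \<Rightarrow> (nat \<Rightarrow> real ^ 'd) measure
      \<Rightarrow> ((nat \<Rightarrow> real ^ 'd) \<times> (nat \<Rightarrow> real ^ 'd)) measure set" where
  "triangular_optimal_couplings p N \<mu> \<nu> = {\<pi> \<in> couplings \<mu> \<nu>. \<exists>\<kappa>\<mu> \<kappa>\<nu> \<kappa>\<pi>.
     disintegration borel N \<mu> \<kappa>\<mu> \<and> disintegration borel N \<nu> \<kappa>\<nu> \<and>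
     disintegration (borel \<Otimes>\<^sub>M borel) N
       (distr \<pi> (path_space (borel \<Otimes>\<^sub>M borel) N) (zip_path N)) \<kappa>\<pi> \<and>
     (AE (x, y) in \<pi>. \<forall>k<N.
        \<kappa>\<pi> k (zip_path k (x, y)) \<in>
          optimal_couplings p (\<kappa>\<mu> k (restrict x {0..<k})) (\<kappa>\<nu> k (restrict y {0..<k})))}"

definition path_cost ::
    "real \<Rightarrow> nat \<Rightarrow> ((nat \<Rightarrow> real ^ 'd::finite) \<times> (nat \<Rightarrow> real ^ 'd)) measure \<Rightarrow> ennreal" where
  "path_cost p N \<pi> = ennroot p (\<integral>\<^sup>+ (x, y). ennreal (path_pnorm_pow p N (\<lambda>k. x k - y k)) \<partial>\<pi>)"

definition KR ::
    "real \<Rightarrow> nat \<Rightarrow> (nat \<Rightarrow> real ^ 'd::finite) measure \<Rightarrow> (nat \<Rightarrow> real ^ 'd) measure \<Rightarrow> ennreal" where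
  "KR p N \<mu> \<nu> = (SUP \<pi> \<in> triangular_optimal_couplings p N \<mu> \<nu>. path_cost p N \<pi>)"

definition AW ::
    "real \<Rightarrow> nat \<Rightarrow> (nat \<Rightarrow> real ^ 'd::finite) measure \<Rightarrow> (nat \<Rightarrow> real ^ 'd) measure \<Rightarrow> ennreal" where
  "AW p N \<mu> \<nu> = (INF \<pi> \<in> bicausal_couplings N \<mu> \<nu>. path_cost p N \<pi>)"

end

theory Submission
  imports Defs
begin

text \<open>
  Triangular optimal couplings are bicausal, so \<open>AW \<le> KR\<close> as soon as one of them exists. For existence,
  couplings are encoded by their values on the cylinders of a Cantor space; they form a compact set on
  which the cost is a supremum of linear functionals, and a minimizer depending measurably on the two
  marginals is found as a cluster point of measurable approximate minimizers. Composing such optimal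
  kernels yields a triangular optimal coupling.

  Conversely, let \<open>AW(\<mu>\<^sub>n, \<mu>)\<close> tend to 0, let \<open>(x, \<xi>)\<close> be almost optimal bicausal and \<open>(x, \<xi>')\<close> triangular
  optimal, glued along \<open>x\<close>. If the costs of \<open>(x, \<xi>')\<close> at the times before \<open>k\<close> tend to 0, then the histories
  of \<open>\<xi>\<close> and \<open>\<xi>'\<close> before \<open>k\<close>, which have the same law independent of \<open>n\<close>, approach each other. Every
  \<open>L\<^sup>p\<close> function of the history, in particular the conditional law of \<open>\<mu>\<close> at time \<open>k\<close> as a function into the
  Wasserstein space, therefore takes close values along \<open>\<xi>\<close> and \<open>\<xi>'\<close>, and the triangle inequality bounds
  the cost of \<open>(x, \<xi>')\<close> at time \<open>k\<close>.
\<close>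

section \<open>Sampling a sequence of bits with prescribed cylinder probabilities\<close>

text \<open>The conditional laws of \<mu> are merely measurable in the history, so closeness of two
  histories at a single point says nothing about them. What helps is that \<xi> and \<xi>' share one
  law that does not change with \<open>n\<close>: a set of small mass is rarely hit by either of
  them, uniformly in \<open>n\<close>, and therefore the sets that both enter together up to
  vanishing probability form a sigma-algebra. No topology on the space of laws is set up. The kernel
  of \<mu> is written as \<open>T (h, u)\<close> with a uniform noise \<open>u\<close>; feeding the
  same \<open>u\<close> into two histories couples the two conditional laws, so only a vector-valued
  function in \<open>L\<^sup>p\<close> has to be compared. Costs are handled as p-th powers, for
  which the triangle inequality holds up to a factor 2^p that limits equal to 0 do not see. For
  existence, the obstacle is that the state space is not compact. Codes restore compactness, and no
  mass escapes from the image of the coding because both marginals are prescribed. The cost of a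
  coupling is only lower semicontinuous in the cylinder probabilities, whence the increasing infima
  over cells.\<close>

definition bits :: "(nat \<Rightarrow> bool) measure" where
  "bits = PiM UNIV (\<lambda>_. count_space UNIV)"

definition prefix_of :: "nat \<Rightarrow> (nat \<Rightarrow> bool) \<Rightarrow> bool list" where
  "prefix_of n s = map s [0..<n]"

definition cyl :: "bool list \<Rightarrow> (nat \<Rightarrow> bool) set" where
  "cyl w = {s. prefix_of (length w) s = w}"

lemma prefix_of_0 [simp]: "prefix_of 0 s = []"
  by (simp add: prefix_of_def)

lemma prefix_of_Suc: "prefix_of (Suc n) s = prefix_of n s @ [s n]"
  by (simp add: prefix_of_def)

lemma length_prefix_of [simp]: "length (prefix_of n s) = n"
  by (simp add: prefix_of_def)

lemma prefix_of_eq_iff: "prefix_of n s = prefix_of n t \<longleftrightarrow> (\<forall>i<n. s i = t i)"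
  by (auto simp: prefix_of_def)

lemma in_cyl_iff: "s \<in> cyl w \<longleftrightarrow> (\<forall>i<length w. s i = w ! i)"
  unfolding cyl_def prefix_of_def mem_Collect_eq list_eq_iff_nth_eq[of _ w] by simp

lemma cyl_Nil [simp]: "cyl [] = UNIV"
  by (simp add: cyl_def)

lemma cyl_split: "cyl w = cyl (w @ [False]) \<union> cyl (w @ [True])"
  "cyl (w @ [False]) \<inter> cyl (w @ [True]) = {}"
  by (auto simp: cyl_def prefix_of_Suc)

lemma space_bits [simp]: "space bits = UNIV"
  by (simp add: bits_def space_PiM)

lemma measurable_bit: "(\<lambda>s. s n) \<in> bits \<rightarrow>\<^sub>M count_space UNIV"
  unfolding bits_def by simp

lemma measurable_bitsI:
  "(\<And>n. Measurable.pred M (\<lambda>x. f x n)) \<Longrightarrow> f \<in> M \<rightarrow>\<^sub>M bits"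
  unfolding bits_def by (rule measurable_PiM_single') auto

lemma measurable_prefix_of [measurable]: "prefix_of n \<in> bits \<rightarrow>\<^sub>M count_space UNIV"
proof (induction n)
  case (Suc n)
  note Suc[measurable] measurable_bit[measurable]
  have "(\<lambda>s. prefix_of n s @ [s n]) \<in> bits \<rightarrow>\<^sub>M count_space UNIV"
    by measurable
  then show ?case by (simp add: prefix_of_Suc[abs_def])
qed (simp add: prefix_of_def[abs_def])

lemma sets_cyl [measurable, simp]: "cyl w \<in> sets bits"
proof -
  have "cyl w = prefix_of (length w) -` {w} \<inter> space bits"
    by (auto simp: cyl_def)
  then show ?thesis
    using measurable_sets[OF measurable_prefix_of, of "{w}" "length w"] by simp
qed

text \<open>Cells of a binary tree are nested or disjoint; the empty set is added for the disjoint
  case.\<close>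

lemma Int_stable_cyl: "Int_stable (insert {} (range cyl))"
proof -
  have le: "cyl v \<inter> cyl w \<in> {{}, cyl w}" if "length v \<le> length w" for v w
    using that by (fastforce simp: in_cyl_iff set_eq_iff)
  have "cyl v \<inter> cyl w \<in> {{}, cyl v, cyl w}" for v w
    using le[of v w] le[of w v] by (cases "length v \<le> length w") (auto simp: Int_commute)
  then have "cyl v \<inter> cyl w \<in> insert {} (range cyl)" for v w
    by (metis empty_iff insertCI insertE rangeI)
  then show ?thesis by (intro Int_stableI) auto
qed

lemma sets_bits_cyl: "sets bits = sigma_sets UNIV (insert {} (range cyl))"
proof (rule antisym)
  have "{s. s i = b} \<in> sigma_sets UNIV (insert {} (range cyl))" for i b
  proof -
    \<comment> \<open>The event is read off from the first \<open>i + 1\<close> bits, hence a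
      countable union of cylinders.\<close>
    have "{s. s i = b} = (\<Union>w\<in>{w. length w = Suc i \<and> w ! i = b}. cyl w)"
    proof (rule set_eqI)
      fix s :: "nat \<Rightarrow> bool"
      have "s \<in> cyl (prefix_of (Suc i) s)" "prefix_of (Suc i) s ! i = s i"
        by (simp_all add: cyl_def) (simp add: prefix_of_def nth_append)
      then show "s \<in> {s. s i = b} \<longleftrightarrow> s \<in> (\<Union>w\<in>{w. length w = Suc i \<and> w ! i = b}. cyl w)"
        by (auto simp: in_cyl_iff intro!: exI[of _ "prefix_of (Suc i) s"])
    qed
    moreover have "countable {w. length w = Suc i \<and> w ! i = b}" by simp
    ultimately show ?thesis
      by (auto intro!: sigma_sets_UNION)
  qed
  then have "{s. s i \<in> A} \<in> sigma_sets UNIV (insert {} (range cyl))" for i A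
  proof -
    have "{s. s i \<in> A} = (\<Union>b\<in>A. {s. s i = b})" by auto
    moreover have "countable A" by (meson countable_finite finite)
    ultimately show ?thesis
      using \<open>\<And>i b. {s. s i = b} \<in> _\<close> by (auto intro!: sigma_sets_UNION)
  qed
  then show "sets bits \<subseteq> sigma_sets UNIV (insert {} (range cyl))"
    unfolding bits_def sets_PiM_single
    by (simp only: space_count_space PiE_UNIV_domain Pi_UNIV) (intro sigma_sets_mono, auto)
next
  show "sigma_sets UNIV (insert {} (range cyl)) \<subseteq> sets bits"
    using sets.sigma_sets_subset[of "insert {} (range cyl)" bits] by (auto simp: subset_eq)
qed

lemma measure_eqI_cyl:
  assumes fin: "emeasure M UNIV \<noteq> \<infinity>" and [simp]: "sets M = sets bits" "sets N = sets bits"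
    and eq: "\<And>w. emeasure M (cyl w) = emeasure N (cyl w)"
  shows "M = N"
proof (rule measure_eqI_generator_eq[where A="\<lambda>_. UNIV" and \<Omega>=UNIV])
  show "Int_stable (insert {} (range cyl))" by (rule Int_stable_cyl)
  show "sets M = sigma_sets UNIV (insert {} (range cyl))"
    "sets N = sigma_sets UNIV (insert {} (range cyl))" by (simp_all add: sets_bits_cyl)
  have "UNIV \<in> range cyl" using cyl_Nil by (rule range_eqI[OF sym])
  then show "range (\<lambda>_::nat. UNIV) \<subseteq> insert {} (range cyl)" by auto
  show "\<And>i::nat. emeasure M UNIV \<noteq> \<infinity>" by (rule fin)
qed (auto simp: eq)

section \<open>Sampling by successive splitting of the unit interval\<close>

definition unif :: "real measure" where
  "unif = uniform_measure lborel {0..<1}"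

lemma sets_unif [simp, measurable_cong]: "sets unif = sets borel"
  by (simp add: unif_def)

lemma space_unif [simp]: "space unif = UNIV"
  by (simp add: unif_def)

lemma prob_space_unif: "prob_space unif"
  unfolding unif_def by (rule prob_space_uniform_measure) auto

lemma emeasure_unif_Ico:
  assumes "0 \<le> a" "a \<le> b" "b \<le> 1"
  shows "emeasure unif {a..<b} = ennreal (b - a)"
proof -
  have "{0..<1} \<inter> {a..<b} = {a..<b}" using assms by auto
  then show ?thesis using assms by (simp add: unif_def divide_ennreal_def)
qed

lemma AE_unif: "AE u in unif. 0 \<le> u \<and> u < 1"
  unfolding unif_def by (rule AE_uniform_measureI) auto

text \<open>These are the families of cylinder probabilities of probability measures on
  \<open>bits\<close>; \<open>emeasure_sample\<close> below constructs the measure.\<close>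

definition consistent :: "(bool list \<Rightarrow> real) \<Rightarrow> bool" where
  "consistent p \<longleftrightarrow> p [] = 1 \<and> (\<forall>w. 0 \<le> p w) \<and> (\<forall>w. p w = p (w @ [False]) + p (w @ [True]))"

lemma consistentD:
  assumes "consistent p"
  shows "p [] = 1" "0 \<le> p w" "p w = p (w @ [False]) + p (w @ [True])"
  using assms unfolding consistent_def by blast+

text \<open>The interval \<open>[0, 1)\<close> is split successively in the proportions prescribed by \<open>p\<close>;
  \<open>left_end p w\<close> is the left end point of the piece of \<open>w\<close>, which has length \<open>p w\<close>.\<close>

definition left_end :: "(bool list \<Rightarrow> real) \<Rightarrow> bool list \<Rightarrow> real" where
  "left_end p w = (\<Sum>i<length w. if w ! i then p (take i w @ [False]) else 0)"

primrec word_at :: "(bool list \<Rightarrow> real) \<Rightarrow> real \<Rightarrow> nat \<Rightarrow> bool list" where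
  "word_at p u 0 = []"
| "word_at p u (Suc n) = word_at p u n @ [left_end p (word_at p u n) + p (word_at p u n @ [False]) \<le> u]"

definition sample :: "(bool list \<Rightarrow> real) \<Rightarrow> real \<Rightarrow> nat \<Rightarrow> bool" where
  "sample p u n \<longleftrightarrow> left_end p (word_at p u n) + p (word_at p u n @ [False]) \<le> u"

lemma left_end_snoc: "left_end p (w @ [b]) = left_end p w + (if b then p (w @ [False]) else 0)"
proof -
  have "(\<Sum>i<length w. if (w @ [b]) ! i then p (take i (w @ [b]) @ [False]) else 0) = left_end p w"
    unfolding left_end_def by (rule sum.cong) (auto simp: nth_append)
  then show ?thesis by (simp add: left_end_def)
qed

lemma length_word_at [simp]: "length (word_at p u n) = n"
  by (induction n) auto

lemma prefix_of_sample: "prefix_of n (sample p u) = word_at p u n"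
  by (induction n) (auto simp: prefix_of_Suc sample_def)

text \<open>Induction on the last letter: the piece of \<open>w\<close> is cut at
  \<open>left_end p w + p (w @ [False])\<close>, and by consistency its right part ends where the
  piece of \<open>w\<close> ends.\<close>

lemma word_at_iff:
  assumes p: "consistent p" and u: "0 \<le> u" "u < 1"
  shows "word_at p u (length w) = w \<longleftrightarrow> left_end p w \<le> u \<and> u < left_end p w + p w"
proof (induction w rule: rev_induct)
  case Nil
  show ?case using consistentD(1)[OF p] u by (simp add: left_end_def)
next
  case (snoc b w)
  have "p w = p (w @ [False]) + p (w @ [True])" "0 \<le> p (w @ [False])" "0 \<le> p (w @ [True])"
    using consistentD[OF p] by blast+
  then show ?case using snoc by (cases b) (auto simp: left_end_snoc)
qed

lemma left_end_bounds:
  assumes p: "consistent p"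
  shows "0 \<le> left_end p w \<and> left_end p w + p w \<le> 1"
proof (induction w rule: rev_induct)
  case Nil
  show ?case using consistentD(1)[OF p] by (simp add: left_end_def)
next
  case (snoc b w)
  have "p w = p (w @ [False]) + p (w @ [True])" "0 \<le> p (w @ [False])" "0 \<le> p (w @ [True])"
    using consistentD[OF p] by blast+
  then show ?case using snoc by (cases b) (auto simp: left_end_snoc)
qed

text \<open>Joint measurability in the probabilities and the noise is what later turns families of
  sampled laws into kernels. The current word takes countably many values, so each step is checked
  word by word.\<close>

lemma measurable_sample:
  assumes [measurable]: "\<And>w. (\<lambda>x. p x w) \<in> borel_measurable M" "u \<in> borel_measurable M"
  shows "(\<lambda>x. sample (p x) (u x)) \<in> M \<rightarrow>\<^sub>M bits"
proof -
  have word[measurable]: "(\<lambda>x. word_at (p x) (u x) n) \<in> M \<rightarrow>\<^sub>M count_space UNIV" for n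
  proof (induction n)
    case (Suc n)
    have [measurable]: "(\<lambda>x. left_end (p x) w) \<in> borel_measurable M" for w
      unfolding left_end_def by measurable
    have "(\<lambda>x. (\<lambda>w x. w @ [left_end (p x) w + p x (w @ [False]) \<le> u x]) (word_at (p x) (u x) n) x)
      \<in> M \<rightarrow>\<^sub>M count_space UNIV"
      by (rule measurable_compose_countable[OF _ Suc]) measurable
    then show ?case by simp
  qed simp
  show ?thesis
  proof (rule measurable_bitsI)
    fix n
    have "(\<lambda>x. sample (p x) (u x) n) = (\<lambda>x. last (word_at (p x) (u x) (Suc n)))"
      by (simp add: sample_def)
    also have "Measurable.pred M \<dots>"
      by (rule measurable_compose[OF word]) simp
    finally show "Measurable.pred M (\<lambda>x. sample (p x) (u x) n)" .
  qed
qed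

text \<open>Up to noise values outside [0, 1), which have probability 0, the event that the sample
  starts with \<open>w\<close> is an interval of length \<open>p w\<close>.\<close>

lemma emeasure_sample:
  assumes "consistent p"
  shows "emeasure (distr unif bits (sample p)) (cyl w) = ennreal (p w)"
proof -
  have m: "sample p \<in> borel \<rightarrow>\<^sub>M bits"
    by (rule measurable_sample[where p="\<lambda>_. p" and u="\<lambda>u. u"]) simp_all
  have "sample p \<in> unif \<rightarrow>\<^sub>M bits"
    using m by (simp cong: measurable_cong_sets)
  then have "emeasure (distr unif bits (sample p)) (cyl w) = emeasure unif (sample p -` cyl w)"
    by (subst emeasure_distr) simp_all
  also have "\<dots> = emeasure unif {left_end p w ..< left_end p w + p w}"
    using AE_unif
  proof (intro emeasure_eq_AE)
    show "AE u in unif. u \<in> sample p -` cyl w \<longleftrightarrow> u \<in> {left_end p w ..< left_end p w + p w}"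
      using AE_unif
    proof eventually_elim
      case (elim u)
      then show ?case
        using word_at_iff[OF assms, of u w] by (simp add: cyl_def prefix_of_sample)
    qed
    show "sample p -` cyl w \<in> sets unif"
      using measurable_sets[OF m sets_cyl[of w]] by simp
  qed simp
  also have "\<dots> = ennreal (p w)"
    using left_end_bounds[OF assms, of w] consistentD(2)[OF assms, of w]
    by (subst emeasure_unif_Ico) auto
  finally show ?thesis .
qed

section \<open>Disintegration and randomization on coded spaces\<close>

text \<open>A measurable retract of the Cantor space. It stands in for a Borel isomorphism: laws on
  \<open>S\<close> become cylinder probabilities under \<open>e\<close>, and sampled bit sequences
  are brought back by \<open>d\<close>, which is only a left inverse of \<open>e\<close>.\<close>

definition coded :: "'a measure \<Rightarrow> ('a \<Rightarrow> nat \<Rightarrow> bool) \<Rightarrow> ((nat \<Rightarrow> bool) \<Rightarrow> 'a) \<Rightarrow> bool" where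
  "coded S e d \<longleftrightarrow> e \<in> S \<rightarrow>\<^sub>M bits \<and> d \<in> bits \<rightarrow>\<^sub>M S \<and> (\<forall>x\<in>space S. d (e x) = x)"

lemma coded_retract:
  assumes "coded S e d" "f \<in> R \<rightarrow>\<^sub>M S" "g \<in> S \<rightarrow>\<^sub>M R" "\<And>x. x \<in> space R \<Longrightarrow> g (f x) = x"
  shows "coded R (e \<circ> f) (g \<circ> d)"
  using assms by (auto simp: coded_def dest: measurable_space intro: measurable_comp)

text \<open>A point is coded by the list of basic open sets that contain it. Decoding picks points
  of ever smaller basic sets from the list and takes their limit, which exists by completeness. The
  second claim, that finitely many bits locate the point, is what later makes a continuous cost
  nearly constant on small cells.\<close>

lemma coded_polish:
  obtains e d where "coded (borel :: 'a::polish_space measure) e d"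
    "\<And>x r. 0 < r \<Longrightarrow> \<exists>n. \<forall>y. prefix_of n (e y) = prefix_of n (e x) \<longrightarrow> dist x y < r"
proof -
  obtain B :: "'a set set" where B: "countable B" "\<And>U. U \<in> B \<Longrightarrow> open U"
    and Bex: "\<And>S. open S \<Longrightarrow> \<exists>U. U \<subseteq> B \<and> S = \<Union>U"
    using univ_second_countable by metis
  have Bne: "B \<noteq> {}" using Bex[of UNIV] by auto
  define U where "U = from_nat_into B"
  have U_open: "open (U n)" for n
    using B(2) from_nat_into[OF Bne] by (simp add: U_def)
  have U_base: "\<exists>n. x \<in> U n \<and> U n \<subseteq> V" if "open V" "x \<in> V" for x V
    using Bex[OF that(1)] that(2) from_nat_into_surj[OF B(1)] unfolding U_def by blast
  define e where "e x = (\<lambda>n. x \<in> U n)" for x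
  have e[measurable]: "e \<in> borel \<rightarrow>\<^sub>M bits"
    unfolding e_def using U_open by (intro measurable_bitsI pred_sets2[OF _ measurable_ident_sets]) auto
  note measurable_bit[measurable]
  \<comment> \<open>\<open>idx k s\<close> will be the first basic set of radius at most 2^-k listed
    by \<open>s\<close>. Being a least index, it depends measurably on \<open>s\<close>.\<close>
  define small where "small k n \<longleftrightarrow> (\<exists>c. U n \<subseteq> ball c ((1/2)^k))" for k n
  define idx where "idx k s = (LEAST n. s n \<and> small k n)" for k and s :: "nat \<Rightarrow> bool"
  define pt where "pt n = (SOME y. y \<in> U n)" for n
  define a where "a k s = pt (idx k s)" for k and s :: "nat \<Rightarrow> bool"
  have [measurable]: "a k \<in> borel_measurable bits" for k
    unfolding a_def idx_def by measurable
  \<comment> \<open>Sequences that are no codes need not give a Cauchy sequence; \<open>pt 0\<close>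
    is a default that keeps \<open>d\<close> total and measurable.\<close>
  define d where "d s = (if Cauchy (\<lambda>k. a k s) then lim (\<lambda>k. a k s) else pt 0)" for s
  have d: "d \<in> borel_measurable bits"
  proof (rule borel_measurable_LIMSEQ_metric)
    show "(\<lambda>s. if Cauchy (\<lambda>k. a k s) then a i s else pt 0) \<in> borel_measurable bits" for i
      by measurable
    show "(\<lambda>i. if Cauchy (\<lambda>k. a k s) then a i s else pt 0) \<longlonglongrightarrow> d s" for s
      unfolding d_def by (auto simp: Cauchy_convergent_iff convergent_LIMSEQ_iff)
  qed
  have de: "d (e x) = x" for x
  proof -
    have "dist (a k (e x)) x \<le> 2 * (1/2)^k" for k
    proof -
      obtain n where "x \<in> U n" "U n \<subseteq> ball x ((1/2)^k)"
        using U_base[of "ball x ((1/2)^k)" x] by auto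
      then have "e x n \<and> small k n" by (auto simp: e_def small_def)
      then have *: "e x (idx k (e x)) \<and> small k (idx k (e x))"
        unfolding idx_def by (rule LeastI)
      then obtain c where c: "U (idx k (e x)) \<subseteq> ball c ((1/2)^k)" by (auto simp: small_def)
      have "x \<in> U (idx k (e x))" using * by (simp add: e_def)
      moreover from this have "a k (e x) \<in> U (idx k (e x))"
        unfolding a_def pt_def by (rule someI)
      ultimately have "dist c x < (1/2)^k" "dist c (a k (e x)) < (1/2)^k" using c by auto
      then have "dist (a k (e x)) x < (1/2)^k + (1/2)^k"
        using dist_triangle3[of "a k (e x)" x c] by linarith
      then show ?thesis by simp
    qed
    moreover have "(\<lambda>k. 2 * (1/2::real)^k) \<longlonglongrightarrow> 0"
      using tendsto_mult_right_zero[OF LIMSEQ_power_zero[of "1/2::real"]] by simp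
    ultimately have "(\<lambda>k. dist (a k (e x)) x) \<longlonglongrightarrow> 0"
      using tendsto_sandwich[of "\<lambda>_. 0" "\<lambda>k. dist (a k (e x)) x" sequentially "\<lambda>k. 2 * (1/2::real)^k" 0]
      by simp
    then have "(\<lambda>k. a k (e x)) \<longlonglongrightarrow> x" by (rule iffD2[OF tendsto_dist_iff])
    then show ?thesis by (simp add: d_def LIMSEQ_imp_Cauchy limI)
  qed
  show ?thesis
  proof (rule that)
    show "coded borel e d" using e d de by (simp add: coded_def)
    fix x :: 'a and r :: real assume "0 < r"
    then obtain n where n: "x \<in> U n" "U n \<subseteq> ball x r" using U_base[of "ball x r" x] by auto
    \<comment> \<open>Bit \<open>n\<close> is visible only in prefixes of length at least
      \<open>n + 1\<close>.\<close>
    then show "\<exists>n. \<forall>y. prefix_of n (e y) = prefix_of n (e x) \<longrightarrow> dist x y < r"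
      by (intro exI[of _ "Suc n"]) (auto simp: prefix_of_eq_iff e_def)
  qed
qed

lemma measure_eqI_pair:
  assumes "prob_space M" and M: "sets M = sets (H \<Otimes>\<^sub>M S)" and N: "sets N = sets (H \<Otimes>\<^sub>M S)"
    and eq: "\<And>A B. A \<in> sets H \<Longrightarrow> B \<in> sets S \<Longrightarrow> emeasure M (A \<times> B) = emeasure N (A \<times> B)"
  shows "M = N"
proof (rule measure_eqI_generator_eq[OF Int_stable_pair_measure_generator[of H S],
    where \<Omega>="space H \<times> space S" and A="\<lambda>_. space H \<times> space S"])
  interpret prob_space M by fact
  show "{a \<times> b |a b. a \<in> sets H \<and> b \<in> sets S} \<subseteq> Pow (space H \<times> space S)"
    by (rule pair_measure_closed)
  show "\<And>i::nat. emeasure M (space H \<times> space S) \<noteq> \<infinity>" by simp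
qed (use M N eq in \<open>auto simp: sets_pair_measure\<close>)

text \<open>The semidirect product m(dh) \<kappa>(h, ds).\<close>

definition joint :: "'h measure \<Rightarrow> 's measure \<Rightarrow> 'h measure \<Rightarrow> ('h \<Rightarrow> 's measure) \<Rightarrow> ('h \<times> 's) measure" where
  "joint H S m \<kappa> = m \<bind> (\<lambda>h. distr (\<kappa> h) (H \<Otimes>\<^sub>M S) (Pair h))"

context
  fixes H :: "'h measure" and S :: "'s measure" and m \<kappa>
  assumes \<kappa>: "\<kappa> \<in> H \<rightarrow>\<^sub>M prob_algebra S" and m: "m \<in> space (prob_algebra H)"
begin

lemma measurable_joint_kernel: "(\<lambda>h. distr (\<kappa> h) (H \<Otimes>\<^sub>M S) (Pair h)) \<in> H \<rightarrow>\<^sub>M prob_algebra (H \<Otimes>\<^sub>M S)"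
  using \<kappa> by (intro measurable_distr_prob_space2[where M=S]) auto

lemma joint_in_prob_algebra: "joint H S m \<kappa> \<in> space (prob_algebra (H \<Otimes>\<^sub>M S))"
  unfolding joint_def
  using prob_space_bind'[OF m measurable_joint_kernel] sets_bind'[OF m measurable_joint_kernel]
  by (simp add: space_prob_algebra)

lemma nn_integral_joint:
  assumes f: "f \<in> borel_measurable (H \<Otimes>\<^sub>M S)"
  shows "(\<integral>\<^sup>+z. f z \<partial>joint H S m \<kappa>) = (\<integral>\<^sup>+h. \<integral>\<^sup>+s. f (h, s) \<partial>\<kappa> h \<partial>m)"
proof -
  have sm: "sets m = sets H" using m by (simp add: space_prob_algebra)
  have "(\<lambda>h. distr (\<kappa> h) (H \<Otimes>\<^sub>M S) (Pair h)) \<in> m \<rightarrow>\<^sub>M subprob_algebra (H \<Otimes>\<^sub>M S)"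
    using measurable_prob_algebraD[OF measurable_joint_kernel] by (simp add: sm cong: measurable_cong_sets)
  then have "(\<integral>\<^sup>+z. f z \<partial>joint H S m \<kappa>) = (\<integral>\<^sup>+h. \<integral>\<^sup>+z. f z \<partial>distr (\<kappa> h) (H \<Otimes>\<^sub>M S) (Pair h) \<partial>m)"
    unfolding joint_def by (rule nn_integral_bind[OF f])
  also have "\<dots> = (\<integral>\<^sup>+h. \<integral>\<^sup>+s. f (h, s) \<partial>\<kappa> h \<partial>m)"
  proof (rule nn_integral_cong)
    fix h assume "h \<in> space m"
    then have h: "h \<in> space H" using sets_eq_imp_space_eq[OF sm] by simp
    then have "sets (\<kappa> h) = sets S" using measurable_space[OF \<kappa>] by (simp add: space_prob_algebra)
    then have "Pair h \<in> \<kappa> h \<rightarrow>\<^sub>M H \<Otimes>\<^sub>M S" using h by (simp cong: measurable_cong_sets)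
    then show "(\<integral>\<^sup>+z. f z \<partial>distr (\<kappa> h) (H \<Otimes>\<^sub>M S) (Pair h)) = (\<integral>\<^sup>+s. f (h, s) \<partial>\<kappa> h)"
      using f by (subst nn_integral_distr) auto
  qed
  finally show ?thesis .
qed

lemma emeasure_joint:
  assumes A: "A \<in> sets H" and B: "B \<in> sets S"
  shows "emeasure (joint H S m \<kappa>) (A \<times> B) = (\<integral>\<^sup>+h. indicator A h * emeasure (\<kappa> h) B \<partial>m)"
proof -
  have "emeasure (joint H S m \<kappa>) (A \<times> B) = (\<integral>\<^sup>+z. indicator (A \<times> B) z \<partial>joint H S m \<kappa>)"
    using joint_in_prob_algebra A B by (subst nn_integral_indicator) (auto simp: space_prob_algebra)
  also have "\<dots> = (\<integral>\<^sup>+h. \<integral>\<^sup>+s. indicator (A \<times> B) (h, s) \<partial>\<kappa> h \<partial>m)"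
    using A B by (intro nn_integral_joint) auto
  also have "\<dots> = (\<integral>\<^sup>+h. indicator A h * emeasure (\<kappa> h) B \<partial>m)"
  proof (rule nn_integral_cong)
    fix h assume "h \<in> space m"
    then have h: "h \<in> space H"
      using m sets_eq_imp_space_eq[of m H] by (simp add: space_prob_algebra)
    then have "sets (\<kappa> h) = sets S" using measurable_space[OF \<kappa>] by (simp add: space_prob_algebra)
    then show "(\<integral>\<^sup>+s. indicator (A \<times> B) (h, s) \<partial>\<kappa> h) = indicator A h * emeasure (\<kappa> h) B"
      using B by (simp add: indicator_times nn_integral_cmult)
  qed
  finally show ?thesis .
qed

end


text \<open>Existence of regular conditional laws. For each word the mass of its cell has a density
  with respect to the first marginal. There are countably many words, so outside one null set these
  densities are consistent and \<open>sample\<close> turns them into a law.\<close>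

lemma rcp:
  assumes M: "M \<in> space (prob_algebra (H \<Otimes>\<^sub>M S))" and S: "coded S e d"
  obtains \<kappa> where "\<kappa> \<in> H \<rightarrow>\<^sub>M prob_algebra S" "M = joint H S (distr M H fst) \<kappa>"
proof -
  interpret M: prob_space M using M by (simp add: space_prob_algebra)
  have sM[measurable_cong, simp]: "sets M = sets (H \<Otimes>\<^sub>M S)" using M by (simp add: space_prob_algebra)
  have spM: "space M = space H \<times> space S" using sets_eq_imp_space_eq[OF sM] by (simp add: space_pair_measure)
  have e[measurable]: "e \<in> S \<rightarrow>\<^sub>M bits" and d[measurable]: "d \<in> bits \<rightarrow>\<^sub>M S"
    and de: "\<And>x. x \<in> space S \<Longrightarrow> d (e x) = x" using S by (auto simp: coded_def)
  define m where "m = distr M H fst"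
  have sm[measurable_cong, simp]: "sets m = sets H" by (simp add: m_def)
  have spm[simp]: "space m = space H" by (simp add: m_def)
  interpret m: prob_space m unfolding m_def by (rule M.prob_space_distr) simp
  have m_in: "m \<in> space (prob_algebra H)" using m.prob_space_axioms by (simp add: space_prob_algebra)
  define E where "E w = e -` cyl w \<inter> space S" for w
  have E[measurable]: "E w \<in> sets S" for w unfolding E_def by measurable
  define \<nu> where "\<nu> w = distr (density M (indicator (space H \<times> E w))) H fst" for w
  have s\<nu>[simp, measurable_cong]: "sets (\<nu> w) = sets H" for w by (simp add: \<nu>_def)
  have \<nu>: "emeasure (\<nu> w) A = emeasure M (A \<times> E w)" if A[measurable]: "A \<in> sets H" for w A
  proof -
    have "emeasure (\<nu> w) A = emeasure (density M (indicator (space H \<times> E w))) (fst -` A \<inter> space M)"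
      unfolding \<nu>_def by (subst emeasure_distr) auto
    also have "fst -` A \<inter> space M = A \<times> space S"
      using sets.sets_into_space[OF A] by (auto simp: spM)
    also have "emeasure (density M (indicator (space H \<times> E w))) (A \<times> space S)
      = (\<integral>\<^sup>+z. indicator (A \<times> E w) z \<partial>M)"
      using sets.sets_into_space[OF A] sets.sets_into_space[OF E[of w]]
      by (subst emeasure_density)
        (auto intro!: nn_integral_cong simp del: nn_integral_indicator split: split_indicator)
    finally show ?thesis by simp
  qed
  define q where "q w = RN_deriv m (\<nu> w)" for w
  have q_meas[measurable]: "q w \<in> borel_measurable H" for w
    using borel_measurable_RN_deriv[of m "\<nu> w"] by (simp add: q_def cong: measurable_cong_sets)
  have dq: "density m (q w) = \<nu> w" for w
    unfolding q_def
  proof (rule m.density_RN_deriv)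
    show "absolutely_continuous m (\<nu> w)"
      unfolding absolutely_continuous_def
    proof
      fix A assume "A \<in> null_sets m"
      then have A: "A \<in> sets H" "emeasure m A = 0" by auto
      have "emeasure M (A \<times> space S) = 0"
      proof -
        have "fst -` A \<inter> space M = A \<times> space S"
          using sets.sets_into_space[OF A(1)] by (auto simp: spM)
        then show ?thesis using A unfolding m_def by (subst (asm) emeasure_distr) auto
      qed
      then have "emeasure M (A \<times> E w) = 0"
        using sets.sets_into_space[OF E[of w]] A(1) emeasure_mono[of "A \<times> E w" "A \<times> space S" M]
        by auto
      then show "A \<in> null_sets (\<nu> w)" using A \<nu> by auto
    qed
  qed simp
  have int_q: "(\<integral>\<^sup>+h. indicator A h * q w h \<partial>m) = emeasure M (A \<times> E w)" if "A \<in> sets H" for A w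
    using that \<nu>[OF that, of w] unfolding dq[symmetric]
    by (subst (asm) emeasure_density) (auto simp: mult.commute)
  have q_Nil: "AE h in m. q [] h = 1"
  proof (rule m.density_unique)
    show "density m (q []) = density m (\<lambda>_. 1)"
    proof (rule measure_eqI)
      fix A assume "A \<in> sets (density m (q []))"
      then have A: "A \<in> sets H" by simp
      have "fst -` A \<inter> space M = A \<times> E []"
        using sets.sets_into_space[OF A] by (auto simp: spM E_def)
      then have "emeasure M (A \<times> E []) = emeasure m A"
        using A unfolding m_def by (subst emeasure_distr) auto
      then show "emeasure (density m (q [])) A = emeasure (density m (\<lambda>_. 1)) A"
        using A \<nu>[OF A] by (simp add: dq density_1)
    qed simp
  qed auto
  have q_split: "AE h in m. q w h = q (w @ [False]) h + q (w @ [True]) h" for w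
  proof (rule m.density_unique)
    show "density m (q w) = density m (\<lambda>h. q (w @ [False]) h + q (w @ [True]) h)"
    proof (rule measure_eqI)
      fix A assume "A \<in> sets (density m (q w))"
      then have A[measurable]: "A \<in> sets H" by simp
      have "A \<times> E w = A \<times> E (w @ [False]) \<union> A \<times> E (w @ [True])"
        using cyl_split(1)[of w] by (auto simp: E_def)
      moreover have "A \<times> E (w @ [False]) \<inter> A \<times> E (w @ [True]) = {}"
        using cyl_split(2)[of w] by (auto simp: E_def)
      ultimately have "emeasure M (A \<times> E w) = emeasure M (A \<times> E (w @ [False])) + emeasure M (A \<times> E (w @ [True]))"
        by (simp add: plus_emeasure)
      then have "(\<integral>\<^sup>+h. indicator A h * q w h \<partial>m) =
        (\<integral>\<^sup>+h. indicator A h * q (w @ [False]) h \<partial>m) + (\<integral>\<^sup>+h. indicator A h * q (w @ [True]) h \<partial>m)"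
        by (simp add: int_q)
      also have "\<dots> = (\<integral>\<^sup>+h. indicator A h * q (w @ [False]) h + indicator A h * q (w @ [True]) h \<partial>m)"
        by (rule nn_integral_add[symmetric]) measurable
      finally show "emeasure (density m (q w)) A = emeasure (density m (\<lambda>h. q (w @ [False]) h + q (w @ [True]) h)) A"
        by (simp add: emeasure_density distrib_left mult.commute)
    qed simp
  qed auto
  define G where "G h \<longleftrightarrow> q [] h = 1 \<and> (\<forall>w. q w h = q (w @ [False]) h + q (w @ [True]) h)" for h
  have G_Nil: "q [] h = 1" and G_split: "q w h = q (w @ [False]) h + q (w @ [True]) h" if "G h" for h w
    using that unfolding G_def by blast+
  have "AE h in m. \<forall>w. q w h = q (w @ [False]) h + q (w @ [True]) h"
    by (rule AE_all_countable[THEN iffD2]) (use q_split in blast)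
  with q_Nil have AE_G: "AE h in m. G h"
    by eventually_elim (unfold G_def, blast)
  have [measurable]: "Measurable.pred H G" unfolding G_def[abs_def] by measurable
  \<comment> \<open>On the exceptional histories the default consists of the cylinder probabilities
    of the point mass at the constantly \<open>False\<close> sequence, so that \<open>p h\<close> is
    consistent for every \<open>h\<close>.\<close>
  define p where "p h w = (if G h then enn2real (q w h) else if True \<in> set w then 0 else 1)" for h w
  have [measurable]: "(\<lambda>h. p h w) \<in> borel_measurable H" for w
    unfolding p_def by measurable
  \<comment> \<open>Finiteness is what allows the passage from \<open>ennreal\<close> densities to
    real probabilities.\<close>
  have q_le: "q w h \<le> 1" if "G h" for w h
  proof (induction w rule: rev_induct)
    case Nil
    show ?case by (simp add: G_Nil[OF that])
  next
    case (snoc b w)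
    have "q (w @ [b]) h \<le> q (w @ [False]) h + q (w @ [True]) h" by (cases b) simp_all
    then have "q (w @ [b]) h \<le> q w h" by (simp only: G_split[OF that, of w])
    then show ?case using snoc by (rule order_trans)
  qed
  have q_p: "ennreal (p h w) = q w h" if "G h" for w h
    using that q_le[OF that, of w] by (auto simp: p_def ennreal_enn2real_if top_unique)
  have cons: "consistent (p h)" for h
  proof (cases "G h")
    case True
    have "p h w = p h (w @ [False]) + p h (w @ [True])" for w
    proof -
      have nonneg: "0 \<le> p h v" for v by (simp add: p_def)
      have "ennreal (p h w) = ennreal (p h (w @ [False])) + ennreal (p h (w @ [True]))"
        by (simp only: q_p[OF True] G_split[OF True, of w])
      then show ?thesis using nonneg by (simp add: ennreal_plus[symmetric] del: ennreal_plus)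
    qed
    moreover have "p h [] = 1" using True by (simp add: p_def G_Nil)
    moreover have "0 \<le> p h w" for w by (simp add: p_def)
    ultimately show ?thesis unfolding consistent_def by blast
  qed (simp add: consistent_def p_def)
  define \<kappa>' where "\<kappa>' h = distr unif bits (sample (p h))" for h
  have samp[measurable]: "(\<lambda>(h, u). sample (p h) u) \<in> H \<Otimes>\<^sub>M unif \<rightarrow>\<^sub>M bits"
    unfolding split_beta by (rule measurable_sample) measurable
  have unif_in: "unif \<in> space (prob_algebra unif)" by (simp add: space_prob_algebra prob_space_unif)
  have \<kappa>': "\<kappa>' \<in> H \<rightarrow>\<^sub>M prob_algebra bits"
    unfolding \<kappa>'_def by (rule measurable_distr_prob_space2[OF _ samp]) (use unif_in in simp)
  define \<kappa> where "\<kappa> h = distr (\<kappa>' h) S d" for h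
  have \<kappa>: "\<kappa> \<in> H \<rightarrow>\<^sub>M prob_algebra S"
    unfolding \<kappa>_def by (rule measurable_compose[OF \<kappa>' measurable_distr_prob_space[OF d]])
  \<comment> \<open>For fixed \<open>A\<close> both sides are finite measures in \<open>B\<close>;
    on cylinders they agree by the choice of \<open>q\<close>, hence they agree everywhere.\<close>
  have key: "emeasure M (A \<times> (e -` B \<inter> space S)) = (\<integral>\<^sup>+h. indicator A h * emeasure (\<kappa>' h) B \<partial>m)"
    if A[measurable]: "A \<in> sets H" and B: "B \<in> sets bits" for A B
  proof -
    define N1 where "N1 = distr (density M (indicator (A \<times> space S))) bits (\<lambda>z. e (snd z))"
    define N2 where "N2 = distr (density (joint H bits m \<kappa>') (indicator (A \<times> UNIV))) bits snd"
    have sJ[measurable_cong, simp]: "sets (joint H bits m \<kappa>') = sets (H \<Otimes>\<^sub>M bits)"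
      using joint_in_prob_algebra[OF \<kappa>' m_in] by (simp add: space_prob_algebra)
    have spJ: "space (joint H bits m \<kappa>') = space H \<times> UNIV"
      using sets_eq_imp_space_eq[OF sJ] by (simp add: space_pair_measure)
    have Asub: "A \<subseteq> space H" using sets.sets_into_space[OF A] .
    have m1: "(\<lambda>z. e (snd z)) \<in> M \<rightarrow>\<^sub>M bits" by measurable
    have N1: "emeasure N1 B = emeasure M (A \<times> (e -` B \<inter> space S))" if [measurable]: "B \<in> sets bits" for B
    proof -
      have "emeasure N1 B = emeasure (density M (indicator (A \<times> space S))) ((\<lambda>z. e (snd z)) -` B \<inter> space M)"
        unfolding N1_def by (subst emeasure_distr) auto
      also have "\<dots> = (\<integral>\<^sup>+z. indicator (A \<times> space S) z * indicator ((\<lambda>z. e (snd z)) -` B \<inter> space M) z \<partial>M)"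
        using measurable_sets[OF m1 that] by (subst emeasure_density) auto
      also have "\<dots> = (\<integral>\<^sup>+z. indicator (A \<times> (e -` B \<inter> space S)) z \<partial>M)"
        using Asub by (intro nn_integral_cong) (auto simp: spM split: split_indicator)
      finally show ?thesis by simp
    qed
    have m2: "snd \<in> joint H bits m \<kappa>' \<rightarrow>\<^sub>M bits" by measurable
    have UN: "A \<times> UNIV \<in> sets (H \<Otimes>\<^sub>M bits)" using A sets.top[of bits] by simp
    have N2: "emeasure N2 B = (\<integral>\<^sup>+h. indicator A h * emeasure (\<kappa>' h) B \<partial>m)" if [measurable]: "B \<in> sets bits" for B
    proof -
      have "emeasure N2 B = emeasure (density (joint H bits m \<kappa>') (indicator (A \<times> UNIV)))
          (snd -` B \<inter> space (joint H bits m \<kappa>'))"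
        unfolding N2_def using m2 that by (subst emeasure_distr) (auto cong: measurable_cong_sets)
      also have "\<dots> = (\<integral>\<^sup>+z. indicator (A \<times> UNIV) z * indicator (snd -` B \<inter> space (joint H bits m \<kappa>')) z \<partial>joint H bits m \<kappa>')"
        using measurable_sets[OF m2 that] UN by (subst emeasure_density) simp_all
      also have "\<dots> = (\<integral>\<^sup>+z. indicator (A \<times> B) z \<partial>joint H bits m \<kappa>')"
        using Asub by (intro nn_integral_cong) (auto simp: spJ split: split_indicator)
      also have "\<dots> = emeasure (joint H bits m \<kappa>') (A \<times> B)" by simp
      also have "\<dots> = (\<integral>\<^sup>+h. indicator A h * emeasure (\<kappa>' h) B \<partial>m)"
        by (rule emeasure_joint[OF \<kappa>' m_in A]) fact
      finally show ?thesis .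
    qed
    have "N1 = N2"
    proof (rule measure_eqI_cyl)
      show "emeasure N1 UNIV \<noteq> \<infinity>" using N1[of UNIV] sets.top[of bits] by simp
      fix w
      have "(\<integral>\<^sup>+h. indicator A h * emeasure (\<kappa>' h) (cyl w) \<partial>m) = (\<integral>\<^sup>+h. indicator A h * q w h \<partial>m)"
        using AE_G by (intro nn_integral_cong_AE) (auto simp: \<kappa>'_def emeasure_sample[OF cons] q_p)
      then show "emeasure N1 (cyl w) = emeasure N2 (cyl w)"
        using int_q[OF A] by (simp add: N1 N2 E_def)
    qed (simp_all add: N1_def N2_def)
    then show ?thesis using N1[OF B] N2[OF B] by simp
  qed
  have "M = joint H S m \<kappa>"
  proof (rule measure_eqI_pair[OF M.prob_space_axioms sM])
    show "sets (joint H S m \<kappa>) = sets (H \<Otimes>\<^sub>M S)"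
      using joint_in_prob_algebra[OF \<kappa> m_in] by (simp add: space_prob_algebra)
    fix A B assume A: "A \<in> sets H" and B: "B \<in> sets S"
    have dB: "d -` B \<in> sets bits" using measurable_sets[OF d B] by simp
    have "e -` (d -` B) \<inter> space S = B" using de sets.sets_into_space[OF B] by auto
    then have "emeasure M (A \<times> B) = (\<integral>\<^sup>+h. indicator A h * emeasure (\<kappa>' h) (d -` B) \<partial>m)"
      using key[OF A dB] by simp
    also have "\<dots> = (\<integral>\<^sup>+h. indicator A h * emeasure (\<kappa> h) B \<partial>m)"
    proof (rule nn_integral_cong)
      fix h
      have "sets (\<kappa>' h) = sets bits" "space (\<kappa>' h) = UNIV" by (simp_all add: \<kappa>'_def)
      then have "emeasure (\<kappa> h) B = emeasure (\<kappa>' h) (d -` B)"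
        unfolding \<kappa>_def using B d by (subst emeasure_distr) (auto cong: measurable_cong_sets)
      then show "indicator A h * emeasure (\<kappa>' h) (d -` B) = indicator A h * emeasure (\<kappa> h) B" by simp
    qed
    also have "\<dots> = emeasure (joint H S m \<kappa>) (A \<times> B)"
      by (rule emeasure_joint[OF \<kappa> m_in A B, symmetric])
    finally show "emeasure M (A \<times> B) = emeasure (joint H S m \<kappa>) (A \<times> B)" .
  qed
  then show ?thesis using that[OF \<kappa>] unfolding m_def by simp
qed


text \<open>Cylinders separate laws on \<open>bits\<close>, and pushing forward by \<open>e\<close>
  and then by \<open>d\<close> gives back the original measure.\<close>

lemma measure_eqI_coded:
  assumes S: "coded S e d" and M: "sets M = sets S" and N: "sets N = sets S"
    and fin: "emeasure M (space S) \<noteq> \<infinity>"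
    and eq: "\<And>w. emeasure M (e -` cyl w \<inter> space S) = emeasure N (e -` cyl w \<inter> space S)"
  shows "M = N"
proof -
  have [measurable]: "e \<in> S \<rightarrow>\<^sub>M bits" "d \<in> bits \<rightarrow>\<^sub>M S" and de: "\<And>x. x \<in> space S \<Longrightarrow> d (e x) = x"
    using S by (auto simp: coded_def)
  have e: "e \<in> M \<rightarrow>\<^sub>M bits" "e \<in> N \<rightarrow>\<^sub>M bits" by (simp_all add: M N cong: measurable_cong_sets)
  have sp: "space M = space S" "space N = space S" using M N sets_eq_imp_space_eq by blast+
  have "distr M bits e = distr N bits e"
    by (rule measure_eqI_cyl) (use fin eq in \<open>simp_all add: emeasure_distr[OF e(1)] emeasure_distr[OF e(2)] sp sets.top[of bits, simplified]\<close>)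
  then have "distr (distr M bits e) S d = distr (distr N bits e) S d" by simp
  then have "distr M S (d \<circ> e) = distr N S (d \<circ> e)" using e by (simp add: distr_distr)
  moreover have "distr K S (d \<circ> e) = K" if "sets K = sets S" for K
  proof -
    have "distr K S (d \<circ> e) = distr K K (\<lambda>x. x)"
      by (rule distr_cong) (simp_all add: that sets_eq_imp_space_eq[OF that] de)
    then show ?thesis by (simp add: distr_id)
  qed
  ultimately show ?thesis using M N by metis
qed

text \<open>Noise outsourcing: \<open>T\<close> samples a bit sequence with the cell probabilities
  of \<open>\<kappa> h\<close> from the noise and decodes it. One measurable \<open>T\<close> serves
  all parameters, so different parameters can be fed with the same noise.\<close>

lemma outsource:
  assumes \<kappa>: "\<kappa> \<in> H \<rightarrow>\<^sub>M prob_algebra S" and S: "coded S e d"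
  obtains T where "T \<in> H \<Otimes>\<^sub>M borel \<rightarrow>\<^sub>M S" "\<And>h. h \<in> space H \<Longrightarrow> \<kappa> h = distr unif S (\<lambda>u. T (h, u))"
proof -
  have e[measurable]: "e \<in> S \<rightarrow>\<^sub>M bits" and d[measurable]: "d \<in> bits \<rightarrow>\<^sub>M S"
    and de: "\<And>x. x \<in> space S \<Longrightarrow> d (e x) = x" using S by (auto simp: coded_def)
  define E where "E w = e -` cyl w \<inter> space S" for w
  have E[measurable]: "E w \<in> sets S" for w unfolding E_def by measurable
  define p where "p h w = measure (\<kappa> h) (E w)" for h w
  have [measurable]: "(\<lambda>h. p h w) \<in> borel_measurable H" for w
    unfolding p_def by (rule measurable_compose[OF \<kappa> measurable_measure_prob_algebra[OF E]])
  define T where "T = (\<lambda>(h, u). d (sample (p h) u))"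
  have samp: "(\<lambda>z. sample (p (fst z)) (snd z)) \<in> H \<Otimes>\<^sub>M borel \<rightarrow>\<^sub>M bits"
    by (rule measurable_sample) measurable
  show ?thesis
  proof (rule that)
    show "T \<in> H \<Otimes>\<^sub>M borel \<rightarrow>\<^sub>M S"
      unfolding T_def split_beta by (rule measurable_compose[OF samp d])
    fix h assume h: "h \<in> space H"
    have prob: "prob_space (\<kappa> h)" and s: "sets (\<kappa> h) = sets S"
      using measurable_space[OF \<kappa> h] by (auto simp: space_prob_algebra)
    interpret prob_space "\<kappa> h" by (rule prob)
    have sp: "space (\<kappa> h) = space S" using sets_eq_imp_space_eq[OF s] .
    have "p h w = p h (w @ [False]) + p h (w @ [True])" for w
    proof -
      have "E w = E (w @ [False]) \<union> E (w @ [True])" "E (w @ [False]) \<inter> E (w @ [True]) = {}"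
        using cyl_split[of w] by (auto simp: E_def)
      then show ?thesis unfolding p_def using s E by (simp add: finite_measure_Union)
    qed
    moreover have "p h [] = 1" using prob_space by (simp add: p_def E_def sp)
    moreover have "0 \<le> p h w" for w by (simp add: p_def)
    ultimately have cons: "consistent (p h)" unfolding consistent_def by blast
    have sm: "sample (p h) \<in> unif \<rightarrow>\<^sub>M bits"
      using measurable_compose_Pair1[OF h samp] by (simp cong: measurable_cong_sets)
    define N where "N = distr unif bits (sample (p h))"
    have "distr (\<kappa> h) bits e = N"
    proof (rule measure_eqI_cyl)
      have e': "e \<in> \<kappa> h \<rightarrow>\<^sub>M bits" by (simp add: s cong: measurable_cong_sets)
      show "emeasure (distr (\<kappa> h) bits e) UNIV \<noteq> \<infinity>"
        using e' sets.top[of bits] by (simp add: emeasure_distr)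
      fix w
      have "emeasure (distr (\<kappa> h) bits e) (cyl w) = emeasure (\<kappa> h) (E w)"
        using e' by (simp add: emeasure_distr sp E_def)
      then show "emeasure (distr (\<kappa> h) bits e) (cyl w) = emeasure N (cyl w)"
        unfolding N_def by (simp add: emeasure_sample[OF cons] p_def emeasure_eq_measure)
    qed (simp_all add: N_def)
    then have "distr (distr (\<kappa> h) bits e) S d = distr N S d" by simp
    moreover have "distr (distr (\<kappa> h) bits e) S d = \<kappa> h"
    proof -
      have "distr (distr (\<kappa> h) bits e) S d = distr (\<kappa> h) S (d \<circ> e)"
        by (rule distr_distr) (simp_all add: s cong: measurable_cong_sets)
      also have "\<dots> = distr (\<kappa> h) (\<kappa> h) (\<lambda>x. x)"
        by (rule distr_cong) (simp_all add: s sp de)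
      finally show ?thesis by (simp add: distr_id)
    qed
    moreover have "distr N S d = distr unif S (\<lambda>u. T (h, u))"
      unfolding N_def using sm by (subst distr_distr) (simp_all add: T_def comp_def)
    ultimately show "\<kappa> h = distr unif S (\<lambda>u. T (h, u))" by simp
  qed
qed

text \<open>For one word this is uniqueness of densities, and countably many words determine a
  law.\<close>

lemma joint_unique:
  assumes S: "coded S e d" and \<kappa>: "\<kappa> \<in> H \<rightarrow>\<^sub>M prob_algebra S" and \<kappa>': "\<kappa>' \<in> H \<rightarrow>\<^sub>M prob_algebra S"
    and m: "m \<in> space (prob_algebra H)" and eq: "joint H S m \<kappa> = joint H S m \<kappa>'"
  shows "AE h in m. \<kappa> h = \<kappa>' h"
proof -
  interpret m: prob_space m using m by (simp add: space_prob_algebra)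
  have sm[measurable_cong, simp]: "sets m = sets H" using m by (simp add: space_prob_algebra)
  have [measurable]: "e \<in> S \<rightarrow>\<^sub>M bits" using S by (auto simp: coded_def)
  have E[measurable]: "e -` cyl w \<inter> space S \<in> sets S" for w by measurable
  have [measurable]: "(\<lambda>h. emeasure (\<kappa> h) (e -` cyl w \<inter> space S)) \<in> borel_measurable H"
     "(\<lambda>h. emeasure (\<kappa>' h) (e -` cyl w \<inter> space S)) \<in> borel_measurable H" for w
    using measurable_compose[OF measurable_prob_algebraD[OF \<kappa>] measurable_emeasure_subprob_algebra[OF E]]
     measurable_compose[OF measurable_prob_algebraD[OF \<kappa>'] measurable_emeasure_subprob_algebra[OF E]] by auto
  have "AE h in m. \<forall>w. emeasure (\<kappa> h) (e -` cyl w \<inter> space S) = emeasure (\<kappa>' h) (e -` cyl w \<inter> space S)"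
  proof (rule AE_all_countable[THEN iffD2], rule allI, rule m.density_unique)
    fix w
    show "density m (\<lambda>h. emeasure (\<kappa> h) (e -` cyl w \<inter> space S)) =
      density m (\<lambda>h. emeasure (\<kappa>' h) (e -` cyl w \<inter> space S))"
    proof (rule measure_eqI)
      fix A assume "A \<in> sets (density m (\<lambda>h. emeasure (\<kappa> h) (e -` cyl w \<inter> space S)))"
      then have A[measurable]: "A \<in> sets H" by simp
      show "emeasure (density m (\<lambda>h. emeasure (\<kappa> h) (e -` cyl w \<inter> space S))) A =
        emeasure (density m (\<lambda>h. emeasure (\<kappa>' h) (e -` cyl w \<inter> space S))) A"
        using emeasure_joint[OF \<kappa> m A E[of w]] emeasure_joint[OF \<kappa>' m A E[of w]] eq
        by (simp add: emeasure_density mult.commute)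
    qed simp
  qed measurable
  then show ?thesis
  proof (rule AE_mp, intro AE_I2 impI)
    fix h assume h: "h \<in> space m"
      and eq: "\<forall>w. emeasure (\<kappa> h) (e -` cyl w \<inter> space S) = emeasure (\<kappa>' h) (e -` cyl w \<inter> space S)"
    have h: "h \<in> space H" using h sets_eq_imp_space_eq[OF sm] by simp
    have k: "prob_space (\<kappa> h)" "sets (\<kappa> h) = sets S" "sets (\<kappa>' h) = sets S"
      using measurable_space[OF \<kappa> h] measurable_space[OF \<kappa>' h] by (auto simp: space_prob_algebra)
    show "\<kappa> h = \<kappa>' h"
    proof (rule measure_eqI_coded[OF S k(2,3)])
      interpret prob_space "\<kappa> h" by fact
      show "emeasure (\<kappa> h) (space S) \<noteq> \<infinity>" by simp
    qed (use eq in blast)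
  qed
qed

text \<open>Extensional functions on a finite index set are a retract, by restriction, of all
  sequences, which form a Polish space.\<close>

lemma coded_path_space:
  obtains e d where "coded (path_space (borel :: 'a::polish_space measure) N) e d"
proof -
  obtain e d where ed: "coded (borel :: (nat \<Rightarrow> 'a) measure) e d"
    by (rule coded_polish) (rule that)
  \<comment> \<open>Outside the index set a path is constantly \<open>undefined\<close>, so these
    coordinates are measurable too.\<close>
  have comp: "(\<lambda>x. x i) \<in> path_space borel N \<rightarrow>\<^sub>M (borel :: 'a measure)" for i :: nat
  proof (cases "i < N")
    case False
    then have "x i = undefined" if "x \<in> space (path_space (borel :: 'a measure) N)" for x
      using that by (auto simp: space_PiM PiE_def extensional_def)
    then show ?thesis by (subst measurable_cong[where g="\<lambda>_. undefined"]) simp_all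
  qed simp
  have "(\<lambda>x. x) \<in> path_space borel N \<rightarrow>\<^sub>M (PiM UNIV (\<lambda>_. borel) :: (nat \<Rightarrow> 'a) measure)"
    by (rule measurable_PiM_single'[where f="\<lambda>i x. x i", OF comp]) simp
  then have f: "(\<lambda>x. x) \<in> path_space borel N \<rightarrow>\<^sub>M (borel :: (nat \<Rightarrow> 'a) measure)"
    using measurable_cong_sets[OF refl sets_PiM_equal_borel] by blast
  have "(\<lambda>x. restrict x {0..<N}) \<in> (PiM UNIV (\<lambda>_. borel) :: (nat \<Rightarrow> 'a) measure) \<rightarrow>\<^sub>M path_space borel N"
    by (rule measurable_restrict_subset) simp
  then have g: "(\<lambda>x. restrict x {0..<N}) \<in> (borel :: (nat \<Rightarrow> 'a) measure) \<rightarrow>\<^sub>M path_space borel N"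
    using measurable_cong_sets[OF sets_PiM_equal_borel refl] by blast
  show ?thesis
    by (rule that[OF coded_retract[OF ed f g]]) (simp add: space_PiM PiE_restrict)
qed

section \<open>Measurable selection of minimizers\<close>

text \<open>The limit is built coordinate by coordinate, each coordinate being the lower limit along
  the times at which the earlier coordinates are close to their limits.\<close>

lemma measurable_cluster_point_nat:
  fixes u :: "nat \<Rightarrow> 'h \<Rightarrow> nat \<Rightarrow> real"
  assumes [measurable]: "\<And>n i. (\<lambda>h. u n h i) \<in> borel_measurable M"
    and bnd: "\<And>n h i. 0 \<le> u n h i" "\<And>n h i. u n h i \<le> 1"
  obtains L :: "nat \<Rightarrow> 'h \<Rightarrow> real" where "\<And>i. L i \<in> borel_measurable M"
    "\<And>h i k. \<exists>n\<ge>k. \<forall>j\<le>i. \<bar>u n h j - L j h\<bar> < 1 / real (Suc k)"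
proof -
  \<comment> \<open>\<open>r\<close> is an admissible coordinate \<open>i\<close> of the limit once
    the earlier coordinates \<open>F\<close> are chosen: arbitrarily late, all of them are
    approximated at one common time.\<close>
  define P where "P F i r \<longleftrightarrow> r \<in> borel_measurable M \<and>
    (\<forall>h k. \<exists>n\<ge>k. (\<forall>j<i. \<bar>u n h j - F j h\<bar> < 1 / real (Suc k)) \<and> \<bar>u n h i - r h\<bar> < 1 / real (Suc k))"
    for F :: "nat \<Rightarrow> 'h \<Rightarrow> real" and i r
  have "\<exists>L. \<forall>i. P L i (L i)"
  proof (rule dependent_wellorder_choice)
    fix r and f g :: "nat \<Rightarrow> 'h \<Rightarrow> real" and i :: nat
    assume "\<And>j. j < i \<Longrightarrow> f j = g j"
    then show "P f i r = P g i r" by (simp add: P_def)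
  next
    fix i :: nat and F
    assume IH: "\<And>j. j < i \<Longrightarrow> P F j (F j)"
    define F' where "F' j = (if j < i then F j else (\<lambda>_. 0))" for j
    have [measurable]: "F' j \<in> borel_measurable M" for j
      using IH by (simp add: F'_def P_def)
    \<comment> \<open>The times after \<open>k\<close> at which the earlier coordinates are within
      1/(k+1) of their limits. They become fewer as \<open>k\<close> grows but never run
      out.\<close>
    define A where "A k h n \<longleftrightarrow> k \<le> n \<and> (\<forall>j\<in>{..<i}. \<bar>u n h j - F' j h\<bar> < 1 / real (Suc k))" for k h n
    have [measurable]: "Measurable.pred M (\<lambda>h. A k h n)" for k n
      unfolding A_def by measurable
    have A_ex: "\<exists>n. A k h n" for k h
    proof (cases i)
      case (Suc i')
      then have "P F i' (F i')" using IH by simp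
      then obtain n where "n \<ge> k" "\<forall>j<i'. \<bar>u n h j - F j h\<bar> < 1 / real (Suc k)" "\<bar>u n h i' - F i' h\<bar> < 1 / real (Suc k)"
        unfolding P_def by blast
      then have "A k h n" using Suc by (auto simp: A_def F'_def less_Suc_eq)
      then show ?thesis ..
    qed (auto simp: A_def)
    have A_mono: "A l h n" if "A k h n" "l \<le> k" for k l h n
    proof -
      have "1 / real (Suc k) \<le> 1 / real (Suc l)" using that by (simp add: frac_le)
      then show ?thesis using that unfolding A_def by (meson order_less_le_trans order_trans)
    qed
    \<comment> \<open>All values of \<open>u\<close> are at most 1 and some time satisfies
      \<open>A k h\<close>, so the filler 1 leaves the infimum over the admissible times
      unchanged.\<close>
    define c where "c k h n = (if A k h n then u n h i else 1)" for k h n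
    define g where "g k h = (INF n. c k h n)" for k h
    have c_bnd: "0 \<le> c k h n" "c k h n \<le> 1" for k h n using bnd by (simp_all add: c_def)
    have bb: "bdd_below (range (c k h))" for k h using c_bnd by (intro bdd_belowI2) auto
    have g_bnd: "0 \<le> g k h" "g k h \<le> 1" for k h
      unfolding g_def using c_bnd(1) order_trans[OF cINF_lower[OF bb UNIV_I] c_bnd(2)]
      by (auto intro: cINF_greatest)
    have g_mono: "g l h \<le> g k h" if "l \<le> k" for k l h
      unfolding g_def
    proof (rule cINF_mono[OF _ bb])
      fix n show "\<exists>m\<in>UNIV. c l h m \<le> c k h n"
        using A_mono[OF _ that, of h n] A_ex[of l h] bnd c_bnd(2)[of l h]
        by (cases "A k h n") (auto simp: c_def intro: exI[of _ n])
    qed simp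
    \<comment> \<open>The infima \<open>g k h\<close> increase with \<open>k\<close>, so this is the
      lower limit of coordinate \<open>i\<close> along the admissible times.\<close>
    define r where "r h = (SUP k. g k h)" for h
    have ba: "bdd_above (range (\<lambda>k. g k h))" for h using g_bnd by (intro bdd_aboveI2) auto
    have r_meas: "r \<in> borel_measurable M"
      unfolding r_def g_def c_def
      using ba bb by (intro borel_measurable_cSUP borel_measurable_cINF) (auto simp: g_def c_def)
    have "\<exists>n\<ge>k. (\<forall>j<i. \<bar>u n h j - F j h\<bar> < 1 / real (Suc k)) \<and> \<bar>u n h i - r h\<bar> < 1 / real (Suc k)" for h k
    proof -
      have pos: "0 < 1 / real (Suc k)" by simp
      then have "r h - 1 / real (Suc k) < (SUP k. g k h)" by (simp add: r_def)
      then obtain l where l: "r h - 1 / real (Suc k) < g l h"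
        using less_cSUP_iff[OF _ ba] by auto
      define k' where "k' = max k l"
      have g1: "r h - 1 / real (Suc k) < g k' h" using l g_mono[of l k' h] by (simp add: k'_def)
      have g2: "g k' h \<le> r h" unfolding r_def by (rule cSUP_upper[OF UNIV_I ba])
      have "\<exists>n. A k' h n \<and> u n h i < g k' h + 1 / real (Suc k)"
      proof -
        have "(INF n. c k' h n) < g k' h + 1 / real (Suc k)" using pos by (simp add: g_def)
        then obtain n where n: "c k' h n < g k' h + 1 / real (Suc k)"
          using cINF_less_iff[OF _ bb] by auto
        show ?thesis
        proof (cases "A k' h n")
          case True
          then show ?thesis using n by (auto simp: c_def)
        next
          case False
          \<comment> \<open>If the near-infimum is attained only by the filler 1, every admissible
            time is good enough.\<close>
          obtain n' where "A k' h n'" using A_ex by blast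
          moreover have "u n' h i < g k' h + 1 / real (Suc k)"
            using n False bnd(2)[of n' h i] by (simp add: c_def)
          ultimately show ?thesis by blast
        qed
      qed
      then obtain n where n: "A k' h n" "u n h i < g k' h + 1 / real (Suc k)" by blast
      have "g k' h \<le> u n h i" using cINF_lower[OF bb UNIV_I, of k' h n] n(1) by (simp add: g_def c_def)
      then have "\<bar>u n h i - r h\<bar> < 1 / real (Suc k)" using g1 g2 n(2) by simp
      moreover have "A k h n" by (rule A_mono[OF n(1)]) (simp add: k'_def)
      ultimately show ?thesis by (auto simp: A_def F'_def)
    qed
    then show "\<exists>r. P F i r" using r_meas unfolding P_def by blast
  qed
  then obtain L where L: "\<And>i. P L i (L i)" by blast
  show ?thesis
  proof (rule that)
    show "L i \<in> borel_measurable M" for i using L[of i] by (simp add: P_def)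
    show "\<exists>n\<ge>k. \<forall>j\<le>i. \<bar>u n h j - L j h\<bar> < 1 / real (Suc k)" for h i k
    proof -
      obtain n where "n\<ge>k" "\<forall>j<i. \<bar>u n h j - L j h\<bar> < 1 / real (Suc k)" "\<bar>u n h i - L i h\<bar> < 1 / real (Suc k)"
        using L[of i] unfolding P_def by blast
      then show ?thesis by (auto simp: order_le_less)
    qed
  qed
qed

text \<open>Only the limit is chosen measurably; the times \<open>f\<close> may depend on
  \<open>h\<close> in any way. They need not increase, but \<open_placeholder> they tend to
  infinity.\<close>

lemma measurable_cluster_point:
  fixes u :: "nat \<Rightarrow> 'h \<Rightarrow> 'i::countable \<Rightarrow> real"
  assumes meas: "\<And>n i. (\<lambda>h. u n h i) \<in> borel_measurable M"
    and bnd: "\<And>n h i. 0 \<le> u n h i" "\<And>n h i. u n h i \<le> 1"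
  obtains L :: "'h \<Rightarrow> 'i \<Rightarrow> real" where "\<And>i. (\<lambda>h. L h i) \<in> borel_measurable M"
    "\<And>h. \<exists>f. (\<forall>k::nat. k \<le> f k) \<and> (\<forall>i. (\<lambda>k. u (f k) h i) \<longlonglongrightarrow> L h i)"
proof -
  obtain L :: "nat \<Rightarrow> 'h \<Rightarrow> real" where L: "\<And>i. L i \<in> borel_measurable M"
    "\<And>h i k. \<exists>n\<ge>k. \<forall>j\<le>i. \<bar>u n h (from_nat j) - L j h\<bar> < 1 / real (Suc k)"
    using measurable_cluster_point_nat[of "\<lambda>n h j. u n h (from_nat j)" M] meas bnd by blast
  show ?thesis
  proof (rule that)
    show "(\<lambda>h. L (to_nat i) h) \<in> borel_measurable M" for i :: 'i by (rule L(1))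
    fix h
    \<comment> \<open>Diagonal choice: at stage \<open>k\<close> the first \<open>k + 1\<close>
      coordinates are controlled, so one sequence of times serves all coordinates.\<close>
    have "\<forall>k. \<exists>n\<ge>k. \<forall>j\<le>k. \<bar>u n h (from_nat j) - L j h\<bar> < 1 / real (Suc k)" using L(2) by blast
    then obtain f where f: "\<And>k. k \<le> f k" "\<And>k j. j \<le> k \<Longrightarrow> \<bar>u (f k) h (from_nat j) - L j h\<bar> < 1 / real (Suc k)"
      by metis
    have "(\<lambda>k. u (f k) h i) \<longlonglongrightarrow> L (to_nat i) h" for i
    proof (rule LIMSEQ_I)
      fix r :: real assume "0 < r"
      then obtain k0 where k0: "1 / real (Suc k0) < r" using nat_approx_posE by blast
      show "\<exists>no. \<forall>n\<ge>no. norm (u (f n) h i - L (to_nat i) h) < r"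
      proof (intro exI allI impI)
        fix n assume n: "max k0 (to_nat i) \<le> n"
        then have "\<bar>u (f n) h i - L (to_nat i) h\<bar> < 1 / real (Suc n)" using f(2)[of "to_nat i" n] by simp
        also have "\<dots> \<le> 1 / real (Suc k0)" using n by (simp add: frac_le)
        finally show "norm (u (f n) h i - L (to_nat i) h) < r" using k0 by simp
      qed
    qed
    then show "\<exists>f. (\<forall>k::nat. k \<le> f k) \<and> (\<forall>i. (\<lambda>k. u (f k) h i) \<longlonglongrightarrow> L (to_nat i) h)"
      using f(1) by blast
  qed
qed

text \<open>Points with finitely many nonzero coordinates, all multiples of some 1/k, are countable
  and approximate every point of the cube coordinate by coordinate.\<close>

lemma countable_dense_unit_cube:
  obtains q :: "nat \<Rightarrow> 'i::countable \<Rightarrow> real" where "\<And>n i. 0 \<le> q n i" "\<And>n i. q n i \<le> 1"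
    "\<And>\<gamma>. (\<And>i. 0 \<le> \<gamma> i \<and> \<gamma> i \<le> 1) \<Longrightarrow> \<exists>f. \<forall>i. (\<lambda>k. q (f k) i) \<longlonglongrightarrow> \<gamma> i"
proof
  define Q where "Q = (\<lambda>(k :: nat, l :: nat list) (i :: 'i). if to_nat i < length l then min 1 (real (l ! to_nat i) / real k) else 0)"
  define q where "q n = Q (from_nat n)" for n
  show "0 \<le> q n i" "q n i \<le> 1" for n i by (auto simp: q_def Q_def split: prod.split)
  fix \<gamma> :: "'i \<Rightarrow> real" assume \<gamma>: "\<And>i. 0 \<le> \<gamma> i \<and> \<gamma> i \<le> 1"
  \<comment> \<open>The first \<open>k\<close> coordinates of the target are rounded down to
    multiples of 1/k.\<close>
  define f where "f k = to_nat (k, map (\<lambda>j. nat \<lfloor>real k * \<gamma> (from_nat j)\<rfloor>) [0..<k])" for k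
  have "(\<lambda>k. q (f k) i) \<longlonglongrightarrow> \<gamma> i" for i
  proof (rule LIMSEQ_I)
    fix r :: real assume "0 < r"
    then obtain k0 where k0: "1 / real (Suc k0) < r" using nat_approx_posE by blast
    show "\<exists>no. \<forall>k\<ge>no. norm (q (f k) i - \<gamma> i) < r"
    proof (intro exI allI impI)
      fix k assume k: "Suc (max k0 (to_nat i)) \<le> k"
      have fl: "real (nat \<lfloor>real k * \<gamma> i\<rfloor>) = of_int \<lfloor>real k * \<gamma> i\<rfloor>" using \<gamma>[of i] by simp
      have "real k * \<gamma> i \<le> real k * 1" using \<gamma>[of i] by (intro mult_left_mono) auto
      then have "of_int \<lfloor>real k * \<gamma> i\<rfloor> \<le> real k" by linarith
      then have "of_int \<lfloor>real k * \<gamma> i\<rfloor> / real k \<le> 1" using k by (simp add: divide_le_eq)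
      then have "q (f k) i = of_int \<lfloor>real k * \<gamma> i\<rfloor> / real k"
        using k fl by (simp add: q_def Q_def f_def)
      moreover have "of_int \<lfloor>real k * \<gamma> i\<rfloor> / real k \<le> \<gamma> i"
        using k by (simp add: divide_le_eq mult.commute)
      moreover have "\<gamma> i - 1 / real k < of_int \<lfloor>real k * \<gamma> i\<rfloor> / real k"
      proof -
        have "real k * (\<gamma> i - 1 / real k) < of_int \<lfloor>real k * \<gamma> i\<rfloor>"
          using k by (simp add: right_diff_distrib)
        then show ?thesis using k by (simp add: less_divide_eq mult.commute)
      qed
      ultimately have "norm (q (f k) i - \<gamma> i) < 1 / real k" by simp
      also have "\<dots> \<le> 1 / real (Suc k0)" using k by (intro divide_left_mono) auto
      finally show "norm (q (f k) i - \<gamma> i) < r" using k0 by simp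
    qed
  qed
  then show "\<exists>f. \<forall>i. (\<lambda>k. q (f k) i) \<longlonglongrightarrow> \<gamma> i" by blast
qed

definition seq_continuous :: "(('i \<Rightarrow> real) \<Rightarrow> real) \<Rightarrow> bool" where
  "seq_continuous F \<longleftrightarrow> (\<forall>x l. (\<forall>i. (\<lambda>k. x k i) \<longlonglongrightarrow> l i) \<longrightarrow> (\<lambda>k. F (x k)) \<longlonglongrightarrow> F l)"

lemma seq_continuousD: "seq_continuous F \<Longrightarrow> (\<And>i. (\<lambda>k. x k i) \<longlonglongrightarrow> l i) \<Longrightarrow> (\<lambda>k. F (x k)) \<longlonglongrightarrow> F l"
  by (simp add: seq_continuous_def)

text \<open>\<open>G m h \<gamma> \<le> 0\<close> for all \<open>m\<close> are the constraints, and
  the supremum over \<open>m\<close> of \<open>J m h \<gamma>\<close> is the objective on the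
  compact cube. The supremum need not be continuous, so stage \<open>n\<close> looks only at the
  indices up to \<open>n\<close>, relaxes the constraints by \<epsilon> and takes an almost optimal
  grid point. For each fixed \<open>m\<close> the inequalities then pass to a cluster point.\<close>

lemma measurable_argmin:
  fixes G J :: "nat \<Rightarrow> 'h \<Rightarrow> ('i::countable \<Rightarrow> real) \<Rightarrow> real"
  assumes G_meas[measurable]: "\<And>m \<gamma>. (\<lambda>h. G m h \<gamma>) \<in> borel_measurable M" and G_cont: "\<And>m h. seq_continuous (G m h)"
    and J_meas[measurable]: "\<And>m \<gamma>. (\<lambda>h. J m h \<gamma>) \<in> borel_measurable M" and J_cont: "\<And>m h. seq_continuous (J m h)"
    and J_nonneg: "\<And>m h \<gamma>. (\<And>i. 0 \<le> \<gamma> i) \<Longrightarrow> 0 \<le> J m h \<gamma>"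
  obtains L :: "'h \<Rightarrow> 'i \<Rightarrow> real" where "\<And>i. (\<lambda>h. L h i) \<in> borel_measurable M"
    "\<And>h i. 0 \<le> L h i \<and> L h i \<le> 1"
    "\<And>h \<gamma> m. (\<And>i. 0 \<le> \<gamma> i \<and> \<gamma> i \<le> 1) \<Longrightarrow> (\<And>m. G m h \<gamma> \<le> 0) \<Longrightarrow> G m h (L h) \<le> 0"
    "\<And>h \<gamma> m t. (\<And>i. 0 \<le> \<gamma> i \<and> \<gamma> i \<le> 1) \<Longrightarrow> (\<And>m. G m h \<gamma> \<le> 0) \<Longrightarrow> (\<And>m. J m h \<gamma> \<le> t) \<Longrightarrow> J m h (L h) \<le> t"
proof -
  obtain q :: "nat \<Rightarrow> 'i \<Rightarrow> real" where q: "\<And>n i. 0 \<le> q n i" "\<And>n i. q n i \<le> 1"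
    and q_dense: "\<And>\<gamma>. (\<And>i. 0 \<le> \<gamma> i \<and> \<gamma> i \<le> 1) \<Longrightarrow> \<exists>f. \<forall>i. (\<lambda>k. q (f k) i) \<longlonglongrightarrow> \<gamma> i"
    by (rule countable_dense_unit_cube) blast
  define \<epsilon> where "\<epsilon> n = 1 / real (Suc n)" for n
  have \<epsilon>_pos: "0 < \<epsilon> n" for n by (simp add: \<epsilon>_def)
  \<comment> \<open>The penalized objective of grid point \<open>j\<close> at stage
    \<open>n\<close>. The constraints are relaxed because a grid point will rarely satisfy them
    exactly.\<close>
  define c where "c n h j = (if \<forall>m\<in>{..n}. G m h (q j) < \<epsilon> n then (SUP m\<in>{..n}. ennreal (J m h (q j))) else \<infinity>)" for n h j
  have [measurable]: "(\<lambda>h. c n h j) \<in> borel_measurable M" for n j unfolding c_def by measurable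
  \<comment> \<open>Taking the first almost optimal index makes the choice measurable in
    \<open>h\<close>.\<close>
  define jj where "jj n h = (LEAST j. c n h j \<le> (INF j. c n h j) + ennreal (\<epsilon> n))" for n h
  have jj_meas[measurable]: "jj n \<in> M \<rightarrow>\<^sub>M count_space UNIV" for n unfolding jj_def by measurable
  have jj: "c n h (jj n h) \<le> (INF j. c n h j) + ennreal (\<epsilon> n)" for n h
  proof (cases "(INF j. c n h j) = \<infinity>")
    case False
    then have "(INF j. c n h j) < (INF j. c n h j) + ennreal (\<epsilon> n)"
      using \<epsilon>_pos[of n] by (simp add: ennreal_add_left_cancel_less[of _ 0, simplified] less_top)
    then obtain j where "c n h j < (INF j. c n h j) + ennreal (\<epsilon> n)" by (auto simp: INF_less_iff)
    then show ?thesis unfolding jj_def by (intro LeastI) (rule less_imp_le)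
  next
    case True
    then show ?thesis by simp
  qed
  define u where "u n h = q (jj n h)" for n h
  have "(\<lambda>h. q (jj n h) i) \<in> borel_measurable M" for n i
    by (rule measurable_compose[OF jj_meas]) simp
  then obtain L where L: "\<And>i. (\<lambda>h. L h i) \<in> borel_measurable M"
    and L_lim: "\<And>h. \<exists>f. (\<forall>k::nat. k \<le> f k) \<and> (\<forall>i. (\<lambda>k. u (f k) h i) \<longlonglongrightarrow> L h i)"
    using measurable_cluster_point[of u M] q unfolding u_def by blast
  \<comment> \<open>A feasible competitor is approximated by grid points, which costs one
    \<epsilon>; the choice of \<open>jj\<close> costs the second.\<close>
  have near: "(\<forall>m\<le>n. G m h (u n h) < \<epsilon> n) \<and> (\<forall>m\<le>n. J m h (u n h) \<le> t + 2 * \<epsilon> n)"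
    if \<gamma>: "\<And>i. 0 \<le> \<gamma> i \<and> \<gamma> i \<le> 1" and G: "\<And>m. G m h \<gamma> \<le> 0" and J: "\<And>m. m \<le> n \<Longrightarrow> J m h \<gamma> \<le> t" for n h \<gamma> t
  proof -
    have t: "0 \<le> t" using J[of 0] J_nonneg[of \<gamma> 0 h] \<gamma> by force
    obtain f where f: "\<And>i. (\<lambda>k. q (f k) i) \<longlonglongrightarrow> \<gamma> i" using q_dense[of \<gamma>] \<gamma> by blast
    have "\<forall>\<^sub>F k in sequentially. \<forall>m\<in>{..n}. G m h (q (f k)) < \<epsilon> n \<and> J m h (q (f k)) < t + \<epsilon> n"
    proof (rule eventually_ball_finite)
      show "\<forall>m\<in>{..n}. \<forall>\<^sub>F k in sequentially. G m h (q (f k)) < \<epsilon> n \<and> J m h (q (f k)) < t + \<epsilon> n"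
      proof (intro ballI eventually_conj)
        fix m assume m: "m \<in> {..n}"
        show "\<forall>\<^sub>F k in sequentially. G m h (q (f k)) < \<epsilon> n"
          by (rule order_tendstoD(2)[OF seq_continuousD[OF G_cont f]]) (use G[of m] \<epsilon>_pos[of n] in linarith)
        show "\<forall>\<^sub>F k in sequentially. J m h (q (f k)) < t + \<epsilon> n"
          by (rule order_tendstoD(2)[OF seq_continuousD[OF J_cont f]]) (use J[of m] m \<epsilon>_pos[of n] in force)
      qed
    qed simp
    then obtain k where k: "\<forall>m\<in>{..n}. G m h (q (f k)) < \<epsilon> n \<and> J m h (q (f k)) < t + \<epsilon> n"
      using eventually_happens by force
    have "(INF j. c n h j) \<le> c n h (f k)" by (rule INF_lower) simp
    also have "\<dots> \<le> ennreal (t + \<epsilon> n)"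
    proof -
      have "(SUP m\<in>{..n}. ennreal (J m h (q (f k)))) \<le> ennreal (t + \<epsilon> n)"
        using k by (intro SUP_least ennreal_leI less_imp_le) auto
      then show ?thesis using k by (simp add: c_def)
    qed
    finally have "(INF j. c n h j) + ennreal (\<epsilon> n) \<le> ennreal (t + \<epsilon> n) + ennreal (\<epsilon> n)"
      by (rule add_right_mono)
    then have *: "c n h (jj n h) \<le> ennreal (t + 2 * \<epsilon> n)"
      using order_trans[OF jj[of n h]] t \<epsilon>_pos[of n] by (simp add: ennreal_plus[symmetric] add.commute del: ennreal_plus)
    then have "c n h (jj n h) \<noteq> \<infinity>" by (auto simp: top_unique)
    then have **: "\<forall>m\<in>{..n}. G m h (u n h) < \<epsilon> n" by (auto simp: c_def u_def split: if_splits)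
    have "ennreal (J m h (u n h)) \<le> ennreal (t + 2 * \<epsilon> n)" if "m \<le> n" for m
    proof -
      have "ennreal (J m h (u n h)) \<le> c n h (jj n h)"
        using ** that by (auto simp: c_def u_def intro: SUP_upper)
      then show ?thesis using * by (rule order_trans)
    qed
    moreover have "0 \<le> t + 2 * \<epsilon> n" using t \<epsilon>_pos[of n] by simp
    ultimately have "J m h (u n h) \<le> t + 2 * \<epsilon> n" if "m \<le> n" for m
      using that ennreal_le_iff by blast
    then show ?thesis using ** by auto
  qed
  have \<epsilon>_le: "\<epsilon> (f k) \<le> \<epsilon> k" if "k \<le> f k" for f :: "nat \<Rightarrow> nat" and k
    using that by (simp add: \<epsilon>_def frac_le)
  have \<epsilon>_lim: "\<epsilon> \<longlonglongrightarrow> 0" unfolding \<epsilon>_def by (rule LIMSEQ_Suc[OF lim_1_over_n])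
  show ?thesis
  proof (rule that[OF L])
    fix h i
    obtain f where f: "\<And>k::nat. k \<le> f k" "\<And>i. (\<lambda>k. u (f k) h i) \<longlonglongrightarrow> L h i" using L_lim[of h] by blast
    show "0 \<le> L h i \<and> L h i \<le> 1"
      using LIMSEQ_le_const[OF f(2)[of i]] LIMSEQ_le_const2[OF f(2)[of i]] q by (auto simp: u_def)
  next
    fix h \<gamma> m
    assume \<gamma>: "\<And>i. 0 \<le> \<gamma> i \<and> \<gamma> i \<le> 1" and G: "\<And>m. G m h \<gamma> \<le> 0"
    obtain f where f: "\<And>k::nat. k \<le> f k" "\<And>i. (\<lambda>k. u (f k) h i) \<longlonglongrightarrow> L h i" using L_lim[of h] by blast
    have "G m h (u (f k) h) \<le> \<epsilon> k" if k: "m \<le> k" for k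
    proof -
      \<comment> \<open>No bound on the objective is given here. Only finitely many indices enter at
        one stage, and their sum is a bound, which is all that \<open>near\<close> asks for.\<close>
      have "J m' h \<gamma> \<le> (\<Sum>i\<le>f k. J i h \<gamma>)" if "m' \<le> f k" for m'
        using that \<gamma> by (intro member_le_sum) (auto intro!: J_nonneg)
      from near[OF \<gamma> G this] have "G m h (u (f k) h) < \<epsilon> (f k)" using k f(1)[of k] by auto
      then show ?thesis using \<epsilon>_le[where f=f and k=k, OF f(1)] by linarith
    qed
    then show "G m h (L h) \<le> 0"
      by (intro LIMSEQ_le[OF seq_continuousD[OF G_cont f(2)] \<epsilon>_lim]) blast
  next
    fix h \<gamma> m t
    assume \<gamma>: "\<And>i. 0 \<le> \<gamma> i \<and> \<gamma> i \<le> 1" and G: "\<And>m. G m h \<gamma> \<le> 0" and J: "\<And>m. J m h \<gamma> \<le> t"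
    obtain f where f: "\<And>k::nat. k \<le> f k" "\<And>i. (\<lambda>k. u (f k) h i) \<longlonglongrightarrow> L h i" using L_lim[of h] by blast
    have "J m h (u (f k) h) \<le> t + 2 * \<epsilon> k" if k: "m \<le> k" for k
    proof -
      from near[OF \<gamma> G J, of "f k"] have "J m h (u (f k) h) \<le> t + 2 * \<epsilon> (f k)" using k f(1)[of k] by auto
      then show ?thesis using \<epsilon>_le[where f=f and k=k, OF f(1)] by linarith
    qed
    moreover have "(\<lambda>k. t + 2 * \<epsilon> k) \<longlonglongrightarrow> t + 2 * 0" by (intro tendsto_intros \<epsilon>_lim)
    ultimately show "J m h (L h) \<le> t"
      by (intro LIMSEQ_le[OF seq_continuousD[OF J_cont f(2)]]) auto
  qed
qed

section \<open>Measurable selection of optimal couplings\<close>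

definition evens :: "(nat \<Rightarrow> bool) \<Rightarrow> nat \<Rightarrow> bool" where
  "evens s = (\<lambda>n. s (2 * n))"

definition odds :: "(nat \<Rightarrow> bool) \<Rightarrow> nat \<Rightarrow> bool" where
  "odds s = (\<lambda>n. s (2 * n + 1))"

text \<open>Codes a pair of bit sequences as one, so that couplings become laws on
  \<open>bits\<close> again, with marginals seen through \<open>evens\<close> and
  \<open>odds\<close>.\<close>

definition interleave :: "(nat \<Rightarrow> bool) \<Rightarrow> (nat \<Rightarrow> bool) \<Rightarrow> nat \<Rightarrow> bool" where
  "interleave s t = (\<lambda>n. if even n then s (n div 2) else t (n div 2))"

text \<open>The cylinders of these words partition the preimage of \<open>cyl v\<close> under
  \<open>evens\<close>. A prescribed marginal thus becomes a family of finite linear equations in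
  the cylinder probabilities.\<close>

definition even_words :: "bool list \<Rightarrow> bool list set" where
  "even_words v = {w. length w = 2 * length v \<and> (\<forall>i<length v. w ! (2 * i) = v ! i)}"

definition odd_words :: "bool list \<Rightarrow> bool list set" where
  "odd_words v = {w. length w = 2 * length v \<and> (\<forall>i<length v. w ! (2 * i + 1) = v ! i)}"

lemma evens_interleave [simp]: "evens (interleave s t) = s"
  by (simp add: evens_def interleave_def)

lemma odds_interleave [simp]: "odds (interleave s t) = t"
  by (simp add: odds_def interleave_def)

lemma interleave_evens_odds: "interleave (evens s) (odds s) = s"
  by (auto simp: evens_def odds_def interleave_def fun_eq_iff elim!: oddE)

lemma measurable_evens [measurable]: "evens \<in> bits \<rightarrow>\<^sub>M bits"
  by (rule measurable_bitsI) (simp add: evens_def measurable_bit)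

lemma measurable_odds [measurable]: "odds \<in> bits \<rightarrow>\<^sub>M bits"
  by (rule measurable_bitsI) (simp add: odds_def measurable_bit)

lemma measurable_interleave [measurable (raw)]:
  assumes [measurable]: "f \<in> M \<rightarrow>\<^sub>M bits" "g \<in> M \<rightarrow>\<^sub>M bits"
  shows "(\<lambda>x. interleave (f x) (g x)) \<in> M \<rightarrow>\<^sub>M bits"
proof (rule measurable_bitsI)
  fix n
  have "(\<lambda>x. f x (n div 2)) \<in> M \<rightarrow>\<^sub>M count_space UNIV" "(\<lambda>x. g x (n div 2)) \<in> M \<rightarrow>\<^sub>M count_space UNIV"
    by (rule measurable_compose[OF _ measurable_bit], fact)+
  then show "Measurable.pred M (\<lambda>x. interleave (f x) (g x) n)" by (simp add: interleave_def)
qed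

lemma finite_words: "finite {w :: bool list. length w = n}"
  using finite_lists_length_eq[of "UNIV :: bool set" n] by simp

lemma finite_even_odd_words: "finite (even_words v)" "finite (odd_words v)"
  by (rule finite_subset[OF _ finite_words[of "2 * length v"]], auto simp: even_words_def odd_words_def)+

lemma disjoint_cyl: "length v = length w \<Longrightarrow> v \<noteq> w \<Longrightarrow> cyl v \<inter> cyl w = {}"
  by (auto simp: cyl_def)

lemma vimage_evens_cyl: "evens -` cyl v = (\<Union>w\<in>even_words v. cyl w)"
proof (rule set_eqI)
  fix s
  have "length (prefix_of (2 * length v) s) = 2 * length v"
    "\<And>i. i < 2 * length v \<Longrightarrow> prefix_of (2 * length v) s ! i = s i"
    by (simp_all add: prefix_of_def)
  then show "s \<in> evens -` cyl v \<longleftrightarrow> s \<in> (\<Union>w\<in>even_words v. cyl w)"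
    by (auto simp: in_cyl_iff evens_def even_words_def intro!: exI[of _ "prefix_of (2 * length v) s"])
qed

lemma vimage_odds_cyl: "odds -` cyl v = (\<Union>w\<in>odd_words v. cyl w)"
proof (rule set_eqI)
  fix s
  have "length (prefix_of (2 * length v) s) = 2 * length v"
    "\<And>i. i < 2 * length v \<Longrightarrow> prefix_of (2 * length v) s ! i = s i"
    by (simp_all add: prefix_of_def)
  then show "s \<in> odds -` cyl v \<longleftrightarrow> s \<in> (\<Union>w\<in>odd_words v. cyl w)"
    by (auto simp: in_cyl_iff odds_def odd_words_def intro!: exI[of _ "prefix_of (2 * length v) s"])
qed

lemma measure_UN_cyl:
  assumes "prob_space N" and [simp]: "sets N = sets bits"
    and "finite W" "\<And>w. w \<in> W \<Longrightarrow> length w = n"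
  shows "measure N (\<Union>w\<in>W. cyl w) = (\<Sum>w\<in>W. measure N (cyl w))"
proof -
  interpret prob_space N by fact
  show ?thesis
    using assms disjoint_cyl
    by (intro finite_measure_finite_Union) (auto simp: disjoint_family_on_def)
qed

text \<open>A function of the first \<open>n\<close> bits integrates to a finite linear form in the
  cylinder probabilities, which is continuous under pointwise convergence.\<close>

lemma nn_integral_prefix:
  assumes "prob_space N" and sN[simp, measurable_cong]: "sets N = sets bits" and f: "\<And>w. 0 \<le> f w"
  shows "(\<integral>\<^sup>+s. ennreal (f (prefix_of n s)) \<partial>N) = ennreal (\<Sum>w | length w = n. f w * measure N (cyl w))"
proof -
  interpret prob_space N by fact
  have "(\<integral>\<^sup>+s. ennreal (f (prefix_of n s)) \<partial>N) = (\<integral>\<^sup>+s. (\<Sum>w | length w = n. ennreal (f w) * indicator (cyl w) s) \<partial>N)"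
  proof (rule nn_integral_cong)
    fix s
    have "(\<Sum>w | length w = n. ennreal (f w) * indicator (cyl w) s)
      = (\<Sum>w | length w = n. if prefix_of n s = w then ennreal (f w) else 0)"
      by (rule sum.cong) (auto simp: cyl_def split: split_indicator)
    also have "\<dots> = ennreal (f (prefix_of n s))"
      using finite_words by (simp add: sum.delta')
    finally show "ennreal (f (prefix_of n s)) = (\<Sum>w | length w = n. ennreal (f w) * indicator (cyl w) s)" by simp
  qed
  also have "\<dots> = (\<Sum>w | length w = n. ennreal (f w) * emeasure N (cyl w))"
    using sets_cyl by (subst nn_integral_sum) (auto simp: nn_integral_cmult_indicator)
  also have "\<dots> = ennreal (\<Sum>w | length w = n. f w * measure N (cyl w))"
    using f by (simp add: emeasure_eq_measure ennreal_mult[symmetric] sum_ennreal)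
  finally show ?thesis .
qed

text \<open>In terms of cylinder probabilities of the interleaved code, couplings satisfy countably
  many linear equations that are measurable in \<open>h\<close>, and the cost is a supremum of
  linear forms. \<open>measurable_argmin\<close> then applies, and its output is sampled and
  decoded.\<close>

theorem measurable_optimal_coupling:
  fixes c :: "'a::polish_space \<Rightarrow> 'a \<Rightarrow> real" and H :: "'h measure"
  assumes c_cont: "continuous_on UNIV (\<lambda>z. c (fst z) (snd z))" and c_nonneg: "\<And>x y. 0 \<le> c x y"
    and A: "A \<in> H \<rightarrow>\<^sub>M prob_algebra borel" and B: "B \<in> H \<rightarrow>\<^sub>M prob_algebra borel"
  obtains \<kappa> where "\<kappa> \<in> H \<rightarrow>\<^sub>M prob_algebra (borel \<Otimes>\<^sub>M borel)"
    "\<And>h. h \<in> space H \<Longrightarrow> \<kappa> h \<in> couplings (A h) (B h)"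
    "\<And>h \<gamma>. h \<in> space H \<Longrightarrow> \<gamma> \<in> couplings (A h) (B h) \<Longrightarrow>
      (\<integral>\<^sup>+(x, y). ennreal (c x y) \<partial>\<kappa> h) \<le> (\<integral>\<^sup>+(x, y). ennreal (c x y) \<partial>\<gamma>)"
proof -
  obtain e d where ed: "coded (borel :: 'a measure) e d"
    and cell_small: "\<And>x r. 0 < r \<Longrightarrow> \<exists>n. \<forall>y. prefix_of n (e y) = prefix_of n (e x) \<longrightarrow> dist x y < r"
    by (rule coded_polish) blast
  have e[measurable]: "e \<in> borel \<rightarrow>\<^sub>M bits" and d[measurable]: "d \<in> bits \<rightarrow>\<^sub>M borel" and de: "\<And>x. d (e x) = x"
    using ed by (auto simp: coded_def)
  have c_meas[measurable]: "(\<lambda>z. c (fst z) (snd z)) \<in> borel_measurable (borel \<Otimes>\<^sub>M borel)"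
    unfolding borel_prod by (rule borel_measurable_continuous_onI[OF c_cont])
  define code where "code z = interleave (e (fst z)) (e (snd z))" for z
  have code[measurable]: "code \<in> borel \<Otimes>\<^sub>M borel \<rightarrow>\<^sub>M bits" unfolding code_def by measurable
  define D where "D s = (d (evens s), d (odds s))" for s
  have D[measurable]: "D \<in> bits \<rightarrow>\<^sub>M borel \<Otimes>\<^sub>M borel" unfolding D_def by measurable
  define cell where "cell w = {z. code z \<in> cyl w}" for w
  \<comment> \<open>The infimum of the cost over the pairs whose code starts with \<open>w\<close>.
    Some words start no code; for these 0 is a default that keeps the linear forms below
    nonnegative.\<close>
  define cmin where "cmin w = (if cell w = {} then 0 else INF z\<in>cell w. c (fst z) (snd z))" for w
  have bdd: "bdd_below ((\<lambda>z. c (fst z) (snd z)) ` S)" for S by (rule bdd_belowI2[of _ 0]) (simp add: c_nonneg)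
  have cmin_nonneg: "0 \<le> cmin w" for w
    using c_nonneg by (auto simp: cmin_def intro: cINF_greatest)
  have in_cell: "z \<in> cell (prefix_of n (code z))" for n z by (simp add: cell_def cyl_def)
  have cmin_le: "cmin (prefix_of n (code z)) \<le> c (fst z) (snd z)" for n z
    using in_cell[of z n] by (auto simp: cmin_def intro: cINF_lower[OF bdd])
  have cmin_mono: "cmin (prefix_of n (code z)) \<le> cmin (prefix_of m (code z))" if "n \<le> m" for n m z
  proof -
    have "cell (prefix_of m (code z)) \<subseteq> cell (prefix_of n (code z))"
      using that by (auto simp: cell_def cyl_def prefix_of_eq_iff)
    then show ?thesis
      using in_cell[of z m] in_cell[of z n] cINF_superset_mono[OF _ bdd, of "cell (prefix_of m (code z))" "cell (prefix_of n (code z))" "\<lambda>z. c (fst z) (snd z)"]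
      by (auto simp: cmin_def)
  qed
  \<comment> \<open>The cells around \<open>z\<close> shrink to \<open>z\<close> and the cost is
    continuous there, so the infima increase to its value.\<close>
  have SUP_cmin: "(SUP n. ennreal (cmin (prefix_of n (code z)))) = ennreal (c (fst z) (snd z))" for z
  proof (rule antisym)
    show "(SUP n. ennreal (cmin (prefix_of n (code z)))) \<le> ennreal (c (fst z) (snd z))"
      by (intro SUP_least ennreal_leI cmin_le)
    show "ennreal (c (fst z) (snd z)) \<le> (SUP n. ennreal (cmin (prefix_of n (code z))))"
    proof (rule ennreal_le_epsilon)
      fix \<epsilon> :: real assume \<epsilon>: "0 < \<epsilon>"
      obtain \<delta> where \<delta>: "\<delta> > 0" "\<And>z'. dist z' z < \<delta> \<Longrightarrow> dist (c (fst z') (snd z')) (c (fst z) (snd z)) < \<epsilon>"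
        using c_cont \<epsilon> unfolding continuous_on_iff by fast
      obtain n1 where n1: "\<And>y. prefix_of n1 (e y) = prefix_of n1 (e (fst z)) \<Longrightarrow> dist (fst z) y < \<delta> / 2"
        using cell_small[of "\<delta> / 2" "fst z"] \<delta>(1) by auto
      obtain n2 where n2: "\<And>y. prefix_of n2 (e y) = prefix_of n2 (e (snd z)) \<Longrightarrow> dist (snd z) y < \<delta> / 2"
        using cell_small[of "\<delta> / 2" "snd z"] \<delta>(1) by auto
      \<comment> \<open>Because of the interleaving, a prefix of this length contains the first
        \<open>n1\<close> bits of one component and the first \<open>n2\<close> bits of the
        other.\<close>
      define n where "n = 2 * max n1 n2 + 2"
      have "c (fst z) (snd z) - \<epsilon> \<le> cmin (prefix_of n (code z))"
      proof -
        have "c (fst z) (snd z) - \<epsilon> \<le> c (fst z') (snd z')" if "z' \<in> cell (prefix_of n (code z))" for z'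
        proof -
          have eq: "code z' i = code z i" if "i < n" for i
            using that \<open>z' \<in> cell (prefix_of n (code z))\<close> by (auto simp: cell_def cyl_def prefix_of_eq_iff)
          have "e (fst z') i = e (fst z) i" if "i < n1" for i
          proof -
            have "code z' (2 * i) = code z (2 * i)" using that by (intro eq) (auto simp: n_def)
            then show ?thesis by (simp add: code_def interleave_def)
          qed
          then have 1: "dist (fst z) (fst z') < \<delta> / 2" by (intro n1) (simp add: prefix_of_eq_iff)
          have "e (snd z') i = e (snd z) i" if "i < n2" for i
          proof -
            have "code z' (2 * i + 1) = code z (2 * i + 1)" using that by (intro eq) (auto simp: n_def)
            then show ?thesis by (simp add: code_def interleave_def)
          qed
          then have 2: "dist (snd z) (snd z') < \<delta> / 2" by (intro n2) (simp add: prefix_of_eq_iff)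
          have "dist z' z \<le> dist (fst z') (fst z) + dist (snd z') (snd z)"
            unfolding dist_prod_def by (rule sqrt_sum_squares_le_sum) auto
          then have "dist z' z < \<delta>" using 1 2 by (simp add: dist_commute)
          from \<delta>(2)[OF this] show ?thesis by (simp add: dist_real_def)
        qed
        then show ?thesis using in_cell[of z n] by (auto simp: cmin_def intro!: cINF_greatest)
      qed
      then have "ennreal (c (fst z) (snd z)) \<le> ennreal (cmin (prefix_of n (code z))) + ennreal \<epsilon>"
        using \<epsilon> cmin_nonneg by (simp add: ennreal_plus[symmetric] ennreal_leI del: ennreal_plus)
      also have "\<dots> \<le> (SUP n. ennreal (cmin (prefix_of n (code z)))) + ennreal \<epsilon>"
        by (intro add_right_mono SUP_upper) simp
      finally show "ennreal (c (fst z) (snd z)) \<le> (SUP n. ennreal (cmin (prefix_of n (code z)))) + ennreal \<epsilon>" .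
    qed
  qed
  have cost_eq: "(\<integral>\<^sup>+(x, y). ennreal (c x y) \<partial>\<gamma>) = (SUP n. \<integral>\<^sup>+z. ennreal (cmin (prefix_of n (code z))) \<partial>\<gamma>)"
    if [measurable_cong]: "sets \<gamma> = sets (borel \<Otimes>\<^sub>M borel)" for \<gamma> :: "('a \<times> 'a) measure"
  proof -
    have "(\<integral>\<^sup>+(x, y). ennreal (c x y) \<partial>\<gamma>) = (\<integral>\<^sup>+z. (SUP n. ennreal (cmin (prefix_of n (code z)))) \<partial>\<gamma>)"
      by (intro nn_integral_cong) (simp add: SUP_cmin split_beta)
    also have "\<dots> = (SUP n. \<integral>\<^sup>+z. ennreal (cmin (prefix_of n (code z))) \<partial>\<gamma>)"
      by (intro nn_integral_monotone_convergence_SUP)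
        (auto simp: incseq_def le_fun_def intro!: ennreal_leI cmin_mono)
    finally show ?thesis .
  qed
  define a where "a h v = measure (A h) (e -` cyl v)" for h v
  define b where "b h v = measure (B h) (e -` cyl v)" for h v
  have e_cyl: "e -` cyl v \<in> sets borel" for v using measurable_sets[OF e sets_cyl[of v]] by simp
  have [measurable]: "(\<lambda>h. a h v) \<in> borel_measurable H" "(\<lambda>h. b h v) \<in> borel_measurable H" for v
    unfolding a_def b_def
    using measurable_compose[OF A measurable_measure_prob_algebra[OF e_cyl]]
      measurable_compose[OF B measurable_measure_prob_algebra[OF e_cyl]] by auto
  \<comment> \<open>Four families of linear equations: total mass, additivity, first marginal,
    second marginal. Absolute values turn each equation into a constraint of the form
    \<open>\<le> 0\<close>; \<open>G\<close> then enumerates all pairs \<open>(k, w)\<close> by one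
    index.\<close>
  define G0 where "G0 k w h \<gamma> = (if k = 0 then \<bar>\<gamma> [] - 1\<bar>
    else if k = 1 then \<bar>\<gamma> w - (\<gamma> (w @ [False]) + \<gamma> (w @ [True]))\<bar>
    else if k = 2 then \<bar>(\<Sum>w\<in>even_words w. \<gamma> w) - a h w\<bar>
    else \<bar>(\<Sum>w\<in>odd_words w. \<gamma> w) - b h w\<bar>)" for k :: nat and w h and \<gamma> :: "bool list \<Rightarrow> real"
  define G where "G m = (case from_nat m of (k, w) \<Rightarrow> G0 k w)" for m
  define J where "J n \<gamma> = (\<Sum>w | length w = n. cmin w * \<gamma> w)" for n and \<gamma> :: "bool list \<Rightarrow> real"
  have G_all: "(\<forall>m. G m h \<gamma> \<le> 0) \<longleftrightarrow> (\<gamma> [] = 1 \<and> (\<forall>w. \<gamma> w = \<gamma> (w @ [False]) + \<gamma> (w @ [True]))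
    \<and> (\<forall>v. (\<Sum>w\<in>even_words v. \<gamma> w) = a h v) \<and> (\<forall>v. (\<Sum>w\<in>odd_words v. \<gamma> w) = b h v))" for h \<gamma>
  proof -
    have "(\<forall>m. G m h \<gamma> \<le> 0) \<longleftrightarrow> (\<forall>k w. G0 k w h \<gamma> \<le> 0)"
    proof
      assume *: "\<forall>m. G m h \<gamma> \<le> 0"
      show "\<forall>k w. G0 k w h \<gamma> \<le> 0"
      proof (intro allI)
        fix k w show "G0 k w h \<gamma> \<le> 0" using *[rule_format, of "to_nat (k, w)"] by (simp add: G_def)
      qed
    next
      assume "\<forall>k w. G0 k w h \<gamma> \<le> 0"
      then show "\<forall>m. G m h \<gamma> \<le> 0" by (simp add: G_def split: prod.split)
    qed
    also have "\<dots> \<longleftrightarrow> (\<forall>w. G0 0 w h \<gamma> \<le> 0) \<and> (\<forall>w. G0 1 w h \<gamma> \<le> 0) \<and> (\<forall>w. G0 2 w h \<gamma> \<le> 0) \<and> (\<forall>w. G0 3 w h \<gamma> \<le> 0)"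
    proof -
      have "G0 k w h \<gamma> = G0 0 w h \<gamma> \<or> G0 k w h \<gamma> = G0 1 w h \<gamma> \<or> G0 k w h \<gamma> = G0 2 w h \<gamma> \<or> G0 k w h \<gamma> = G0 3 w h \<gamma>" for k w
        unfolding G0_def by simp
      then show ?thesis by metis
    qed
    finally show ?thesis by (simp add: G0_def)
  qed
  obtain L :: "'h \<Rightarrow> bool list \<Rightarrow> real" where L_meas[measurable]: "\<And>w. (\<lambda>h. L h w) \<in> borel_measurable H"
    and L01: "\<And>h w. 0 \<le> L h w \<and> L h w \<le> 1"
    and LG: "\<And>h \<gamma> m. (\<And>i. 0 \<le> \<gamma> i \<and> \<gamma> i \<le> 1) \<Longrightarrow> (\<And>m. G m h \<gamma> \<le> 0) \<Longrightarrow> G m h (L h) \<le> 0"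
    and LJ: "\<And>h \<gamma> n t. (\<And>i. 0 \<le> \<gamma> i \<and> \<gamma> i \<le> 1) \<Longrightarrow> (\<And>m. G m h \<gamma> \<le> 0) \<Longrightarrow> (\<And>n. J n \<gamma> \<le> t) \<Longrightarrow> J n (L h) \<le> t"
  proof (rule measurable_argmin[of G H "\<lambda>n h. J n"])
    fix m h \<gamma>
    show "(\<lambda>h. G m h \<gamma>) \<in> borel_measurable H"
      unfolding G_def G0_def by (simp split: prod.split)
    show "seq_continuous (G m h)"
      unfolding seq_continuous_def G_def G0_def
      by (auto split: prod.split intro!: tendsto_intros)
    show "(\<lambda>h. J m \<gamma>) \<in> borel_measurable H" by simp
    show "seq_continuous (J m)"
      unfolding seq_continuous_def J_def by (auto intro!: tendsto_intros)
    show "0 \<le> J m \<gamma>" if "\<And>i. 0 \<le> \<gamma> i"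
      unfolding J_def using that cmin_nonneg by (intro sum_nonneg mult_nonneg_nonneg) auto
  qed blast
  \<comment> \<open>Every coupling yields a feasible point with the same approximate costs, so it is
    an admissible competitor.\<close>
  have coup: "\<exists>p. (\<forall>i. 0 \<le> p i \<and> p i \<le> 1) \<and> (\<forall>m. G m h p \<le> 0) \<and>
      (\<forall>n. (\<integral>\<^sup>+z. ennreal (cmin (prefix_of n (code z))) \<partial>\<gamma>) = ennreal (J n p))"
    if h: "h \<in> space H" and \<gamma>: "\<gamma> \<in> couplings (A h) (B h)" for h \<gamma>
  proof -
    have pA: "prob_space (A h)" "sets (A h) = sets borel" and pB: "prob_space (B h)" "sets (B h) = sets borel"
      using measurable_space[OF A h] measurable_space[OF B h] by (auto simp: space_prob_algebra)
    have s\<gamma>[measurable_cong]: "sets \<gamma> = sets (borel \<Otimes>\<^sub>M borel)"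
      and f: "distr \<gamma> (A h) fst = A h" "distr \<gamma> (B h) snd = B h"
      using \<gamma> pA pB by (auto simp: couplings_def cong: sets_pair_measure_cong)
    have "fst \<in> \<gamma> \<rightarrow>\<^sub>M A h" by (simp add: pA cong: measurable_cong_sets)
    then have prob\<gamma>: "prob_space \<gamma>" using pA(1) f(1) prob_space_distrD by metis
    define N where "N = distr \<gamma> bits code"
    have N: "prob_space N" "sets N = sets bits"
    proof -
      have "code \<in> \<gamma> \<rightarrow>\<^sub>M bits" by measurable
      from prob_space.prob_space_distr[OF prob\<gamma> this] show "prob_space N" by (simp add: N_def)
    qed (simp add: N_def)
    interpret N: prob_space N by fact
    define p where "p w = measure N (cyl w)" for w
    have N_evens: "measure N (evens -` cyl v) = a h v" for v
    proof -
      have "measure N (evens -` cyl v) = measure \<gamma> (fst -` (e -` cyl v) \<inter> space \<gamma>)"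
        unfolding N_def using measurable_sets[OF measurable_evens sets_cyl[of v]]
        by (subst measure_distr) (auto simp: code_def vimage_def intro!: arg_cong[where f="measure \<gamma>"])
      also have "\<dots> = measure (distr \<gamma> (A h) fst) (e -` cyl v)"
        using e_cyl pA by (subst measure_distr) (auto cong: measurable_cong_sets)
      finally show ?thesis by (simp add: f a_def)
    qed
    have N_odds: "measure N (odds -` cyl v) = b h v" for v
    proof -
      have "measure N (odds -` cyl v) = measure \<gamma> (snd -` (e -` cyl v) \<inter> space \<gamma>)"
        unfolding N_def using measurable_sets[OF measurable_odds sets_cyl[of v]]
        by (subst measure_distr) (auto simp: code_def vimage_def intro!: arg_cong[where f="measure \<gamma>"])
      also have "\<dots> = measure (distr \<gamma> (B h) snd) (e -` cyl v)"
        using e_cyl pB by (subst measure_distr) (auto cong: measurable_cong_sets)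
      finally show ?thesis by (simp add: f b_def)
    qed
    have "\<forall>m. G m h p \<le> 0"
      unfolding G_all
    proof (intro conjI allI)
      have "space N = UNIV" using sets_eq_imp_space_eq[OF N(2)] by simp
      then show "p [] = 1" using N.prob_space by (simp add: p_def)
      show "p w = p (w @ [False]) + p (w @ [True])" for w
        unfolding p_def using cyl_split[of w] N by (simp add: N.finite_measure_Union)
      show "(\<Sum>w\<in>even_words v. p w) = a h v" for v
        unfolding p_def N_evens[symmetric] vimage_evens_cyl
        by (rule measure_UN_cyl[OF N finite_even_odd_words(1), symmetric]) (simp add: even_words_def)
      show "(\<Sum>w\<in>odd_words v. p w) = b h v" for v
        unfolding p_def N_odds[symmetric] vimage_odds_cyl
        by (rule measure_UN_cyl[OF N finite_even_odd_words(2), symmetric]) (simp add: odd_words_def)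
    qed
    moreover have "(\<integral>\<^sup>+z. ennreal (cmin (prefix_of n (code z))) \<partial>\<gamma>) = ennreal (J n p)" for n
    proof -
      have "(\<integral>\<^sup>+z. ennreal (cmin (prefix_of n (code z))) \<partial>\<gamma>) = (\<integral>\<^sup>+s. ennreal (cmin (prefix_of n s)) \<partial>N)"
        unfolding N_def by (subst nn_integral_distr) auto
      then show ?thesis unfolding J_def p_def using nn_integral_prefix[where N=N and f=cmin and n=n, OF N cmin_nonneg] by simp
    qed
    moreover have "\<forall>i. 0 \<le> p i \<and> p i \<le> 1" by (simp add: p_def)
    ultimately show ?thesis by blast
  qed
  define N where "N h = distr unif bits (sample (L h))" for h
  have unif_in: "unif \<in> space (prob_algebra unif)" by (simp add: space_prob_algebra prob_space_unif)
  have "(\<lambda>(h, u). sample (L h) u) \<in> H \<Otimes>\<^sub>M unif \<rightarrow>\<^sub>M bits"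
    unfolding split_beta by (rule measurable_sample) measurable
  then have N_meas: "N \<in> H \<rightarrow>\<^sub>M prob_algebra bits"
    unfolding N_def by (intro measurable_distr_prob_space2[where M=unif]) (use unif_in in simp)
  define \<kappa> where "\<kappa> h = distr (N h) (borel \<Otimes>\<^sub>M borel) D" for h
  have facts: "\<kappa> h \<in> couplings (A h) (B h) \<and> (\<forall>\<gamma>\<in>couplings (A h) (B h).
      (\<integral>\<^sup>+(x, y). ennreal (c x y) \<partial>\<kappa> h) \<le> (\<integral>\<^sup>+(x, y). ennreal (c x y) \<partial>\<gamma>))" if h: "h \<in> space H" for h
  proof -
    have pA: "prob_space (A h)" "sets (A h) = sets borel" and pB: "prob_space (B h)" "sets (B h) = sets borel"
      using measurable_space[OF A h] measurable_space[OF B h] by (auto simp: space_prob_algebra)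
    have spA: "space (A h) = UNIV" "space (B h) = UNIV"
      using sets_eq_imp_space_eq[OF pA(2)] sets_eq_imp_space_eq[OF pB(2)] by simp_all
    interpret pA: prob_space "A h" by fact
    interpret pB: prob_space "B h" by fact
    interpret pair_prob_space "A h" "B h" ..
    have "distr (A h \<Otimes>\<^sub>M B h) (B h) snd = B h"
    proof (rule measure_eqI)
      fix X assume "X \<in> sets (distr (A h \<Otimes>\<^sub>M B h) (B h) snd)"
      then have X: "X \<in> sets (B h)" by simp
      have "snd -` X \<inter> space (A h \<Otimes>\<^sub>M B h) = space (A h) \<times> X"
        using sets.sets_into_space[OF X] by (auto simp: space_pair_measure)
      then show "emeasure (distr (A h \<Otimes>\<^sub>M B h) (B h) snd) X = emeasure (B h) X"
        using X pB.emeasure_pair_measure_Times[of "space (A h)" "A h" X] pA.emeasure_space_1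
        by (simp add: emeasure_distr)
    qed simp
    then have "A h \<Otimes>\<^sub>M B h \<in> couplings (A h) (B h)"
      unfolding couplings_def by (simp add: pB.distr_pair_fst)
    \<comment> \<open>The product coupling shows that the constraints can be met, which is what
      makes the selected point feasible.\<close>
    from coup[OF h this] obtain p0 where "\<forall>i. 0 \<le> p0 i \<and> p0 i \<le> 1" "\<forall>m. G m h p0 \<le> 0" by blast
    then have "\<forall>m. G m h (L h) \<le> 0" using LG by blast
    note GL = this[unfolded G_all]
    have GLe: "(\<Sum>w\<in>even_words v. L h w) = a h v" and GLo: "(\<Sum>w\<in>odd_words v. L h w) = b h v" for v
      using GL by blast+
    have cons: "consistent (L h)" unfolding consistent_def using GL L01 by blast
    have N: "prob_space (N h)" "sets (N h) = sets bits"
      using measurable_space[OF N_meas h] by (auto simp: space_prob_algebra)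
    note N(2)[measurable_cong]
    interpret N: prob_space "N h" by (rule N(1))
    have N_cyl: "measure (N h) (cyl w) = L h w" for w
      using emeasure_sample[OF cons, of w] L01[of h w] by (simp add: N_def measure_def)
    have dist_eq: "distr (N h) bits g = distr K bits e"
      if K: "prob_space K" "sets K = sets borel" and g: "g \<in> bits \<rightarrow>\<^sub>M bits"
        and eq: "\<And>v. measure (N h) (g -` cyl v) = measure K (e -` cyl v)" for g and K :: "'a measure"
    proof (rule measure_eqI_cyl)
      interpret K: prob_space K by fact
      have gN: "g \<in> N h \<rightarrow>\<^sub>M bits" using g by (simp add: N cong: measurable_cong_sets)
      have eK: "e \<in> K \<rightarrow>\<^sub>M bits" using e by (simp add: K cong: measurable_cong_sets)
      interpret g: prob_space "distr (N h) bits g" by (rule N.prob_space_distr[OF gN])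
      show "emeasure (distr (N h) bits g) UNIV \<noteq> \<infinity>" by simp
      fix v
      have "space (N h) = UNIV" "space K = UNIV"
        using sets_eq_imp_space_eq[OF N(2)] sets_eq_imp_space_eq[OF K(2)] by simp_all
      then show "emeasure (distr (N h) bits g) (cyl v) = emeasure (distr K bits e) (cyl v)"
        using gN eK eq[of v] by (simp add: emeasure_distr N.emeasure_eq_measure K.emeasure_eq_measure)
    qed simp_all
    have N_ev: "distr (N h) bits evens = distr (A h) bits e"
    proof (rule dist_eq[OF pA measurable_evens])
      show "measure (N h) (evens -` cyl v) = measure (A h) (e -` cyl v)" for v
        using measure_UN_cyl[OF N finite_even_odd_words(1), of v "2 * length v"] GLe
        by (simp add: vimage_evens_cyl N_cyl a_def even_words_def)
    qed
    have N_od: "distr (N h) bits odds = distr (B h) bits e"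
    proof (rule dist_eq[OF pB measurable_odds])
      show "measure (N h) (odds -` cyl v) = measure (B h) (e -` cyl v)" for v
        using measure_UN_cyl[OF N finite_even_odd_words(2), of v "2 * length v"] GLo
        by (simp add: vimage_odds_cyl N_cyl b_def odd_words_def)
    qed
    have push: "distr (distr (N h) bits g) borel d = K"
      if K: "sets K = sets borel" and eq: "distr (N h) bits g = distr K bits e" for g and K :: "'a measure"
    proof -
      have "distr (distr K bits e) borel d = distr K borel (d \<circ> e)"
        by (rule distr_distr) (simp_all add: K cong: measurable_cong_sets)
      also have "\<dots> = distr K K (\<lambda>x. x)" by (rule distr_cong) (simp_all add: K de)
      finally show ?thesis using eq by (simp add: distr_id)
    qed
    have s\<kappa>: "sets (\<kappa> h) = sets (borel \<Otimes>\<^sub>M borel)" by (simp add: \<kappa>_def)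
    have "distr (\<kappa> h) (A h) fst = A h"
    proof -
      have "distr (\<kappa> h) (A h) fst = distr (\<kappa> h) borel fst" by (rule distr_cong) (simp_all add: pA)
      also have "\<dots> = distr (distr (N h) bits evens) borel d"
        unfolding \<kappa>_def by (simp add: distr_distr comp_def D_def)
      finally show ?thesis using push[OF pA(2) N_ev] by simp
    qed
    moreover have "distr (\<kappa> h) (B h) snd = B h"
    proof -
      have "distr (\<kappa> h) (B h) snd = distr (\<kappa> h) borel snd" by (rule distr_cong) (simp_all add: pB)
      also have "\<dots> = distr (distr (N h) bits odds) borel d"
        unfolding \<kappa>_def by (simp add: distr_distr comp_def D_def)
      finally show ?thesis using push[OF pB(2) N_od] by simp
    qed
    moreover have "sets (\<kappa> h) = sets (A h \<Otimes>\<^sub>M B h)"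
      unfolding s\<kappa> by (rule sets_pair_measure_cong) (simp_all add: pA pB)
    ultimately have c1: "\<kappa> h \<in> couplings (A h) (B h)" by (simp add: couplings_def)
    \<comment> \<open>Here it is seen that no mass is lost: the marginal of the sampled sequence is
      the law of the code of a point, hence is carried by genuine codes, on which \<open>e\<close>
      undoes \<open>d\<close>.\<close>
    have AE_e: "AE s in N h. e (d (g s)) = g s"
      if K: "sets K = sets borel" and g: "g \<in> bits \<rightarrow>\<^sub>M bits" and eq: "distr (N h) bits g = distr K bits e"
      for g and K :: "'a measure"
    proof -
      have [measurable]: "(\<lambda>t. e (d t)) \<in> bits \<rightarrow>\<^sub>M bits" by measurable
      have [measurable]: "Measurable.pred bits (\<lambda>t. e (d t) n)" for n
        by (rule measurable_compose[OF _ measurable_bit]) measurable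
      have P: "{t \<in> space bits. e (d t) = t} \<in> sets bits"
        unfolding fun_eq_iff using measurable_bit by measurable
      have "AE t in distr K bits e. e (d t) = t"
        using P by (subst AE_distr_iff) (simp_all add: K de cong: measurable_cong_sets)
      then show ?thesis using P g unfolding eq[symmetric]
        by (subst (asm) AE_distr_iff) (simp_all add: N cong: measurable_cong_sets)
    qed
    have AE_code: "AE s in N h. code (D s) = s"
      using AE_e[OF pA(2) measurable_evens N_ev] AE_e[OF pB(2) measurable_odds N_od]
      by eventually_elim (simp add: code_def D_def interleave_evens_odds)
    have int\<kappa>: "(\<integral>\<^sup>+z. ennreal (cmin (prefix_of n (code z))) \<partial>\<kappa> h) = ennreal (J n (L h))" for n
    proof -
      have "(\<integral>\<^sup>+z. ennreal (cmin (prefix_of n (code z))) \<partial>\<kappa> h) = (\<integral>\<^sup>+s. ennreal (cmin (prefix_of n (code (D s)))) \<partial>N h)"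
        unfolding \<kappa>_def by (subst nn_integral_distr) auto
      also have "\<dots> = (\<integral>\<^sup>+s. ennreal (cmin (prefix_of n s)) \<partial>N h)"
        using AE_code by (intro nn_integral_cong_AE) auto
      finally show ?thesis unfolding J_def using nn_integral_prefix[where N="N h" and f=cmin and n=n, OF N cmin_nonneg] by (simp add: N_cyl)
    qed
    have "(\<integral>\<^sup>+(x, y). ennreal (c x y) \<partial>\<kappa> h) \<le> (\<integral>\<^sup>+(x, y). ennreal (c x y) \<partial>\<gamma>)" if \<gamma>: "\<gamma> \<in> couplings (A h) (B h)" for \<gamma>
    proof (cases "(\<integral>\<^sup>+(x, y). ennreal (c x y) \<partial>\<gamma>)")
      case (real t)
      have s\<gamma>: "sets \<gamma> = sets (borel \<Otimes>\<^sub>M borel)"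
        using \<gamma> pA pB by (auto simp: couplings_def cong: sets_pair_measure_cong)
      obtain p where p: "\<And>i. 0 \<le> p i \<and> p i \<le> 1" "\<And>m. G m h p \<le> 0"
        and pJ: "\<And>n. (\<integral>\<^sup>+z. ennreal (cmin (prefix_of n (code z))) \<partial>\<gamma>) = ennreal (J n p)"
        using coup[OF h \<gamma>] by blast
      have "J n p \<le> t" for n
      proof -
        have "ennreal (J n p) \<le> ennreal t"
          unfolding pJ[symmetric] real(2)[symmetric] cost_eq[OF s\<gamma>] by (rule SUP_upper) simp
        then show ?thesis using real(1) by (simp add: ennreal_le_iff)
      qed
      \<comment> \<open>The same bound \<open>t\<close> holds at every level \<open>n\<close>, so it
        survives the supremum over \<open>n\<close>, which is the true cost.\<close>
      then have "J n (L h) \<le> t" for n using LJ[OF p] by blast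
      then have "(\<integral>\<^sup>+(x, y). ennreal (c x y) \<partial>\<kappa> h) \<le> ennreal t"
        unfolding cost_eq[OF s\<kappa>] int\<kappa> by (intro SUP_least ennreal_leI)
      then show ?thesis using real(2) by simp
    qed simp
    then show ?thesis using c1 by blast
  qed
  have "\<kappa> \<in> H \<rightarrow>\<^sub>M prob_algebra (borel \<Otimes>\<^sub>M borel)"
    unfolding \<kappa>_def by (rule measurable_compose[OF N_meas measurable_distr_prob_space[OF D]])
  then show ?thesis using that facts by blast
qed

section \<open>Successive disintegrations\<close>

definition kernels :: "'a measure \<Rightarrow> (nat \<Rightarrow> (nat \<Rightarrow> 'a) \<Rightarrow> 'a measure) \<Rightarrow> bool" where
  "kernels S \<kappa> \<longleftrightarrow> (\<forall>k. \<kappa> k \<in> path_space S k \<rightarrow>\<^sub>M prob_algebra S)"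

lemma kernelsD: "kernels S \<kappa> \<Longrightarrow> \<kappa> k \<in> path_space S k \<rightarrow>\<^sub>M prob_algebra S"
  by (simp add: kernels_def)

lemma Ionescu_Tulcea_iff_kernels: "Ionescu_Tulcea \<kappa> (\<lambda>_. S) \<longleftrightarrow> kernels S \<kappa>"
proof
  assume "Ionescu_Tulcea \<kappa> (\<lambda>_. S)"
  then interpret Ionescu_Tulcea \<kappa> "\<lambda>_. S" .
  show "kernels S \<kappa>" unfolding kernels_def
    by (intro allI measurable_prob_algebraI prob_space_P P)
next
  assume \<kappa>: "kernels S \<kappa>"
  show "Ionescu_Tulcea \<kappa> (\<lambda>_. S)"
  proof (rule Ionescu_Tulcea.intro)
    show "\<kappa> i \<in> path_space S i \<rightarrow>\<^sub>M subprob_algebra S" for i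
      by (rule measurable_prob_algebraD[OF kernelsD[OF \<kappa>]])
    show "prob_space (\<kappa> i x)" if "x \<in> space (path_space S i)" for i x
      using measurable_space[OF kernelsD[OF \<kappa>] that] by (simp add: space_prob_algebra)
  qed
qed

lemma measurable_restrict_path [measurable]:
  "k \<le> N \<Longrightarrow> (\<lambda>x. restrict x {0..<k}) \<in> path_space S N \<rightarrow>\<^sub>M path_space S k"
  by (intro measurable_restrict_subset) simp

lemma measurable_restrict_path':
  assumes "sets \<mu> = sets (path_space S N)" "k \<le> N"
  shows "(\<lambda>x. restrict x {0..<k}) \<in> \<mu> \<rightarrow>\<^sub>M path_space S k"
  using measurable_restrict_path[OF assms(2)] by (simp add: assms(1) cong: measurable_cong_sets)

lemma measurable_history_pair:
  assumes "sets \<mu> = sets (path_space S N)" "k < N"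
  shows "(\<lambda>x. (restrict x {0..<k}, x k)) \<in> \<mu> \<rightarrow>\<^sub>M path_space S k \<Otimes>\<^sub>M S"
proof -
  have "(\<lambda>x. (restrict x {0..<k}, x k)) \<in> path_space S N \<rightarrow>\<^sub>M path_space S k \<Otimes>\<^sub>M S"
    using assms(2) by (intro measurable_Pair measurable_restrict_path measurable_component_singleton) auto
  then show ?thesis by (simp add: assms(1) cong: measurable_cong_sets)
qed

lemma measurable_path_snoc:
  "(\<lambda>x. (fst x)(k := snd x)) \<in> path_space S k \<Otimes>\<^sub>M S \<rightarrow>\<^sub>M path_space S (Suc k)"
  using measurable_add_dim[of k "{0..<k}" "\<lambda>_. S"]
  by (simp add: atLeastLessThanSuc case_prod_beta')

lemma measurable_snoc_comp:
  assumes "f \<in> path_space S (Suc k) \<rightarrow>\<^sub>M R"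
  shows "(\<lambda>(y, z). f (y(k := z))) \<in> path_space S k \<Otimes>\<^sub>M S \<rightarrow>\<^sub>M R"
proof -
  have "(\<lambda>x. f ((fst x)(k := snd x))) \<in> path_space S k \<Otimes>\<^sub>M S \<rightarrow>\<^sub>M R"
    using measurable_comp[OF measurable_path_snoc assms] by (simp only: comp_def)
  then show ?thesis by (simp only: case_prod_beta')
qed

lemma restrict_path_space: "x \<in> space (path_space S N) \<Longrightarrow> restrict x {0..<N} = x"
  unfolding space_PiM by (rule PiE_restrict)

lemma measurable_nn_integral_kernel:
  assumes "\<kappa> \<in> M \<rightarrow>\<^sub>M prob_algebra N" "f \<in> borel_measurable (M \<Otimes>\<^sub>M N)"
  shows "(\<lambda>x. \<integral>\<^sup>+z. f (x, z) \<partial>\<kappa> x) \<in> borel_measurable M"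
proof -
  have eq: "(\<lambda>(x, y). f (x, y)) = f" by (rule ext) (simp split: prod.split)
  have f: "(\<lambda>(x, y). f (x, y)) \<in> borel_measurable (M \<Otimes>\<^sub>M N)"
    by (subst eq) (rule assms(2))
  have \<kappa>: "\<kappa> \<in> M \<rightarrow>\<^sub>M subprob_algebra N" by (rule measurable_prob_algebraD[OF assms(1)])
  show ?thesis
    by (rule nn_integral_measurable_subprob_algebra2[where L=\<kappa> and f="\<lambda>x z. f (x, z)", OF f \<kappa>])
qed

lemma measurable_nn_integral_snoc:
  assumes \<kappa>: "kernels S \<kappa>" and f: "f \<in> borel_measurable (path_space S (Suc k))"
  shows "(\<lambda>y. \<integral>\<^sup>+z. f (y(k := z)) \<partial>\<kappa> k y) \<in> borel_measurable (path_space S k)"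
proof -
  have 1: "\<kappa> k \<in> path_space S k \<rightarrow>\<^sub>M prob_algebra S" by (rule kernelsD[OF \<kappa>])
  have 2: "(\<lambda>(y, z). f (y(k := z))) \<in> borel_measurable (path_space S k \<Otimes>\<^sub>M S)"
    by (rule measurable_snoc_comp[OF f])
  have 3: "(\<lambda>y. \<integral>\<^sup>+z. (case (y, z) of (y, z) \<Rightarrow> f (y(k := z))) \<partial>\<kappa> k y) \<in> borel_measurable (path_space S k)"
    by (rule measurable_nn_integral_kernel[OF 1 2])
  show ?thesis using 3 by (simp only: prod.case)
qed

text \<open>Replaces the composition of kernels by an intrinsic description: integrals over history
  and next state are computed through the kernel. This form is convenient both for building
  disintegrations and for pushing them forward.\<close>

lemma disintegration_iff:
  "disintegration S N \<mu> \<kappa> \<longleftrightarrow> kernels S \<kappa> \<and> \<mu> \<in> space (prob_algebra (path_space S N)) \<and>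
    (\<forall>k<N. \<forall>f\<in>borel_measurable (path_space S k \<Otimes>\<^sub>M S).
      (\<integral>\<^sup>+x. f (restrict x {0..<k}, x k) \<partial>\<mu>) =
      (\<integral>\<^sup>+x. \<integral>\<^sup>+z. f (restrict x {0..<k}, z) \<partial>\<kappa> k (restrict x {0..<k}) \<partial>\<mu>))"
  (is "?L \<longleftrightarrow> ?R")
proof (cases "kernels S \<kappa>")
  case False
  then show ?thesis by (simp add: disintegration_def Ionescu_Tulcea_iff_kernels)
next
  case True
  then interpret Ionescu_Tulcea \<kappa> "\<lambda>_. S" by (simp add: Ionescu_Tulcea_iff_kernels)
  let ?u = "\<lambda>_::nat. undefined :: 'a"
  have u: "?u \<in> space (path_space S 0)" by (simp add: space_PiM)
  have sC[measurable_cong, simp]: "sets (C 0 k ?u) = sets (path_space S k)" for k using sets_C[OF u, of k] by simp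
  have spC: "space (C 0 k ?u) = space (path_space S k)" for k using space_C[OF u, of k] by simp
  have C_Suc: "(\<integral>\<^sup>+x. f x \<partial>C 0 (Suc k) ?u) = (\<integral>\<^sup>+y. \<integral>\<^sup>+z. f (y(k := z)) \<partial>\<kappa> k y \<partial>C 0 k ?u)"
    if f: "f \<in> borel_measurable (path_space S (Suc k))" for f k
  proof -
    have "eP k \<in> C 0 k ?u \<rightarrow>\<^sub>M subprob_algebra (path_space S (Suc k))"
      using measurable_eP[of k] by (simp cong: measurable_cong_sets)
    from nn_integral_bind[OF f this]
    have "(\<integral>\<^sup>+x. f x \<partial>C 0 (Suc k) ?u) = (\<integral>\<^sup>+y. \<integral>\<^sup>+x. f x \<partial>eP k y \<partial>C 0 k ?u)" by simp
    also have "\<dots> = (\<integral>\<^sup>+y. \<integral>\<^sup>+z. f (y(k := z)) \<partial>\<kappa> k y \<partial>C 0 k ?u)"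
      by (intro nn_integral_cong nn_integral_eP[OF _ f]) (simp add: spC)
    finally show ?thesis .
  qed
  show ?thesis
  proof
    assume ?L
    then have \<mu>: "\<mu> = C 0 N ?u" by (simp add: disintegration_def)
    have "(\<integral>\<^sup>+x. f (restrict x {0..<k}, x k) \<partial>\<mu>) =
      (\<integral>\<^sup>+x. \<integral>\<^sup>+z. f (restrict x {0..<k}, z) \<partial>\<kappa> k (restrict x {0..<k}) \<partial>\<mu>)"
      if k: "k < N" and f[measurable]: "f \<in> borel_measurable (path_space S k \<Otimes>\<^sub>M S)" for k f
    proof -
      define g where "g y = f (restrict y {0..<k}, y k)" for y
      have g: "g \<in> borel_measurable (path_space S (Suc k))" unfolding g_def by measurable
      define G where "G y = (\<integral>\<^sup>+z. f (y, z) \<partial>\<kappa> k y)" for y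
      have G: "G \<in> borel_measurable (path_space S k)"
        unfolding G_def
        by (rule measurable_nn_integral_kernel[OF kernelsD[OF True] f])
      have "(\<integral>\<^sup>+x. f (restrict x {0..<k}, x k) \<partial>\<mu>) = (\<integral>\<^sup>+x. g (restrict x {0..<Suc k}) \<partial>\<mu>)"
        by (intro nn_integral_cong) (simp add: g_def min_def)
      also have "\<dots> = (\<integral>\<^sup>+x. g x \<partial>C 0 (Suc k) ?u)"
        unfolding \<mu> using nn_integral_C[of "Suc k" N g 0 ?u] k g u by simp
      also have "\<dots> = (\<integral>\<^sup>+y. \<integral>\<^sup>+z. g (y(k := z)) \<partial>\<kappa> k y \<partial>C 0 k ?u)" by (rule C_Suc[OF g])
      also have "\<dots> = (\<integral>\<^sup>+y. G y \<partial>C 0 k ?u)"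
        by (intro nn_integral_cong) (simp add: g_def G_def spC restrict_path_space)
      also have "\<dots> = (\<integral>\<^sup>+x. G (restrict x {0..<k}) \<partial>\<mu>)"
        unfolding \<mu> using nn_integral_C[of k N G 0 ?u] k G u by simp
      finally show ?thesis by (simp add: G_def)
    qed
    moreover have "\<mu> \<in> space (prob_algebra (path_space S N))"
      unfolding \<mu> using prob_space_C[OF u, of N] by (simp add: space_prob_algebra)
    ultimately show ?R using True by blast
  next
    assume R: ?R
    then have sm[measurable_cong, simp]: "sets \<mu> = sets (path_space S N)" and p: "prob_space \<mu>"
      by (auto simp: space_prob_algebra)
    have sp: "space \<mu> = space (path_space S N)" using sets_eq_imp_space_eq[OF sm] .
    \<comment> \<open>The one-step identities determine the laws of the initial segments
      successively. At time 0 the path space has one point, so two probability measures on it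
      coincide.\<close>
    have marg: "distr \<mu> (path_space S k) (\<lambda>x. restrict x {0..<k}) = C 0 k ?u" if "k \<le> N" for k
      using that
    proof (induction k)
      case 0
      interpret d: prob_space "distr \<mu> (path_space S 0) (\<lambda>x. restrict x {0..<0})"
        by (rule prob_space.prob_space_distr[OF p]) measurable
      interpret c: prob_space "C 0 0 ?u" by (rule prob_space_C[OF u])
      show ?case
      proof (rule measure_eqI)
        fix A assume "A \<in> sets (distr \<mu> (path_space S 0) (\<lambda>x. restrict x {0..<0}))"
        then have A: "A \<in> sets (path_space S 0)" by simp
        then have "A \<subseteq> space (path_space S 0)" by (rule sets.sets_into_space)
        then consider "A = {}" | "A = space (path_space S 0)" by (auto simp: space_PiM)
        then show "emeasure (distr \<mu> (path_space S 0) (\<lambda>x. restrict x {0..<0})) A = emeasure (C 0 0 ?u) A"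
        proof cases
          case 2
          then show ?thesis using d.emeasure_space_1 c.emeasure_space_1 spC[of 0] by simp
        qed simp
      qed (simp del: C.simps)
    next
      case (Suc k)
      show ?case
      proof (rule measure_eqI)
        show "sets (distr \<mu> (path_space S (Suc k)) (\<lambda>x. restrict x {0..<Suc k})) = sets (C 0 (Suc k) ?u)"
          by (simp del: C.simps)
        fix A assume "A \<in> sets (distr \<mu> (path_space S (Suc k)) (\<lambda>x. restrict x {0..<Suc k}))"
        then have A[measurable]: "A \<in> sets (path_space S (Suc k))" by simp
        have r[measurable]: "(\<lambda>x. restrict x {0..<j}) \<in> \<mu> \<rightarrow>\<^sub>M path_space S j" if "j \<le> N" for j
          using that by measurable
        define f where "f = (\<lambda>(y, z). indicator A (y(k := z)) :: ennreal)"
        have f: "f \<in> borel_measurable (path_space S k \<Otimes>\<^sub>M S)"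
          unfolding f_def by (rule measurable_snoc_comp) measurable
        have "emeasure (distr \<mu> (path_space S (Suc k)) (\<lambda>x. restrict x {0..<Suc k})) A =
           (\<integral>\<^sup>+x. indicator A x \<partial>distr \<mu> (path_space S (Suc k)) (\<lambda>x. restrict x {0..<Suc k}))" by simp
        also have "\<dots> = (\<integral>\<^sup>+x. indicator A (restrict x {0..<Suc k}) \<partial>\<mu>)"
          using r[OF Suc.prems] by (subst nn_integral_distr) auto
        also have "\<dots> = (\<integral>\<^sup>+x. f (restrict x {0..<k}, x k) \<partial>\<mu>)"
        proof (rule nn_integral_cong)
          fix x :: "nat \<Rightarrow> 'a"
          have "restrict x {0..<Suc k} = (restrict x {0..<k})(k := x k)" by (auto simp: fun_eq_iff)
          then show "indicator A (restrict x {0..<Suc k}) = f (restrict x {0..<k}, x k)" by (simp add: f_def)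
        qed
        also have "\<dots> = (\<integral>\<^sup>+x. \<integral>\<^sup>+z. f (restrict x {0..<k}, z) \<partial>\<kappa> k (restrict x {0..<k}) \<partial>\<mu>)"
          using R f Suc.prems by auto
        also have "\<dots> = (\<integral>\<^sup>+x. \<integral>\<^sup>+z. indicator A ((restrict x {0..<k})(k := z)) \<partial>\<kappa> k (restrict x {0..<k}) \<partial>\<mu>)"
          by (simp add: f_def)
        also have "\<dots> = (\<integral>\<^sup>+y. \<integral>\<^sup>+z. indicator A (y(k := z)) \<partial>\<kappa> k y \<partial>distr \<mu> (path_space S k) (\<lambda>x. restrict x {0..<k}))"
          using Suc.prems measurable_nn_integral_snoc[OF True, of "indicator A"]
          by (subst nn_integral_distr[OF r]) auto
        also have "\<dots> = (\<integral>\<^sup>+y. \<integral>\<^sup>+z. indicator A (y(k := z)) \<partial>\<kappa> k y \<partial>C 0 k ?u)"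
          by (simp only: Suc.IH[OF Suc_leD[OF Suc.prems]])
        also have "\<dots> = (\<integral>\<^sup>+x. indicator A x \<partial>C 0 (Suc k) ?u)" by (rule C_Suc[symmetric]) measurable
        also have "\<dots> = emeasure (C 0 (Suc k) ?u) A" using A by (simp del: C.simps)
        finally show "emeasure (distr \<mu> (path_space S (Suc k)) (\<lambda>x. restrict x {0..<Suc k})) A = emeasure (C 0 (Suc k) ?u) A" .
      qed
    qed
    have "\<mu> = distr \<mu> \<mu> (\<lambda>x. x)" by (simp add: distr_id)
    also have "\<dots> = distr \<mu> (path_space S N) (\<lambda>x. restrict x {0..<N})"
      by (rule distr_cong) (simp_all add: sp restrict_path_space)
    also have "\<dots> = C 0 N ?u" by (rule marg) simp
    finally show ?L using True by (simp add: disintegration_def Ionescu_Tulcea_iff_kernels)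
  qed
qed

lemma disintegration_unique_measure:
  "disintegration S N \<mu> \<kappa> \<Longrightarrow> disintegration S N \<mu>' \<kappa> \<Longrightarrow> \<mu> = \<mu>'"
  by (simp add: disintegration_def)

lemma disintegrationD:
  assumes "disintegration S N \<mu> \<kappa>"
  shows "kernels S \<kappa>" "prob_space \<mu>" "sets \<mu> = sets (path_space S N)"
    "\<And>k f. k < N \<Longrightarrow> f \<in> borel_measurable (path_space S k \<Otimes>\<^sub>M S) \<Longrightarrow>
      (\<integral>\<^sup>+x. f (restrict x {0..<k}, x k) \<partial>\<mu>) =
      (\<integral>\<^sup>+x. \<integral>\<^sup>+z. f (restrict x {0..<k}, z) \<partial>\<kappa> k (restrict x {0..<k}) \<partial>\<mu>)"
  using assms by (auto simp: disintegration_iff space_prob_algebra)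

lemma disintegration_of_kernels:
  assumes "kernels S \<kappa>"
  obtains \<mu> where "disintegration S N \<mu> \<kappa>"
  using assms by (auto simp: disintegration_def Ionescu_Tulcea_iff_kernels)

text \<open>Connects disintegrations with \<open>joint\<close>, so that uniqueness of conditional
  laws can be applied at each time.\<close>

lemma disintegration_joint:
  assumes \<mu>: "disintegration S N \<mu> \<kappa>" and k: "k < N"
  shows "distr \<mu> (path_space S k \<Otimes>\<^sub>M S) (\<lambda>x. (restrict x {0..<k}, x k)) =
    joint (path_space S k) S (distr \<mu> (path_space S k) (\<lambda>x. restrict x {0..<k})) (\<kappa> k)"
    (is "?d = joint _ _ ?m _")
proof (rule measure_eqI)
  note D = disintegrationD[OF \<mu>]
  note D(3)[measurable_cong]
  have r[measurable]: "(\<lambda>x. restrict x {0..<k}) \<in> \<mu> \<rightarrow>\<^sub>M path_space S k"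
    by (rule measurable_restrict_path'[OF D(3)]) (use k in simp)
  have r2[measurable]: "(\<lambda>x. (restrict x {0..<k}, x k)) \<in> \<mu> \<rightarrow>\<^sub>M path_space S k \<Otimes>\<^sub>M S"
    by (rule measurable_history_pair[OF D(3) k])
  have m: "?m \<in> space (prob_algebra (path_space S k))"
    using prob_space.prob_space_distr[OF D(2) r] by (simp add: space_prob_algebra)
  have sJ: "sets (joint (path_space S k) S ?m (\<kappa> k)) = sets (path_space S k \<Otimes>\<^sub>M S)"
    using joint_in_prob_algebra[OF kernelsD[OF D(1)] m] by (simp add: space_prob_algebra)
  then show "sets ?d = sets (joint (path_space S k) S ?m (\<kappa> k))" by simp
  fix A assume "A \<in> sets ?d"
  then have A[measurable]: "A \<in> sets (path_space S k \<Otimes>\<^sub>M S)" by simp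
  have "emeasure ?d A = (\<integral>\<^sup>+z. indicator A z \<partial>?d)" by simp
  also have "\<dots> = (\<integral>\<^sup>+x. indicator A (restrict x {0..<k}, x k) \<partial>\<mu>)"
    by (rule nn_integral_distr[OF r2]) simp
  also have "\<dots> = (\<integral>\<^sup>+x. \<integral>\<^sup>+z. indicator A (restrict x {0..<k}, z) \<partial>\<kappa> k (restrict x {0..<k}) \<partial>\<mu>)"
    by (rule D(4)[OF k]) measurable
  also have "\<dots> = (\<integral>\<^sup>+y. \<integral>\<^sup>+z. indicator A (y, z) \<partial>\<kappa> k y \<partial>?m)"
  proof (rule nn_integral_distr[OF r, symmetric])
    show "(\<lambda>y. \<integral>\<^sup>+z. indicator A (y, z) \<partial>\<kappa> k y) \<in> borel_measurable ?m"
      using measurable_nn_integral_kernel[OF kernelsD[OF D(1)], of "indicator A"] by simp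
  qed
  also have "\<dots> = (\<integral>\<^sup>+z. indicator A z \<partial>joint (path_space S k) S ?m (\<kappa> k))"
    by (rule nn_integral_joint[OF kernelsD[OF D(1)] m, symmetric]) measurable
  also have "\<dots> = emeasure (joint (path_space S k) S ?m (\<kappa> k)) A" using A sJ by simp
  finally show "emeasure ?d A = emeasure (joint (path_space S k) S ?m (\<kappa> k)) A" .
qed

text \<open>This is why the almost sure conditions defining bicausal and triangular optimal
  couplings do not depend on the chosen versions.\<close>

lemma disintegration_unique:
  assumes S: "coded S e d" and \<mu>: "disintegration S N \<mu> \<kappa>" "disintegration S N \<mu> \<kappa>'" and k: "k < N"
  shows "AE x in \<mu>. \<kappa> k (restrict x {0..<k}) = \<kappa>' k (restrict x {0..<k})"
proof -
  note D = disintegrationD[OF \<mu>(1)]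
  note D(3)[measurable_cong]
  let ?m = "distr \<mu> (path_space S k) (\<lambda>x. restrict x {0..<k})"
  have r: "(\<lambda>x. restrict x {0..<k}) \<in> \<mu> \<rightarrow>\<^sub>M path_space S k"
    by (rule measurable_restrict_path'[OF D(3)]) (use k in simp)
  have "?m \<in> space (prob_algebra (path_space S k))"
    using prob_space.prob_space_distr[OF D(2) r] by (simp add: space_prob_algebra)
  from joint_unique[OF S kernelsD[OF D(1)] kernelsD[OF disintegrationD(1)[OF \<mu>(2)]] this]
  have "AE y in ?m. \<kappa> k y = \<kappa>' k y"
    using disintegration_joint[OF \<mu>(1) k] disintegration_joint[OF \<mu>(2) k] by simp
  then show ?thesis by (rule AE_distrD[OF r])
qed

text \<open>Each time is treated on its own: the kernel is the conditional law of \<open>x k\<close>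
  given the history before \<open>k\<close>.\<close>

lemma disintegration_exists:
  fixes \<mu> :: "(nat \<Rightarrow> 'a::polish_space) measure"
  assumes "prob_space \<mu>" and s[measurable_cong]: "sets \<mu> = sets (path_space borel N)"
  obtains \<kappa> where "disintegration borel N \<mu> \<kappa>"
proof -
  obtain e d where ed: "coded (borel :: 'a measure) e d" by (rule coded_polish) (rule that)
  define M where "M k = distr \<mu> (path_space borel k \<Otimes>\<^sub>M borel) (\<lambda>x. (restrict x {0..<k}, x k))" for k
  define Q where "Q k \<kappa> \<longleftrightarrow> \<kappa> \<in> path_space borel k \<rightarrow>\<^sub>M prob_algebra borel \<and> (k < N \<longrightarrow>
      (\<forall>f\<in>borel_measurable (path_space borel k \<Otimes>\<^sub>M borel).
      (\<integral>\<^sup>+x. f (restrict x {0..<k}, x k) \<partial>\<mu>) =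
      (\<integral>\<^sup>+x. \<integral>\<^sup>+z. f (restrict x {0..<k}, z) \<partial>\<kappa> (restrict x {0..<k}) \<partial>\<mu>)))"
    for k and \<kappa> :: "(nat \<Rightarrow> 'a) \<Rightarrow> 'a measure"
  have "\<exists>\<kappa>. Q k \<kappa>" for k
  proof (cases "k < N")
    case False
    \<comment> \<open>\<open>kernels\<close> asks for a Markov kernel at every time; from time
      \<open>N\<close> on a constant point mass is taken.\<close>
    have "(\<lambda>_. return borel (undefined :: 'a)) \<in> path_space borel k \<rightarrow>\<^sub>M prob_algebra borel"
      by (rule measurable_const) (simp add: space_prob_algebra prob_space_return)
    then show ?thesis using False unfolding Q_def by blast
  next
    case True
    have r[measurable]: "(\<lambda>x. restrict x {0..<k}) \<in> \<mu> \<rightarrow>\<^sub>M path_space borel k"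
      by (rule measurable_restrict_path'[OF s]) (use True in simp)
    have r2: "(\<lambda>x. (restrict x {0..<k}, x k)) \<in> \<mu> \<rightarrow>\<^sub>M path_space borel k \<Otimes>\<^sub>M borel"
      by (rule measurable_history_pair[OF s True])
    have "M k \<in> space (prob_algebra (path_space borel k \<Otimes>\<^sub>M borel))"
      unfolding M_def using prob_space.prob_space_distr[OF assms(1) r2] by (simp add: space_prob_algebra)
    from rcp[OF this ed] obtain \<kappa> where \<kappa>: "\<kappa> \<in> path_space borel k \<rightarrow>\<^sub>M prob_algebra borel"
      and M: "M k = joint (path_space borel k) borel (distr (M k) (path_space borel k) fst) \<kappa>" by blast
    have m: "distr (M k) (path_space borel k) fst = distr \<mu> (path_space borel k) (\<lambda>x. restrict x {0..<k})"
      unfolding M_def using r2 by (subst distr_distr) (auto simp: comp_def)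
    have mp: "distr \<mu> (path_space borel k) (\<lambda>x. restrict x {0..<k}) \<in> space (prob_algebra (path_space borel k))"
      using prob_space.prob_space_distr[OF assms(1) r] by (simp add: space_prob_algebra)
    show ?thesis
      unfolding Q_def
    proof (intro exI[of _ \<kappa>] conjI impI ballI \<kappa>)
      fix f :: "(nat \<Rightarrow> 'a) \<times> 'a \<Rightarrow> ennreal"
      assume f[measurable]: "f \<in> borel_measurable (path_space (borel :: 'a measure) k \<Otimes>\<^sub>M borel)"
      have "(\<integral>\<^sup>+x. f (restrict x {0..<k}, x k) \<partial>\<mu>) = (\<integral>\<^sup>+z. f z \<partial>M k)"
        unfolding M_def by (rule nn_integral_distr[OF r2, symmetric]) simp
      also have "\<dots> = (\<integral>\<^sup>+y. \<integral>\<^sup>+z. f (y, z) \<partial>\<kappa> y \<partial>distr \<mu> (path_space borel k) (\<lambda>x. restrict x {0..<k}))"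
        by (subst M, unfold m) (rule nn_integral_joint[OF \<kappa> mp f])
      also have "\<dots> = (\<integral>\<^sup>+x. \<integral>\<^sup>+z. f (restrict x {0..<k}, z) \<partial>\<kappa> (restrict x {0..<k}) \<partial>\<mu>)"
      proof (rule nn_integral_distr[OF r])
        show "(\<lambda>y. \<integral>\<^sup>+z. f (y, z) \<partial>\<kappa> y) \<in> borel_measurable (distr \<mu> (path_space borel k) (\<lambda>x. restrict x {0..<k}))"
          using measurable_nn_integral_kernel[OF \<kappa> f] by simp
      qed
      finally show "(\<integral>\<^sup>+x. f (restrict x {0..<k}, x k) \<partial>\<mu>) =
        (\<integral>\<^sup>+x. \<integral>\<^sup>+z. f (restrict x {0..<k}, z) \<partial>\<kappa> (restrict x {0..<k}) \<partial>\<mu>)" .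
    qed
  qed
  then obtain \<kappa> where "\<And>k. Q k (\<kappa> k)" by metis
  then have "disintegration borel N \<mu> \<kappa>"
    using assms unfolding disintegration_iff kernels_def space_prob_algebra Q_def by blast
  then show ?thesis by (rule that)
qed

lemma measurable_map_path:
  assumes g: "g \<in> S \<rightarrow>\<^sub>M R"
  shows "(\<lambda>h. \<lambda>i\<in>{0..<N}. g (h i)) \<in> path_space S N \<rightarrow>\<^sub>M path_space R N"
proof (rule measurable_restrict)
  fix i assume "i \<in> {0..<N}"
  from measurable_compose[OF measurable_component_singleton[OF this] g]
  show "(\<lambda>h. g (h i)) \<in> path_space S N \<rightarrow>\<^sub>M R" .
qed

text \<open>By \<open>eq\<close> the image of the conditional law depends on the history only
  through the image history, so the image process has the kernels \<open>\<kappa>'\<close>. Applied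
  to the two projections of a composed coupling, it identifies the marginals.\<close>

lemma disintegration_map:
  assumes \<Gamma>: "disintegration S N \<Gamma> \<kappa>" and g[measurable]: "g \<in> S \<rightarrow>\<^sub>M R" and \<kappa>': "kernels R \<kappa>'"
    and eq: "\<And>k h. k < N \<Longrightarrow> h \<in> space (path_space S k) \<Longrightarrow> distr (\<kappa> k h) R g = \<kappa>' k (\<lambda>i\<in>{0..<k}. g (h i))"
  shows "disintegration R N (distr \<Gamma> (path_space R N) (\<lambda>h. \<lambda>i\<in>{0..<N}. g (h i))) \<kappa>'"
  unfolding disintegration_iff
proof (intro conjI allI impI ballI \<kappa>')
  note D = disintegrationD[OF \<Gamma>]
  note D(3)[measurable_cong]
  have sp: "space \<Gamma> = space (path_space S N)" using sets_eq_imp_space_eq[OF D(3)] .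
  have G: "(\<lambda>h. \<lambda>i\<in>{0..<N}. g (h i)) \<in> \<Gamma> \<rightarrow>\<^sub>M path_space R N"
    using measurable_map_path[OF g, of N] by (simp add: D(3) cong: measurable_cong_sets)
  show "distr \<Gamma> (path_space R N) (\<lambda>h. \<lambda>i\<in>{0..<N}. g (h i)) \<in> space (prob_algebra (path_space R N))"
    using prob_space.prob_space_distr[OF D(2) G] by (simp add: space_prob_algebra)
  fix k and f :: "_ \<Rightarrow> ennreal" assume k: "k < N" and f[measurable]: "f \<in> borel_measurable (path_space R k \<Otimes>\<^sub>M R)"
  define gk where "gk h = (\<lambda>i\<in>{0..<k}. g (h i))" for h
  have gk[measurable]: "gk \<in> path_space S k \<rightarrow>\<^sub>M path_space R k"
    unfolding gk_def by (rule measurable_map_path[OF g])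
  have res: "restrict (\<lambda>i\<in>{0..<N}. g (h i)) {0..<k} = gk (restrict h {0..<k})"
    "(\<lambda>i\<in>{0..<N}. g (h i)) k = g (h k)" for h
    using k by (auto simp: restrict_def fun_eq_iff gk_def)
  define F where "F x = (\<integral>\<^sup>+z. f (x, z) \<partial>\<kappa>' k x)" for x
  have F[measurable]: "F \<in> borel_measurable (path_space R k)"
    unfolding F_def by (rule measurable_nn_integral_kernel[OF kernelsD[OF \<kappa>'] f])
  have fR: "(\<lambda>x. f (restrict x {0..<k}, x k)) \<in> borel_measurable (path_space R N)"
    by (rule measurable_compose[OF measurable_history_pair[OF refl k] f])
  have FR: "(\<lambda>x. F (restrict x {0..<k})) \<in> borel_measurable (path_space R N)"
    by (rule measurable_compose[OF measurable_restrict_path F]) (use k in simp)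
  have "(\<integral>\<^sup>+x. f (restrict x {0..<k}, x k) \<partial>distr \<Gamma> (path_space R N) (\<lambda>h. \<lambda>i\<in>{0..<N}. g (h i))) =
    (\<integral>\<^sup>+h. f (restrict (\<lambda>i\<in>{0..<N}. g (h i)) {0..<k}, (\<lambda>i\<in>{0..<N}. g (h i)) k) \<partial>\<Gamma>)"
    by (rule nn_integral_distr[OF G]) (simp only: measurable_distr_eq1 fR)
  also have "\<dots> = (\<integral>\<^sup>+h. f (gk (restrict h {0..<k}), g (h k)) \<partial>\<Gamma>)" by (simp only: res)
  also have "\<dots> = (\<integral>\<^sup>+h. \<integral>\<^sup>+z. f (gk (restrict h {0..<k}), g z) \<partial>\<kappa> k (restrict h {0..<k}) \<partial>\<Gamma>)"
    using D(4)[OF k, of "\<lambda>x. f (gk (fst x), g (snd x))"] by simp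
  also have "\<dots> = (\<integral>\<^sup>+h. F (gk (restrict h {0..<k})) \<partial>\<Gamma>)"
  proof (rule nn_integral_cong)
    fix h assume "h \<in> space \<Gamma>"
    then have h: "restrict h {0..<k} \<in> space (path_space S k)"
      using measurable_space[OF measurable_restrict_path'[OF D(3)], of k] k by simp
    have s: "sets (\<kappa> k (restrict h {0..<k})) = sets S"
      using measurable_space[OF kernelsD[OF D(1)] h] by (simp add: space_prob_algebra)
    have fst: "gk (restrict h {0..<k}) \<in> space (path_space R k)"
      using measurable_space[OF gk h] .
    have g': "g \<in> \<kappa> k (restrict h {0..<k}) \<rightarrow>\<^sub>M R" using g by (simp add: s cong: measurable_cong_sets)
    have "F (gk (restrict h {0..<k})) =
      (\<integral>\<^sup>+z. f (gk (restrict h {0..<k}), z) \<partial>distr (\<kappa> k (restrict h {0..<k})) R g)"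
      unfolding F_def eq[OF k h] gk_def ..
    also have "\<dots> = (\<integral>\<^sup>+z. f (gk (restrict h {0..<k}), g z) \<partial>\<kappa> k (restrict h {0..<k}))"
      using fst by (intro nn_integral_distr[OF g']) simp
    finally show "(\<integral>\<^sup>+z. f (gk (restrict h {0..<k}), g z) \<partial>\<kappa> k (restrict h {0..<k})) =
      F (gk (restrict h {0..<k}))" ..
  qed
  also have "\<dots> = (\<integral>\<^sup>+h. F (restrict (\<lambda>i\<in>{0..<N}. g (h i)) {0..<k}) \<partial>\<Gamma>)" by (simp only: res)
  also have "\<dots> = (\<integral>\<^sup>+x. F (restrict x {0..<k}) \<partial>distr \<Gamma> (path_space R N) (\<lambda>h. \<lambda>i\<in>{0..<N}. g (h i)))"
    by (rule nn_integral_distr[OF G, symmetric]) (simp only: measurable_distr_eq1 FR)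
  finally show "(\<integral>\<^sup>+x. f (restrict x {0..<k}, x k) \<partial>distr \<Gamma> (path_space R N) (\<lambda>h. \<lambda>i\<in>{0..<N}. g (h i))) =
    (\<integral>\<^sup>+x. \<integral>\<^sup>+z. f (restrict x {0..<k}, z) \<partial>\<kappa>' k (restrict x {0..<k})
      \<partial>distr \<Gamma> (path_space R N) (\<lambda>h. \<lambda>i\<in>{0..<N}. g (h i)))" by (simp only: F_def)
qed

section \<open>Convergence along merging random variables\<close>

text \<open>From \<open>a + b \<le> 2 * max a b\<close>; this also covers exponents below 1.\<close>

lemma powr_add_le:
  fixes a b p :: real
  assumes "0 \<le> a" "0 \<le> b" "0 \<le> p"
  shows "(a + b) powr p \<le> 2 powr p * (a powr p + b powr p)"
proof -
  have "(a + b) powr p \<le> (2 * max a b) powr p" using assms by (intro powr_mono2) auto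
  also have "\<dots> = 2 powr p * (max a b) powr p" using assms by (simp add: powr_mult)
  also have "(max a b) powr p \<le> a powr p + b powr p" by (simp add: max_def)
  finally show ?thesis by simp
qed

lemma tendsto_0_ennreal_le:
  fixes F :: "nat \<Rightarrow> ennreal"
  assumes "\<And>e. 0 < e \<Longrightarrow> \<forall>\<^sub>F n in sequentially. F n \<le> ennreal (c * e)" and c: "0 < c"
  shows "F \<longlonglongrightarrow> 0"
proof (rule order_tendstoI)
  fix a :: ennreal assume "0 < a"
  then obtain r where r: "0 < r" "ennreal r < a"
    by (metis ennreal_0 ennreal_less_zero_iff dense ennreal_cases less_top not_gr_zero order_less_trans)
  have "\<forall>\<^sub>F n in sequentially. F n \<le> ennreal (c * (r / c))" using assms(1)[of "r / c"] r c by simp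
  then show "\<forall>\<^sub>F n in sequentially. F n < a"
    by eventually_elim (use r c in \<open>auto intro: le_less_trans\<close>)
qed simp

text \<open>The probability spaces vary with \<open>n\<close>, but both variables always have the
  law \<open>m\<close>. This makes every error that is measured by \<open>m\<close> uniform in
  \<open>n\<close>.\<close>

locale merging =
  fixes \<Omega> :: "nat \<Rightarrow> 'w measure" and m :: "'x measure" and \<xi> \<xi>' :: "nat \<Rightarrow> 'w \<Rightarrow> 'x"
  assumes prob_\<Omega>: "\<And>n. prob_space (\<Omega> n)"
    and \<xi>[measurable]: "\<And>n. \<xi> n \<in> \<Omega> n \<rightarrow>\<^sub>M m" and \<xi>'[measurable]: "\<And>n. \<xi>' n \<in> \<Omega> n \<rightarrow>\<^sub>M m"
    and law: "\<And>n. distr (\<Omega> n) m (\<xi> n) = m" and law': "\<And>n. distr (\<Omega> n) m (\<xi>' n) = m"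
begin

lemma prob_m: "prob_space m"
  using prob_space.prob_space_distr[OF prob_\<Omega> \<xi>] by (simp add: law)

sublocale m: prob_space m by (rule prob_m)

definition differ :: "'x set \<Rightarrow> nat \<Rightarrow> 'w set" where
  "differ A n = {\<omega> \<in> space (\<Omega> n). \<xi> n \<omega> \<in> A \<longleftrightarrow> \<xi>' n \<omega> \<notin> A}"

definition merges :: "'x set \<Rightarrow> bool" where
  "merges A \<longleftrightarrow> (\<lambda>n. measure (\<Omega> n) (differ A n)) \<longlonglongrightarrow> 0"

lemma differ_sets [measurable]:
  assumes [measurable]: "A \<in> sets m"
  shows "differ A n \<in> sets (\<Omega> n)"
  unfolding differ_def by measurable

lemma \<xi>_space: "\<omega> \<in> space (\<Omega> n) \<Longrightarrow> \<xi> n \<omega> \<in> space m" "\<omega> \<in> space (\<Omega> n) \<Longrightarrow> \<xi>' n \<omega> \<in> space m"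
  using measurable_space[OF \<xi>] measurable_space[OF \<xi>'] by auto

lemma measure_\<xi>:
  assumes [measurable]: "A \<in> sets m"
  shows "measure (\<Omega> n) {\<omega> \<in> space (\<Omega> n). \<xi> n \<omega> \<in> A} = measure m A"
    "measure (\<Omega> n) {\<omega> \<in> space (\<Omega> n). \<xi>' n \<omega> \<in> A} = measure m A"
proof -
  have "measure m A = measure (distr (\<Omega> n) m (\<xi> n)) A" by (simp add: law)
  then show "measure (\<Omega> n) {\<omega> \<in> space (\<Omega> n). \<xi> n \<omega> \<in> A} = measure m A"
    using assms by (simp add: measure_distr vimage_def Int_def conj_commute)
  have "measure m A = measure (distr (\<Omega> n) m (\<xi>' n)) A" by (simp add: law')
  then show "measure (\<Omega> n) {\<omega> \<in> space (\<Omega> n). \<xi>' n \<omega> \<in> A} = measure m A"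
    using assms by (simp add: measure_distr vimage_def Int_def conj_commute)
qed

lemma nn_integral_\<xi>:
  assumes "f \<in> borel_measurable m"
  shows "(\<integral>\<^sup>+\<omega>. f (\<xi> n \<omega>) \<partial>\<Omega> n) = (\<integral>\<^sup>+x. f x \<partial>m)" "(\<integral>\<^sup>+\<omega>. f (\<xi>' n \<omega>) \<partial>\<Omega> n) = (\<integral>\<^sup>+x. f x \<partial>m)"
proof -
  have "(\<integral>\<^sup>+x. f x \<partial>m) = (\<integral>\<^sup>+x. f x \<partial>distr (\<Omega> n) m (\<xi> n))" by (simp add: law)
  then show "(\<integral>\<^sup>+\<omega>. f (\<xi> n \<omega>) \<partial>\<Omega> n) = (\<integral>\<^sup>+x. f x \<partial>m)"
    using assms by (simp add: nn_integral_distr)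
  have "(\<integral>\<^sup>+x. f x \<partial>m) = (\<integral>\<^sup>+x. f x \<partial>distr (\<Omega> n) m (\<xi>' n))" by (simp add: law')
  then show "(\<integral>\<^sup>+\<omega>. f (\<xi>' n \<omega>) \<partial>\<Omega> n) = (\<integral>\<^sup>+x. f x \<partial>m)"
    using assms by (simp add: nn_integral_distr)
qed

lemma mergesI:
  assumes "\<And>\<epsilon>. 0 < \<epsilon> \<Longrightarrow> \<exists>b. b \<longlonglongrightarrow> 0 \<and> (\<forall>n. measure (\<Omega> n) (differ A n) \<le> b n + \<epsilon>)"
  shows "merges A"
  unfolding merges_def
proof (rule LIMSEQ_I)
  fix r :: real assume "0 < r"
  then obtain b where b: "b \<longlonglongrightarrow> 0" "\<And>n. measure (\<Omega> n) (differ A n) \<le> b n + r / 2"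
    using assms[of "r / 2"] by auto
  obtain N where N: "\<And>n. n \<ge> N \<Longrightarrow> \<bar>b n\<bar> < r / 2"
    using LIMSEQ_D[OF b(1), of "r / 2"] \<open>0 < r\<close> by auto
  show "\<exists>N. \<forall>n\<ge>N. norm (measure (\<Omega> n) (differ A n) - 0) < r"
  proof (intro exI allI impI)
    fix n assume "N \<le> n"
    from N[OF this] b(2)[of n] show "norm (measure (\<Omega> n) (differ A n) - 0) < r" by simp
  qed
qed

text \<open>The union is cut off after finitely many sets. The remainder \<open>R\<close> has small
  mass under \<open>m\<close>, and each of the two variables hits it with exactly this probability,
  whatever \<open>n\<close> is.\<close>

lemma merges_UN:
  assumes A[measurable]: "\<And>i::nat. A i \<in> sets m" and merges: "\<And>i. merges (A i)"
  shows "merges (\<Union>i. A i)"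
proof (rule mergesI)
  fix \<epsilon> :: real assume \<epsilon>: "0 < \<epsilon>"
  define B where "B K = (\<Union>i<K. A i)" for K
  have [measurable]: "B K \<in> sets m" for K unfolding B_def by measurable
  have "(\<lambda>K. measure m (B K)) \<longlonglongrightarrow> measure m (\<Union>K. B K)"
  proof (rule m.finite_Lim_measure_incseq)
    show "incseq B" unfolding incseq_def B_def by (auto intro: order_less_le_trans)
  qed auto
  moreover have "(\<Union>K. B K) = (\<Union>i. A i)" by (auto simp: B_def)
  ultimately obtain K where K: "\<bar>measure m (B K) - measure m (\<Union>i. A i)\<bar> < \<epsilon> / 2"
    using LIMSEQ_D[of _ _ "\<epsilon> / 2"] \<epsilon> by fastforce
  define R where "R = (\<Union>i. A i) - B K"
  have [measurable]: "R \<in> sets m" unfolding R_def by measurable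
  have "measure m R = measure m (\<Union>i. A i) - measure m (B K)"
    unfolding R_def by (rule m.finite_measure_Diff) (auto simp: B_def)
  then have R: "measure m R \<le> \<epsilon> / 2" using K by linarith
  show "\<exists>b. b \<longlonglongrightarrow> 0 \<and> (\<forall>n. measure (\<Omega> n) (differ (\<Union>i. A i) n) \<le> b n + \<epsilon>)"
  proof (intro exI conjI allI)
    show "(\<lambda>n. \<Sum>i<K. measure (\<Omega> n) (differ (A i) n)) \<longlonglongrightarrow> 0"
      using merges unfolding merges_def by (intro tendsto_null_sum) blast
    fix n
    interpret \<Omega>: prob_space "\<Omega> n" by (rule prob_\<Omega>)
    let ?R1 = "{\<omega> \<in> space (\<Omega> n). \<xi> n \<omega> \<in> R}" and ?R2 = "{\<omega> \<in> space (\<Omega> n). \<xi>' n \<omega> \<in> R}"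
    have "differ (\<Union>i. A i) n \<subseteq> (\<Union>i<K. differ (A i) n) \<union> (?R1 \<union> ?R2)"
      unfolding differ_def R_def B_def by blast
    then have "measure (\<Omega> n) (differ (\<Union>i. A i) n) \<le> measure (\<Omega> n) ((\<Union>i<K. differ (A i) n) \<union> (?R1 \<union> ?R2))"
      by (rule \<Omega>.finite_measure_mono) measurable
    also have "\<dots> \<le> measure (\<Omega> n) (\<Union>i<K. differ (A i) n) + measure (\<Omega> n) (?R1 \<union> ?R2)"
      by (rule measure_Un_le) measurable
    also have "measure (\<Omega> n) (?R1 \<union> ?R2) \<le> measure (\<Omega> n) ?R1 + measure (\<Omega> n) ?R2"
      by (rule measure_Un_le) measurable
    also have "\<dots> \<le> \<epsilon>" using R by (simp add: measure_\<xi>)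
    also have "measure (\<Omega> n) (\<Union>i<K. differ (A i) n) \<le> (\<Sum>i<K. measure (\<Omega> n) (differ (A i) n))"
      by (rule \<Omega>.finite_measure_subadditive_finite) auto
    finally show "measure (\<Omega> n) (differ (\<Union>i. A i) n) \<le> (\<Sum>i<K. measure (\<Omega> n) (differ (A i) n)) + \<epsilon>" by simp
  qed
qed

lemma sigma_algebra_merges: "sigma_algebra (space m) {A \<in> sets m. merges A}"
  unfolding sigma_algebra_iff2
proof (intro conjI ballI allI impI)
  show "{A \<in> sets m. merges A} \<subseteq> Pow (space m)" using sets.sets_into_space by blast
  show "{} \<in> {A \<in> sets m. merges A}" by (simp add: merges_def differ_def)
  show "space m - A \<in> {A \<in> sets m. merges A}" if "A \<in> {A \<in> sets m. merges A}" for A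
  proof -
    have "differ (space m - A) n = differ A n" for n
      using \<xi>_space by (auto simp: differ_def)
    then show ?thesis using that by (auto simp: merges_def)
  qed
  show "(\<Union>i. A i) \<in> {A \<in> sets m. merges A}" if "range A \<subseteq> {A \<in> sets m. merges A}" for A :: "nat \<Rightarrow> _"
    using that merges_UN[of A] by auto
qed

text \<open>Packaged as a measure, so that the claim that all sets merge becomes measurability of
  the identity and can be checked on coordinates.\<close>

definition merging_algebra :: "'x measure" where
  "merging_algebra = sigma (space m) {A \<in> sets m. merges A}"

lemma space_merging_algebra [simp]: "space merging_algebra = space m"
  unfolding merging_algebra_def by (rule space_measure_of) (use sets.sets_into_space in blast)

lemma sets_merging_algebra: "sets merging_algebra = {A \<in> sets m. merges A}"
  unfolding merging_algebra_def by (rule sigma_algebra.sets_measure_of_eq[OF sigma_algebra_merges])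

text \<open>Suppose that exactly one of the two values lies in a closed set \<open>C\<close>. Then
  either they are at least \<delta> apart, or one of them lies outside \<open>C\<close> at distance
  less than \<delta> from it. The first has vanishing probability by \<open>conv\<close>; the second
  has small probability uniformly in \<open>n\<close>, since these shells decrease to the empty set
  as \<delta> tends to 0.\<close>

lemma measurable_merging_algebra:
  fixes \<phi> :: "'x \<Rightarrow> 'b::{metric_space, second_countable_topology}"
  assumes \<phi>[measurable]: "\<phi> \<in> borel_measurable m"
    and conv: "\<And>\<delta>. 0 < \<delta> \<Longrightarrow> (\<lambda>n. measure (\<Omega> n) {\<omega> \<in> space (\<Omega> n). \<delta> \<le> dist (\<phi> (\<xi> n \<omega>)) (\<phi> (\<xi>' n \<omega>))}) \<longlonglongrightarrow> 0"
  shows "\<phi> \<in> borel_measurable merging_algebra"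
  unfolding borel_eq_closed
proof (rule measurable_measure_of)
  fix C :: "'b set" assume "C \<in> {C. closed C}"
  then have C: "closed C" by simp
  then have C'[measurable]: "C \<in> sets borel" by simp
  have "\<phi> -` C \<inter> space m \<in> sets m" by measurable
  moreover have "merges (\<phi> -` C \<inter> space m)"
  proof (cases "C = {}")
    case True
    then show ?thesis by (simp add: merges_def differ_def)
  next
    case False
    show ?thesis
    proof (rule mergesI)
      fix \<epsilon> :: real assume \<epsilon>: "0 < \<epsilon>"
      define B where "B k = {x \<in> space m. \<phi> x \<notin> C \<and> infdist (\<phi> x) C < 1 / real (Suc k)}" for k
      have [measurable]: "(\<lambda>x. infdist (\<phi> x) C) \<in> borel_measurable m"
        by (rule measurable_compose[OF \<phi> borel_measurable_continuous_onI[OF continuous_on_infdist[OF continuous_on_id]]])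
      have [measurable]: "B k \<in> sets m" for k unfolding B_def by measurable
      have "(\<lambda>k. measure m (B k)) \<longlonglongrightarrow> measure m (\<Inter>k. B k)"
      proof (rule m.finite_Lim_measure_decseq)
        show "decseq B"
          unfolding decseq_def B_def
        proof safe
          fix k l :: nat and x assume "k \<le> l" "infdist (\<phi> x) C < 1 / real (Suc l)"
          then show "infdist (\<phi> x) C < 1 / real (Suc k)"
            by (meson frac_le less_le_trans of_nat_0_less_iff of_nat_le_iff Suc_le_mono zero_less_Suc zero_le_one order_refl)
        qed
      qed auto
      moreover have "(\<Inter>k. B k) = {}"
      proof (rule ccontr)
        assume "(\<Inter>k. B k) \<noteq> {}"
        then obtain x where x: "\<And>k. x \<in> B k" by blast
        then have "infdist (\<phi> x) C \<noteq> 0"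
          using in_closed_iff_infdist_zero[OF C False, of "\<phi> x"] by (auto simp: B_def)
        then have "0 < infdist (\<phi> x) C" using infdist_nonneg[of "\<phi> x" C] by simp
        then obtain k where "1 / real (Suc k) < infdist (\<phi> x) C" using nat_approx_posE by blast
        then show False using x[of k] by (simp add: B_def)
      qed
      ultimately obtain k where k: "measure m (B k) < \<epsilon> / 2"
        using LIMSEQ_D[of "\<lambda>k. measure m (B k)" 0 "\<epsilon> / 2"] \<epsilon> by auto
      define \<delta> where "\<delta> = 1 / real (Suc k)"
      show "\<exists>b. b \<longlonglongrightarrow> 0 \<and> (\<forall>n. measure (\<Omega> n) (differ (\<phi> -` C \<inter> space m) n) \<le> b n + \<epsilon>)"
      proof (intro exI conjI allI)
        show "(\<lambda>n. measure (\<Omega> n) {\<omega> \<in> space (\<Omega> n). \<delta> \<le> dist (\<phi> (\<xi> n \<omega>)) (\<phi> (\<xi>' n \<omega>))}) \<longlonglongrightarrow> 0"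
          by (rule conv) (simp add: \<delta>_def)
        fix n
        interpret \<Omega>: prob_space "\<Omega> n" by (rule prob_\<Omega>)
        let ?D = "{\<omega> \<in> space (\<Omega> n). \<delta> \<le> dist (\<phi> (\<xi> n \<omega>)) (\<phi> (\<xi>' n \<omega>))}"
        let ?B1 = "{\<omega> \<in> space (\<Omega> n). \<xi> n \<omega> \<in> B k}" and ?B2 = "{\<omega> \<in> space (\<Omega> n). \<xi>' n \<omega> \<in> B k}"
        have D[measurable]: "?D \<in> sets (\<Omega> n)" by measurable
        have "differ (\<phi> -` C \<inter> space m) n \<subseteq> ?D \<union> (?B1 \<union> ?B2)"
        proof
          fix \<omega> assume w: "\<omega> \<in> differ (\<phi> -` C \<inter> space m) n"
          then have w1: "\<omega> \<in> space (\<Omega> n)" by (simp add: differ_def)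
          note sp = \<xi>_space[OF w1]
          consider "\<phi> (\<xi> n \<omega>) \<in> C" "\<phi> (\<xi>' n \<omega>) \<notin> C" | "\<phi> (\<xi> n \<omega>) \<notin> C" "\<phi> (\<xi>' n \<omega>) \<in> C"
            using w sp by (auto simp: differ_def)
          then show "\<omega> \<in> ?D \<union> (?B1 \<union> ?B2)"
          proof cases
            case 1
            have "infdist (\<phi> (\<xi>' n \<omega>)) C \<le> dist (\<phi> (\<xi> n \<omega>)) (\<phi> (\<xi>' n \<omega>))"
              using infdist_le[OF 1(1), of "\<phi> (\<xi>' n \<omega>)"] by (simp add: dist_commute)
            then show ?thesis using 1 w1 sp by (auto simp: B_def \<delta>_def)
          next
            case 2
            have "infdist (\<phi> (\<xi> n \<omega>)) C \<le> dist (\<phi> (\<xi> n \<omega>)) (\<phi> (\<xi>' n \<omega>))"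
              using infdist_le[OF 2(2), of "\<phi> (\<xi> n \<omega>)"] by simp
            then show ?thesis using 2 w1 sp by (auto simp: B_def \<delta>_def)
          qed
        qed
        then have "measure (\<Omega> n) (differ (\<phi> -` C \<inter> space m) n) \<le> measure (\<Omega> n) (?D \<union> (?B1 \<union> ?B2))"
          by (rule \<Omega>.finite_measure_mono) measurable
        also have "\<dots> \<le> measure (\<Omega> n) ?D + measure (\<Omega> n) (?B1 \<union> ?B2)"
          by (rule measure_Un_le) measurable
        also have "measure (\<Omega> n) (?B1 \<union> ?B2) \<le> measure (\<Omega> n) ?B1 + measure (\<Omega> n) ?B2"
          by (rule measure_Un_le) measurable
        also have "\<dots> \<le> \<epsilon>" using k by (simp add: measure_\<xi>)
        finally show "measure (\<Omega> n) (differ (\<phi> -` C \<inter> space m) n) \<le> measure (\<Omega> n) ?D + \<epsilon>" by simp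
      qed
    qed
  qed
  ultimately show "\<phi> -` C \<inter> space merging_algebra \<in> sets merging_algebra"
    by (simp add: sets_merging_algebra)
qed auto

text \<open>If the two values differ by more than \<epsilon>, some multiple of \<epsilon> separates
  them, so the variables disagree on one of the level sets \<open>A j\<close>. As \<open>f\<close>
  is bounded, finitely many levels suffice.\<close>

lemma Lp_merging_bounded:
  fixes f :: "'x \<Rightarrow> real"
  assumes all: "\<And>A. A \<in> sets m \<Longrightarrow> merges A" and f[measurable]: "f \<in> borel_measurable m"
    and M: "\<And>x. \<bar>f x\<bar> \<le> M" and p: "0 < p"
  shows "(\<lambda>n. \<integral>\<^sup>+\<omega>. ennreal (\<bar>f (\<xi> n \<omega>) - f (\<xi>' n \<omega>)\<bar> powr p) \<partial>\<Omega> n) \<longlonglongrightarrow> 0"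
proof (rule tendsto_0_ennreal_le[where c=2])
  fix e :: real assume e: "0 < e"
  \<comment> \<open>Differences up to \<epsilon> then contribute at most \<open>e\<close> to the
    integral.\<close>
  define \<epsilon> where "\<epsilon> = e powr (1 / p)"
  have \<epsilon>: "0 < \<epsilon>" "\<epsilon> powr p = e" using e p by (simp_all add: \<epsilon>_def powr_powr)
  have M0: "0 \<le> M" using M[of undefined] by linarith
  define J where "J = {-\<lceil>M / \<epsilon>\<rceil> .. \<lceil>M / \<epsilon>\<rceil>}"
  define A where "A j = {x \<in> space m. f x \<le> of_int j * \<epsilon>}" for j :: int
  have [measurable]: "A j \<in> sets m" for j unfolding A_def by measurable
  define b where "b n = (\<Sum>j\<in>J. measure (\<Omega> n) (differ (A j) n))" for n
  have b: "b \<longlonglongrightarrow> 0"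
    unfolding b_def using all[of "A _"] by (intro tendsto_null_sum) (simp add: merges_def)
  have le: "(\<integral>\<^sup>+\<omega>. ennreal (\<bar>f (\<xi> n \<omega>) - f (\<xi>' n \<omega>)\<bar> powr p) \<partial>\<Omega> n) \<le> ennreal (e + (2 * M) powr p * b n)" for n
  proof -
    interpret \<Omega>: prob_space "\<Omega> n" by (rule prob_\<Omega>)
    define D where "D = (\<Union>j\<in>J. differ (A j) n)"
    have [measurable]: "D \<in> sets (\<Omega> n)" unfolding D_def J_def by measurable
    have D: "\<omega> \<in> D" if w: "\<omega> \<in> space (\<Omega> n)" and far: "\<bar>f (\<xi> n \<omega>) - f (\<xi>' n \<omega>)\<bar> > \<epsilon>" for \<omega>
    proof -
      \<comment> \<open>The separating level is \<open>s\<close> rounded up to a multiple of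
        \<epsilon>, which exceeds \<open>s\<close> by less than \<epsilon>.\<close>
      have *: "\<exists>j\<in>J. s \<le> of_int j * \<epsilon> \<and> of_int j * \<epsilon> < t" if "t - s > \<epsilon>" "\<bar>s\<bar> \<le> M" for s t
      proof
        have "s / \<epsilon> \<le> of_int \<lceil>s / \<epsilon>\<rceil>" "of_int \<lceil>s / \<epsilon>\<rceil> < s / \<epsilon> + 1" by linarith+
        then have "s / \<epsilon> * \<epsilon> \<le> of_int \<lceil>s / \<epsilon>\<rceil> * \<epsilon>" "of_int \<lceil>s / \<epsilon>\<rceil> * \<epsilon> < (s / \<epsilon> + 1) * \<epsilon>"
          using \<epsilon>(1) by (intro mult_right_mono mult_strict_right_mono; simp)+
        then show "s \<le> of_int \<lceil>s / \<epsilon>\<rceil> * \<epsilon> \<and> of_int \<lceil>s / \<epsilon>\<rceil> * \<epsilon> < t"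
          using \<epsilon>(1) that(1) by (simp add: distrib_right)
        have "-\<lceil>b\<rceil> \<le> \<lceil>a\<rceil> \<and> \<lceil>a\<rceil> \<le> \<lceil>b\<rceil>" if "- b \<le> a" "a \<le> b" for a b :: real
          using that by linarith
        moreover have "- (M / \<epsilon>) \<le> s / \<epsilon>" "s / \<epsilon> \<le> M / \<epsilon>"
          using that(2) \<epsilon>(1) by (simp_all add: divide_right_mono minus_divide_left del: minus_divide_left[symmetric])
        ultimately show "\<lceil>s / \<epsilon>\<rceil> \<in> J" unfolding J_def by simp
      qed
      note sp = \<xi>_space[OF w]
      show ?thesis
      proof (cases "f (\<xi> n \<omega>) < f (\<xi>' n \<omega>)")
        case True
        then obtain j where "j \<in> J" "f (\<xi> n \<omega>) \<le> of_int j * \<epsilon>" "of_int j * \<epsilon> < f (\<xi>' n \<omega>)"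
          using *[of "f (\<xi>' n \<omega>)" "f (\<xi> n \<omega>)"] far M by auto
        then show ?thesis using w sp by (auto simp: D_def differ_def A_def intro!: bexI[of _ j])
      next
        case False
        then obtain j where "j \<in> J" "f (\<xi>' n \<omega>) \<le> of_int j * \<epsilon>" "of_int j * \<epsilon> < f (\<xi> n \<omega>)"
          using *[of "f (\<xi> n \<omega>)" "f (\<xi>' n \<omega>)"] far M by auto
        then show ?thesis using w sp by (auto simp: D_def differ_def A_def intro!: bexI[of _ j])
      qed
    qed
    have "(\<integral>\<^sup>+\<omega>. ennreal (\<bar>f (\<xi> n \<omega>) - f (\<xi>' n \<omega>)\<bar> powr p) \<partial>\<Omega> n) \<le>
      (\<integral>\<^sup>+\<omega>. ennreal e + ennreal ((2 * M) powr p) * indicator D \<omega> \<partial>\<Omega> n)"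
    proof (rule nn_integral_mono)
      fix \<omega> assume w: "\<omega> \<in> space (\<Omega> n)"
      show "ennreal (\<bar>f (\<xi> n \<omega>) - f (\<xi>' n \<omega>)\<bar> powr p) \<le> ennreal e + ennreal ((2 * M) powr p) * indicator D \<omega>"
      proof (cases "\<bar>f (\<xi> n \<omega>) - f (\<xi>' n \<omega>)\<bar> > \<epsilon>")
        case True
        have "\<bar>f (\<xi> n \<omega>) - f (\<xi>' n \<omega>)\<bar> \<le> 2 * M" using M[of "\<xi> n \<omega>"] M[of "\<xi>' n \<omega>"] by linarith
        then have "\<bar>f (\<xi> n \<omega>) - f (\<xi>' n \<omega>)\<bar> powr p \<le> (2 * M) powr p" using p by (intro powr_mono2) auto
        then show ?thesis using D[OF w True] by (simp add: ennreal_leI add_increasing)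
      next
        case False
        then have "\<bar>f (\<xi> n \<omega>) - f (\<xi>' n \<omega>)\<bar> powr p \<le> \<epsilon> powr p" using p by (intro powr_mono2) auto
        then show ?thesis using \<epsilon>(2) by (simp add: ennreal_leI add_increasing2)
      qed
    qed
    also have "\<dots> = ennreal e + ennreal ((2 * M) powr p) * emeasure (\<Omega> n) D"
      by (simp add: nn_integral_add nn_integral_cmult_indicator \<Omega>.emeasure_space_1)
    also have "\<dots> \<le> ennreal e + ennreal ((2 * M) powr p) * ennreal (b n)"
    proof -
      have "measure (\<Omega> n) D \<le> b n"
        unfolding D_def b_def by (rule \<Omega>.finite_measure_subadditive_finite) (auto simp: J_def)
      then show ?thesis by (intro add_left_mono mult_left_mono) (simp_all add: \<Omega>.emeasure_eq_measure ennreal_leI)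
    qed
    also have "\<dots> = ennreal (e + (2 * M) powr p * b n)"
      using e by (simp add: ennreal_plus ennreal_mult' b_def sum_nonneg)
    finally show ?thesis .
  qed
  have "(\<lambda>n. e + (2 * M) powr p * b n) \<longlonglongrightarrow> e + (2 * M) powr p * 0"
    by (intro tendsto_intros b)
  then have "\<forall>\<^sub>F n in sequentially. e + (2 * M) powr p * b n < 2 * e"
    using e by (intro order_tendstoD(2)) auto
  then show "\<forall>\<^sub>F n in sequentially. (\<integral>\<^sup>+\<omega>. ennreal (\<bar>f (\<xi> n \<omega>) - f (\<xi>' n \<omega>)\<bar> powr p) \<partial>\<Omega> n) \<le> ennreal (2 * e)"
    by eventually_elim (use le in \<open>meson ennreal_leI less_imp_le order_trans\<close>)
qed simp

text \<open>Truncate \<open>f\<close> and use the bounded case. The two truncation errors depend on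
  the common law only, so they are small uniformly in \<open>n\<close>.\<close>

lemma Lp_merging:
  fixes f :: "'x \<Rightarrow> real"
  assumes all: "\<And>A. A \<in> sets m \<Longrightarrow> merges A" and f[measurable]: "f \<in> borel_measurable m"
    and fin: "(\<integral>\<^sup>+x. ennreal (\<bar>f x\<bar> powr p) \<partial>m) < \<infinity>" and p: "0 < p"
  shows "(\<lambda>n. \<integral>\<^sup>+\<omega>. ennreal (\<bar>f (\<xi> n \<omega>) - f (\<xi>' n \<omega>)\<bar> powr p) \<partial>\<Omega> n) \<longlonglongrightarrow> 0"
\<comment> \<open>A difference is split into three parts by two applications of
  \<open>powr_add_le\<close>, and each part contributes at most \<open>e\<close>.\<close>
proof (rule tendsto_0_ennreal_le[where c="2 powr p * 2 powr p * 3"])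
  fix e :: real assume e: "0 < e"
  define g where "g M x = max (- real M) (min (real M) (f x))" for M :: nat and x
  have [measurable]: "g M \<in> borel_measurable m" for M unfolding g_def by measurable
  have "(\<lambda>M. \<integral>\<^sup>+x. ennreal (\<bar>f x - g M x\<bar> powr p) \<partial>m) \<longlonglongrightarrow> (\<integral>\<^sup>+x. 0 \<partial>m)"
  proof (rule nn_integral_dominated_convergence[OF _ _ _ _ fin])
    show "AE x in m. ennreal (\<bar>f x - g M x\<bar> powr p) \<le> ennreal (\<bar>f x\<bar> powr p)" for M
      using p by (intro AE_I2 ennreal_leI powr_mono2) (auto simp: g_def)
    show "AE x in m. (\<lambda>M. ennreal (\<bar>f x - g M x\<bar> powr p)) \<longlonglongrightarrow> 0"
    proof (rule AE_I2)
      fix x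
      obtain K where "\<bar>f x\<bar> \<le> real K" using real_arch_simple by blast
      then have "f x - g M x = 0" if "K \<le> M" for M using that by (auto simp: g_def)
      then have "\<forall>\<^sub>F M in sequentially. ennreal (\<bar>f x - g M x\<bar> powr p) = 0"
        by (intro eventually_sequentiallyI[of K]) simp
      then show "(\<lambda>M. ennreal (\<bar>f x - g M x\<bar> powr p)) \<longlonglongrightarrow> 0" by (rule tendsto_eventually)
    qed
  qed auto
  then have "\<forall>\<^sub>F M in sequentially. (\<integral>\<^sup>+x. ennreal (\<bar>f x - g M x\<bar> powr p) \<partial>m) < ennreal e"
    using e by (intro order_tendstoD(2)) auto
  then obtain M where M: "(\<integral>\<^sup>+x. ennreal (\<bar>f x - g M x\<bar> powr p) \<partial>m) < ennreal e"
    using eventually_happens by force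
  let ?c = "2 powr p * 2 powr p"
  have c: "1 \<le> 2 powr p" using p by (simp add: ge_one_powr_ge_zero)
  have pt: "\<bar>a - b\<bar> powr p \<le> ?c * (\<bar>a - a'\<bar> powr p + \<bar>b - b'\<bar> powr p + \<bar>a' - b'\<bar> powr p)" for a b a' b' :: real
  proof -
    have "\<bar>a - b\<bar> powr p \<le> (\<bar>a - a'\<bar> + (\<bar>b - b'\<bar> + \<bar>a' - b'\<bar>)) powr p" using p by (intro powr_mono2) auto
    also have "\<dots> \<le> 2 powr p * (\<bar>a - a'\<bar> powr p + (\<bar>b - b'\<bar> + \<bar>a' - b'\<bar>) powr p)"
      using p by (intro powr_add_le) auto
    also have "\<dots> \<le> 2 powr p * (2 powr p * \<bar>a - a'\<bar> powr p + 2 powr p * (\<bar>b - b'\<bar> powr p + \<bar>a' - b'\<bar> powr p))"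
    proof (intro mult_left_mono add_mono)
      show "\<bar>a - a'\<bar> powr p \<le> 2 powr p * \<bar>a - a'\<bar> powr p"
        using mult_right_mono[OF c, of "\<bar>a - a'\<bar> powr p"] by simp
      show "(\<bar>b - b'\<bar> + \<bar>a' - b'\<bar>) powr p \<le> 2 powr p * (\<bar>b - b'\<bar> powr p + \<bar>a' - b'\<bar> powr p)"
        using p by (intro powr_add_le) auto
    qed simp
    finally show ?thesis by (simp add: algebra_simps)
  qed
  have bdd: "(\<lambda>n. \<integral>\<^sup>+\<omega>. ennreal (\<bar>g M (\<xi> n \<omega>) - g M (\<xi>' n \<omega>)\<bar> powr p) \<partial>\<Omega> n) \<longlonglongrightarrow> 0"
    by (rule Lp_merging_bounded[OF all _ _ p, where M="real M"]) (auto simp: g_def)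
  then have "\<forall>\<^sub>F n in sequentially. (\<integral>\<^sup>+\<omega>. ennreal (\<bar>g M (\<xi> n \<omega>) - g M (\<xi>' n \<omega>)\<bar> powr p) \<partial>\<Omega> n) < ennreal e"
    using e by (intro order_tendstoD(2)) auto
  then show "\<forall>\<^sub>F n in sequentially. (\<integral>\<^sup>+\<omega>. ennreal (\<bar>f (\<xi> n \<omega>) - f (\<xi>' n \<omega>)\<bar> powr p) \<partial>\<Omega> n) \<le> ennreal (?c * 3 * e)"
  proof eventually_elim
    case (elim n)
    have "(\<integral>\<^sup>+\<omega>. ennreal (\<bar>f (\<xi> n \<omega>) - f (\<xi>' n \<omega>)\<bar> powr p) \<partial>\<Omega> n) \<le>
      (\<integral>\<^sup>+\<omega>. ennreal ?c * (ennreal (\<bar>f (\<xi> n \<omega>) - g M (\<xi> n \<omega>)\<bar> powr p) + ennreal (\<bar>f (\<xi>' n \<omega>) - g M (\<xi>' n \<omega>)\<bar> powr p)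
        + ennreal (\<bar>g M (\<xi> n \<omega>) - g M (\<xi>' n \<omega>)\<bar> powr p)) \<partial>\<Omega> n)"
      using pt by (intro nn_integral_mono) (simp add: ennreal_plus[symmetric] ennreal_mult[symmetric] ennreal_leI del: ennreal_plus)
    also have "\<dots> = ennreal ?c * ((\<integral>\<^sup>+\<omega>. ennreal (\<bar>f (\<xi> n \<omega>) - g M (\<xi> n \<omega>)\<bar> powr p) \<partial>\<Omega> n)
       + (\<integral>\<^sup>+\<omega>. ennreal (\<bar>f (\<xi>' n \<omega>) - g M (\<xi>' n \<omega>)\<bar> powr p) \<partial>\<Omega> n)
       + (\<integral>\<^sup>+\<omega>. ennreal (\<bar>g M (\<xi> n \<omega>) - g M (\<xi>' n \<omega>)\<bar> powr p) \<partial>\<Omega> n))"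
      by (simp add: nn_integral_cmult nn_integral_add)
    also have "\<dots> \<le> ennreal ?c * (ennreal e + ennreal e + ennreal e)"
    proof (intro mult_left_mono add_mono)
      show "(\<integral>\<^sup>+\<omega>. ennreal (\<bar>f (\<xi> n \<omega>) - g M (\<xi> n \<omega>)\<bar> powr p) \<partial>\<Omega> n) \<le> ennreal e"
        using M nn_integral_\<xi>(1)[of "\<lambda>x. ennreal (\<bar>f x - g M x\<bar> powr p)" n] by simp
      show "(\<integral>\<^sup>+\<omega>. ennreal (\<bar>f (\<xi>' n \<omega>) - g M (\<xi>' n \<omega>)\<bar> powr p) \<partial>\<Omega> n) \<le> ennreal e"
        using M nn_integral_\<xi>(2)[of "\<lambda>x. ennreal (\<bar>f x - g M x\<bar> powr p)" n] by simp
    qed (use elim in auto)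
    also have "\<dots> = ennreal (?c * 3 * e)"
      using e by (simp add: ennreal_plus[symmetric] ennreal_mult[symmetric] mult.assoc del: ennreal_plus)
    finally show ?case .
  qed
qed simp

end

section \<open>Transport costs\<close>

lemma pnorm_pow_nonneg [simp]: "0 \<le> pnorm_pow p v"
  by (simp add: pnorm_pow_def sum_nonneg)

lemma pnorm_pow_commute: "pnorm_pow p (x - y) = pnorm_pow p (y - x)"
  by (simp add: pnorm_pow_def abs_minus_commute)

lemma pnorm_pow_triangle:
  assumes "0 \<le> p"
  shows "pnorm_pow p (x - z) \<le> 2 powr p * (pnorm_pow p (x - y) + pnorm_pow p (y - z))"
proof -
  have "\<bar>x $ i - z $ i\<bar> powr p \<le> 2 powr p * (\<bar>x $ i - y $ i\<bar> powr p + \<bar>y $ i - z $ i\<bar> powr p)" for i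
  proof -
    have "\<bar>x $ i - z $ i\<bar> powr p \<le> (\<bar>x $ i - y $ i\<bar> + \<bar>y $ i - z $ i\<bar>) powr p"
      using assms by (intro powr_mono2) auto
    also have "\<dots> \<le> 2 powr p * (\<bar>x $ i - y $ i\<bar> powr p + \<bar>y $ i - z $ i\<bar> powr p)"
      using assms by (intro powr_add_le) auto
    finally show ?thesis .
  qed
  then have "(\<Sum>i\<in>UNIV. \<bar>x $ i - z $ i\<bar> powr p) \<le>
    (\<Sum>i\<in>UNIV. 2 powr p * (\<bar>x $ i - y $ i\<bar> powr p + \<bar>y $ i - z $ i\<bar> powr p))"
    by (rule sum_mono)
  then show ?thesis by (simp add: pnorm_pow_def sum_distrib_left[symmetric] sum.distrib)
qed

lemma continuous_pnorm_pow: "0 < p \<Longrightarrow> continuous_on S (pnorm_pow p :: real ^ 'd::finite \<Rightarrow> real)"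
  unfolding pnorm_pow_def
  by (intro continuous_intros continuous_on_powr') auto

lemma measurable_pnorm_pow [measurable]: "pnorm_pow p \<in> borel_measurable (borel :: (real ^ 'd::finite) measure)"
  unfolding pnorm_pow_def by measurable

text \<open>The norm is at most the sum of the absolute coordinates, so some coordinate is at least
  \<delta> divided by the dimension. Serves in a Markov inequality.\<close>

lemma pnorm_pow_ge:
  fixes v :: "real ^ 'd::finite"
  assumes "0 < p" "0 < \<delta>" "\<delta> \<le> norm v"
  shows "(\<delta> / real CARD('d)) powr p \<le> pnorm_pow p v"
proof -
  have "\<exists>i. \<delta> / real CARD('d) \<le> \<bar>v $ i\<bar>"
  proof (rule ccontr)
    assume "\<nexists>i. \<delta> / real CARD('d) \<le> \<bar>v $ i\<bar>"
    then have "(\<Sum>i\<in>UNIV. \<bar>v $ i\<bar>) < (\<Sum>i\<in>(UNIV::'d set). \<delta> / real CARD('d))"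
      by (intro sum_strict_mono) (auto simp: not_le)
    then show False using norm_le_l1_cart[of v] assms by simp
  qed
  then obtain i where i: "\<delta> / real CARD('d) \<le> \<bar>v $ i\<bar>" by blast
  have "(\<delta> / real CARD('d)) powr p \<le> \<bar>v $ i\<bar> powr p"
    using assms i by (intro powr_mono2) auto
  also have "\<dots> \<le> pnorm_pow p v"
    unfolding pnorm_pow_def by (rule member_le_sum) auto
  finally show ?thesis .
qed

text \<open>The transport cost before the p-th root is taken, so that costs of conditional laws can
  be integrated over the history.\<close>

definition coupling_cost :: "real \<Rightarrow> ((real ^ 'd::finite) \<times> (real ^ 'd)) measure \<Rightarrow> ennreal" where
  "coupling_cost p \<gamma> = (\<integral>\<^sup>+(x, y). ennreal (pnorm_pow p (x - y)) \<partial>\<gamma>)"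

lemma ennroot_less_iff:
  assumes p: "0 < p" and r: "0 < r"
  shows "ennroot p a < ennreal r \<longleftrightarrow> a < ennreal (r powr p)"
proof (cases a)
  case (real t)
  have "t powr (1 / p) < r \<longleftrightarrow> t < r powr p"
  proof
    assume "t powr (1 / p) < r"
    then have "(t powr (1 / p)) powr p < r powr p" using p by (intro powr_less_mono2) auto
    then show "t < r powr p" using p real by (simp add: powr_powr)
  next
    assume "t < r powr p"
    then have "t powr (1 / p) < (r powr p) powr (1 / p)" using p real by (intro powr_less_mono2) auto
    then show "t powr (1 / p) < r" using p r by (simp add: powr_powr)
  qed
  then show ?thesis using real r by (simp add: ennroot_def ennreal_less_iff)
qed (simp add: ennroot_def)

lemma ennroot_le_iff:
  assumes p: "0 < p"
  shows "ennroot p a \<le> ennroot p b \<longleftrightarrow> a \<le> b"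
proof (cases a; cases b)
  fix s t :: real assume *: "0 \<le> s" "a = ennreal s" "0 \<le> t" "b = ennreal t"
  have "s powr (1 / p) \<le> t powr (1 / p) \<longleftrightarrow> s \<le> t"
    using p * powr_mono2[of "1 / p" s t] powr_less_mono2[of "1 / p" t s] by (auto simp: not_le[symmetric])
  then show ?thesis using * by (simp add: ennroot_def ennreal_le_iff)
qed (simp_all add: ennroot_def top_unique)

lemma tendsto_ennroot_0_iff:
  fixes F :: "nat \<Rightarrow> ennreal"
  assumes p: "0 < p"
  shows "(\<lambda>n. ennroot p (F n)) \<longlonglongrightarrow> 0 \<longleftrightarrow> F \<longlonglongrightarrow> 0"
proof
  assume *: "(\<lambda>n. ennroot p (F n)) \<longlonglongrightarrow> 0"
  show "F \<longlonglongrightarrow> 0"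
  proof (rule tendsto_0_ennreal_le[where c=1])
    fix e :: real assume e: "0 < e"
    have "\<forall>\<^sub>F n in sequentially. ennroot p (F n) < ennreal (e powr (1 / p))"
      using e by (intro order_tendstoD(2)[OF *]) simp
    then show "\<forall>\<^sub>F n in sequentially. F n \<le> ennreal (1 * e)"
      using e p by (simp add: ennroot_less_iff powr_powr) (auto elim: eventually_mono)
  qed simp
next
  assume *: "F \<longlonglongrightarrow> 0"
  show "(\<lambda>n. ennroot p (F n)) \<longlonglongrightarrow> 0"
  proof (rule tendsto_0_ennreal_le[where c=1])
    fix e :: real assume e: "0 < e"
    have "\<forall>\<^sub>F n in sequentially. F n < ennreal (e powr p)"
      using e by (intro order_tendstoD(2)[OF *]) simp
    then show "\<forall>\<^sub>F n in sequentially. ennroot p (F n) \<le> ennreal (1 * e)"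
      using e p by (simp add: ennroot_less_iff[symmetric]) (auto elim: eventually_mono)
  qed simp
qed

lemma optimal_couplings_iff:
  assumes "0 < p"
  shows "\<gamma> \<in> optimal_couplings p \<alpha> \<beta> \<longleftrightarrow>
    \<gamma> \<in> couplings \<alpha> \<beta> \<and> (\<forall>\<gamma>'\<in>couplings \<alpha> \<beta>. coupling_cost p \<gamma> \<le> coupling_cost p \<gamma>')"
proof -
  have tc: "transport_cost p \<gamma> = ennroot p (coupling_cost p \<gamma>)" for \<gamma> :: "((real ^ 'a) \<times> (real ^ 'a)) measure"
    by (simp add: transport_cost_def coupling_cost_def)
  show ?thesis
  proof
    assume "\<gamma> \<in> optimal_couplings p \<alpha> \<beta>"
    then have 1: "\<gamma> \<in> couplings \<alpha> \<beta>" and 2: "transport_cost p \<gamma> = wasserstein p \<alpha> \<beta>"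
      by (auto simp: optimal_couplings_def)
    have "transport_cost p \<gamma> \<le> transport_cost p \<gamma>'" if "\<gamma>' \<in> couplings \<alpha> \<beta>" for \<gamma>'
      unfolding 2 wasserstein_def using that by (rule INF_lower)
    then show "\<gamma> \<in> couplings \<alpha> \<beta> \<and> (\<forall>\<gamma>'\<in>couplings \<alpha> \<beta>. coupling_cost p \<gamma> \<le> coupling_cost p \<gamma>')"
      using 1 by (simp add: tc ennroot_le_iff[OF assms])
  next
    assume *: "\<gamma> \<in> couplings \<alpha> \<beta> \<and> (\<forall>\<gamma>'\<in>couplings \<alpha> \<beta>. coupling_cost p \<gamma> \<le> coupling_cost p \<gamma>')"
    then have "transport_cost p \<gamma> = wasserstein p \<alpha> \<beta>"
      unfolding wasserstein_def
      by (intro antisym INF_greatest INF_lower) (auto simp: tc ennroot_le_iff[OF assms])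
    then show "\<gamma> \<in> optimal_couplings p \<alpha> \<beta>" using * by (simp add: optimal_couplings_def)
  qed
qed

section \<open>Minimal cost and measurable optimal couplings of laws on the state space\<close>

lemma measurable_coupling_cost [measurable]:
  "coupling_cost p \<in> borel_measurable (prob_algebra (borel \<Otimes>\<^sub>M borel))"
proof -
  have m: "(\<lambda>z. ennreal (pnorm_pow p (fst z - snd z))) \<in> borel_measurable (borel \<Otimes>\<^sub>M borel)" by measurable
  have eq: "coupling_cost p = (\<lambda>\<gamma>. \<integral>\<^sup>+z. ennreal (pnorm_pow p (fst z - snd z)) \<partial>\<gamma>)"
    by (simp add: fun_eq_iff coupling_cost_def split_beta')
  show ?thesis
    unfolding eq
    by (rule measurable_compose[OF measurable_prob_algebraD[OF measurable_ident_sets[OF refl]]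
        nn_integral_measurable_subprob_algebra[OF m]])
qed

definition min_cost :: "real \<Rightarrow> (real ^ 'd::finite) measure \<Rightarrow> (real ^ 'd) measure \<Rightarrow> ennreal" where
  "min_cost p \<alpha> \<beta> = (INF \<gamma>\<in>couplings \<alpha> \<beta>. coupling_cost p \<gamma>)"

text \<open>With the pair of laws itself as the parameter, one universal selection is obtained,
  which can be composed with any two measurable kernels.\<close>

lemma optimal_kernel:
  assumes p: "0 < p"
  obtains Opt :: "(real ^ 'd::finite) measure \<times> (real ^ 'd) measure \<Rightarrow> ((real ^ 'd) \<times> (real ^ 'd)) measure"
  where "Opt \<in> prob_algebra borel \<Otimes>\<^sub>M prob_algebra borel \<rightarrow>\<^sub>M prob_algebra (borel \<Otimes>\<^sub>M borel)"
    "\<And>\<alpha> \<beta>. \<alpha> \<in> space (prob_algebra borel) \<Longrightarrow> \<beta> \<in> space (prob_algebra borel) \<Longrightarrow>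
      Opt (\<alpha>, \<beta>) \<in> optimal_couplings p \<alpha> \<beta> \<and> coupling_cost p (Opt (\<alpha>, \<beta>)) = min_cost p \<alpha> \<beta>"
proof -
  have "continuous_on UNIV (\<lambda>z :: (real ^ 'd) \<times> (real ^ 'd). pnorm_pow p (fst z - snd z))"
    by (intro continuous_on_compose2[OF continuous_pnorm_pow[OF p, of UNIV]] continuous_intros) simp
  then obtain Opt :: "(real ^ 'd) measure \<times> (real ^ 'd) measure \<Rightarrow> ((real ^ 'd) \<times> (real ^ 'd)) measure"
    where O: "Opt \<in> prob_algebra borel \<Otimes>\<^sub>M prob_algebra borel \<rightarrow>\<^sub>M prob_algebra (borel \<Otimes>\<^sub>M borel)"
    "\<And>h. h \<in> space (prob_algebra borel \<Otimes>\<^sub>M prob_algebra borel) \<Longrightarrow> Opt h \<in> couplings (fst h) (snd h)"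
    "\<And>h \<gamma>. h \<in> space (prob_algebra borel \<Otimes>\<^sub>M prob_algebra borel) \<Longrightarrow> \<gamma> \<in> couplings (fst h) (snd h) \<Longrightarrow>
      coupling_cost p (Opt h) \<le> coupling_cost p \<gamma>"
    unfolding coupling_cost_def
    by (rule measurable_optimal_coupling[OF _ _ measurable_fst measurable_snd, of "\<lambda>x y. pnorm_pow p (x - y)"]) auto
  show ?thesis
  proof (rule that[OF O(1)])
    fix \<alpha> \<beta> :: "(real ^ 'd) measure"
    assume "\<alpha> \<in> space (prob_algebra borel)" "\<beta> \<in> space (prob_algebra borel)"
    then have h: "(\<alpha>, \<beta>) \<in> space (prob_algebra borel \<Otimes>\<^sub>M prob_algebra borel)"
      by (simp add: space_pair_measure)
    have 1: "Opt (\<alpha>, \<beta>) \<in> couplings \<alpha> \<beta>" using O(2)[OF h] by simp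
    have 2: "coupling_cost p (Opt (\<alpha>, \<beta>)) \<le> coupling_cost p \<gamma>" if "\<gamma> \<in> couplings \<alpha> \<beta>" for \<gamma>
      using O(3)[OF h] that by simp
    show "Opt (\<alpha>, \<beta>) \<in> optimal_couplings p \<alpha> \<beta> \<and> coupling_cost p (Opt (\<alpha>, \<beta>)) = min_cost p \<alpha> \<beta>"
      using 1 2 unfolding optimal_couplings_iff[OF p] min_cost_def
      by (auto intro!: antisym INF_greatest INF_lower2[of "Opt (\<alpha>, \<beta>)"])
  qed
qed

text \<open>An infimum over uncountably many couplings, measurable because the measurable selection
  attains it.\<close>

lemma measurable_min_cost:
  assumes p: "0 < p" and f: "f \<in> M \<rightarrow>\<^sub>M prob_algebra (borel :: (real ^ 'd::finite) measure)" and g: "g \<in> M \<rightarrow>\<^sub>M prob_algebra borel"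
  shows "(\<lambda>x. min_cost p (f x) (g x)) \<in> borel_measurable M"
proof -
  obtain Opt where O: "Opt \<in> prob_algebra borel \<Otimes>\<^sub>M prob_algebra borel \<rightarrow>\<^sub>M prob_algebra (borel \<Otimes>\<^sub>M borel)"
    "\<And>\<alpha> \<beta> :: (real ^ 'd) measure. \<alpha> \<in> space (prob_algebra borel) \<Longrightarrow> \<beta> \<in> space (prob_algebra borel) \<Longrightarrow>
      Opt (\<alpha>, \<beta>) \<in> optimal_couplings p \<alpha> \<beta> \<and> coupling_cost p (Opt (\<alpha>, \<beta>)) = min_cost p \<alpha> \<beta>"
    by (rule optimal_kernel[OF p, where 'd='d]) blast
  have "(\<lambda>x. coupling_cost p (Opt (f x, g x))) \<in> borel_measurable M"
    by (rule measurable_compose[OF measurable_compose[OF measurable_Pair[OF f g] O(1)] measurable_coupling_cost])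
  then show ?thesis
    using O(2) measurable_space[OF f] measurable_space[OF g] by (subst measurable_cong) auto
qed

text \<open>The gluing device: two laws of pairs with the same first marginal can both be realized
  on the product of that marginal with \<open>unif\<close>.\<close>

lemma distr_randomization:
  assumes M: "M \<in> space (prob_algebra (H \<Otimes>\<^sub>M S))" and S: "coded S e d"
  obtains T where "T \<in> H \<Otimes>\<^sub>M borel \<rightarrow>\<^sub>M S"
    "M = distr (distr M H fst \<Otimes>\<^sub>M unif) (H \<Otimes>\<^sub>M S) (\<lambda>\<omega>. (fst \<omega>, T \<omega>))"
proof -
  interpret M: prob_space M using M by (simp add: space_prob_algebra)
  have sM[measurable_cong]: "sets M = sets (H \<Otimes>\<^sub>M S)" using M by (simp add: space_prob_algebra)
  define m where "m = distr M H fst"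
  have sm[measurable_cong]: "sets m = sets H" by (simp add: m_def)
  interpret m: prob_space m unfolding m_def by (rule M.prob_space_distr) measurable
  interpret U: prob_space unif by (rule prob_space_unif)
  have m: "m \<in> space (prob_algebra H)" using m.prob_space_axioms sm by (simp add: space_prob_algebra)
  obtain K where K: "K \<in> H \<rightarrow>\<^sub>M prob_algebra S" and MK: "M = joint H S m K"
    using rcp[OF M S] unfolding m_def by blast
  obtain T where T[measurable]: "T \<in> H \<Otimes>\<^sub>M borel \<rightarrow>\<^sub>M S" and KT: "\<And>h. h \<in> space H \<Longrightarrow> K h = distr unif S (\<lambda>u. T (h, u))"
    using outsource[OF K S] by blast
  have T'[measurable]: "(\<lambda>\<omega>. (fst \<omega>, T \<omega>)) \<in> m \<Otimes>\<^sub>M unif \<rightarrow>\<^sub>M H \<Otimes>\<^sub>M S" by measurable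
  have "M = distr (m \<Otimes>\<^sub>M unif) (H \<Otimes>\<^sub>M S) (\<lambda>\<omega>. (fst \<omega>, T \<omega>))"
  proof (rule measure_eqI_pair[OF M.prob_space_axioms sM])
    fix A B assume A[measurable]: "A \<in> sets H" and B[measurable]: "B \<in> sets S"
    have "emeasure (distr (m \<Otimes>\<^sub>M unif) (H \<Otimes>\<^sub>M S) (\<lambda>\<omega>. (fst \<omega>, T \<omega>))) (A \<times> B)
      = (\<integral>\<^sup>+\<omega>. indicator (A \<times> B) \<omega> \<partial>distr (m \<Otimes>\<^sub>M unif) (H \<Otimes>\<^sub>M S) (\<lambda>\<omega>. (fst \<omega>, T \<omega>)))" by simp
    also have "\<dots> = (\<integral>\<^sup>+\<omega>. indicator (A \<times> B) (fst \<omega>, T \<omega>) \<partial>(m \<Otimes>\<^sub>M unif))"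
      by (rule nn_integral_distr[OF T']) simp
    also have "\<dots> = (\<integral>\<^sup>+h. \<integral>\<^sup>+u. indicator A h * indicator B (T (h, u)) \<partial>unif \<partial>m)"
      by (subst U.nn_integral_fst[symmetric]) (auto simp: indicator_times)
    also have "\<dots> = (\<integral>\<^sup>+h. indicator A h * emeasure (K h) B \<partial>m)"
    proof (rule nn_integral_cong)
      fix h assume "h \<in> space m"
      then have h[measurable]: "h \<in> space H" using sets_eq_imp_space_eq[OF sm] by simp
      have Th[measurable]: "(\<lambda>u. T (h, u)) \<in> unif \<rightarrow>\<^sub>M S"
        using measurable_compose_Pair1[OF h T] by (simp cong: measurable_cong_sets)
      have "emeasure (K h) B = (\<integral>\<^sup>+s. indicator B s \<partial>distr unif S (\<lambda>u. T (h, u)))"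
        unfolding KT[OF h] by simp
      also have "\<dots> = (\<integral>\<^sup>+u. indicator B (T (h, u)) \<partial>unif)" by (rule nn_integral_distr[OF Th]) simp
      finally show "(\<integral>\<^sup>+u. indicator A h * indicator B (T (h, u)) \<partial>unif) = indicator A h * emeasure (K h) B"
        by (simp add: nn_integral_cmult)
    qed
    also have "\<dots> = emeasure M (A \<times> B)" unfolding MK by (rule emeasure_joint[OF K m A B, symmetric])
    finally show "emeasure M (A \<times> B) = emeasure (distr (m \<Otimes>\<^sub>M unif) (H \<Otimes>\<^sub>M S) (\<lambda>\<omega>. (fst \<omega>, T \<omega>))) (A \<times> B)" ..
  qed simp
  then show ?thesis using that[OF T] by (simp only: m_def)
qed

section \<open>Gluing of couplings and existence of triangular optimal couplings\<close>

lemma couplings_prob_algebra: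
  assumes "prob_space \<mu>" "sets \<mu> = sets A" "sets \<nu> = sets B" "\<gamma> \<in> couplings \<mu> \<nu>"
  shows "\<gamma> \<in> space (prob_algebra (A \<Otimes>\<^sub>M B))" "distr \<gamma> A fst = \<mu>" "distr \<gamma> B snd = \<nu>"
proof -
  have s: "sets \<gamma> = sets (\<mu> \<Otimes>\<^sub>M \<nu>)" "distr \<gamma> \<mu> fst = \<mu>" "distr \<gamma> \<nu> snd = \<nu>"
    using assms by (auto simp: couplings_def)
  have s': "sets \<gamma> = sets (A \<Otimes>\<^sub>M B)" unfolding s(1) by (rule sets_pair_measure_cong) (use assms in auto)
  have "fst \<in> \<gamma> \<rightarrow>\<^sub>M \<mu>" by (simp add: s(1) cong: measurable_cong_sets)
  then have "prob_space \<gamma>" using assms(1) s(2) prob_space_distrD by metis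
  then show "\<gamma> \<in> space (prob_algebra (A \<Otimes>\<^sub>M B))" using s' by (simp add: space_prob_algebra)
  have "distr \<gamma> A fst = distr \<gamma> \<mu> fst" by (rule distr_cong) (use assms in auto)
  then show "distr \<gamma> A fst = \<mu>" using s by simp
  have "distr \<gamma> B snd = distr \<gamma> \<nu> snd" by (rule distr_cong) (use assms in auto)
  then show "distr \<gamma> B snd = \<nu>" using s by simp
qed

lemma couplingsI:
  assumes "sets \<mu> = sets A" "sets \<nu> = sets B" "sets \<gamma> = sets (A \<Otimes>\<^sub>M B)"
    and "distr \<gamma> A fst = \<mu>" "distr \<gamma> B snd = \<nu>"
  shows "\<gamma> \<in> couplings \<mu> \<nu>"
proof -
  have "sets \<gamma> = sets (\<mu> \<Otimes>\<^sub>M \<nu>)" unfolding assms(3) by (rule sets_pair_measure_cong) (use assms in auto)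
  moreover have "distr \<gamma> \<mu> fst = distr \<gamma> A fst" "distr \<gamma> \<nu> snd = distr \<gamma> B snd"
    by (rule distr_cong; use assms in auto)+
  ultimately show ?thesis using assms by (simp add: couplings_def)
qed

lemma min_cost_le_maps:
  assumes P: "prob_space P" and f: "f \<in> P \<rightarrow>\<^sub>M borel" and g: "g \<in> P \<rightarrow>\<^sub>M borel"
    and \<alpha>: "\<alpha> = distr P borel f" and \<beta>: "\<beta> = distr P borel g"
  shows "min_cost p \<alpha> \<beta> \<le> (\<integral>\<^sup>+\<omega>. ennreal (pnorm_pow p (f \<omega> - g \<omega>)) \<partial>P)"
proof -
  define \<gamma> where "\<gamma> = distr P (borel \<Otimes>\<^sub>M borel) (\<lambda>\<omega>. (f \<omega>, g \<omega>))"
  have fg: "(\<lambda>\<omega>. (f \<omega>, g \<omega>)) \<in> P \<rightarrow>\<^sub>M borel \<Otimes>\<^sub>M borel" using f g by measurable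
  have "\<gamma> \<in> couplings \<alpha> \<beta>"
    by (rule couplingsI[of _ borel _ borel])
      (simp_all add: \<gamma>_def \<alpha> \<beta> distr_distr[OF measurable_fst fg] distr_distr[OF measurable_snd fg] comp_def)
  then have "min_cost p \<alpha> \<beta> \<le> coupling_cost p \<gamma>" unfolding min_cost_def by (rule INF_lower)
  also have "\<dots> = (\<integral>\<^sup>+\<omega>. ennreal (pnorm_pow p (f \<omega> - g \<omega>)) \<partial>P)"
    unfolding coupling_cost_def \<gamma>_def by (subst nn_integral_distr[OF fg]) (auto simp: split_beta')
  finally show ?thesis .
qed

text \<open>Optimal couplings are glued along the middle law \<beta>, both outer variables being
  functions of the same \<beta>-variable and the same noise. The factor 2^p comes from
  \<open>pnorm_pow_triangle\<close>.\<close>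

lemma min_cost_triangle:
  fixes \<alpha> \<beta> \<gamma> :: "(real ^ 'd::finite) measure"
  assumes p: "0 < p" and \<alpha>: "\<alpha> \<in> space (prob_algebra borel)" and \<beta>: "\<beta> \<in> space (prob_algebra borel)"
    and \<gamma>: "\<gamma> \<in> space (prob_algebra borel)"
  shows "min_cost p \<alpha> \<gamma> \<le> ennreal (2 powr p) * (min_cost p \<alpha> \<beta> + min_cost p \<beta> \<gamma>)"
proof -
  obtain e d where ed: "coded (borel :: (real ^ 'd) measure) e d" by (rule coded_polish) (rule that)
  obtain Opt where O: "Opt \<in> prob_algebra borel \<Otimes>\<^sub>M prob_algebra borel \<rightarrow>\<^sub>M prob_algebra (borel \<Otimes>\<^sub>M borel)"
    "\<And>\<alpha> \<beta> :: (real ^ 'd) measure. \<alpha> \<in> space (prob_algebra borel) \<Longrightarrow> \<beta> \<in> space (prob_algebra borel) \<Longrightarrow>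
      Opt (\<alpha>, \<beta>) \<in> optimal_couplings p \<alpha> \<beta> \<and> coupling_cost p (Opt (\<alpha>, \<beta>)) = min_cost p \<alpha> \<beta>"
    by (rule optimal_kernel[OF p, where 'd='d]) blast
  have pa: "prob_space \<alpha>" "sets \<alpha> = sets borel" "prob_space \<beta>" "sets \<beta> = sets borel" "sets \<gamma> = sets borel"
    using \<alpha> \<beta> \<gamma> by (auto simp: space_prob_algebra)
  define g1 where "g1 = Opt (\<alpha>, \<beta>)"
  define g2 where "g2 = Opt (\<beta>, \<gamma>)"
  have "g1 \<in> couplings \<alpha> \<beta>" "g2 \<in> couplings \<beta> \<gamma>"
    using O(2)[OF \<alpha> \<beta>] O(2)[OF \<beta> \<gamma>] by (auto simp: g1_def g2_def optimal_couplings_def)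
  note G1 = couplings_prob_algebra[OF pa(1,2,4) this(1)] and G2 = couplings_prob_algebra[OF pa(3,4,5) this(2)]
  have c1: "coupling_cost p g1 = min_cost p \<alpha> \<beta>" and c2: "coupling_cost p g2 = min_cost p \<beta> \<gamma>"
    using O(2)[OF \<alpha> \<beta>] O(2)[OF \<beta> \<gamma>] by (auto simp: g1_def g2_def)
  have sg1[measurable_cong]: "sets g1 = sets (borel \<Otimes>\<^sub>M borel)" and sg2[measurable_cong]: "sets g2 = sets (borel \<Otimes>\<^sub>M borel)"
    and pg1: "prob_space g1" using G1(1) G2(1) by (auto simp: space_prob_algebra)
  \<comment> \<open>The swap puts the common marginal \<beta> first, as the randomization
    asks.\<close>
  define g1' where "g1' = distr g1 (borel \<Otimes>\<^sub>M borel) (\<lambda>z. (snd z, fst z))"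
  have sw: "(\<lambda>z. (snd z, fst z)) \<in> g1 \<rightarrow>\<^sub>M borel \<Otimes>\<^sub>M borel" by measurable
  have g1': "g1' \<in> space (prob_algebra (borel \<Otimes>\<^sub>M borel))"
    unfolding g1'_def using prob_space.prob_space_distr[OF pg1 sw] by (simp add: space_prob_algebra)
  have g1'_marg: "distr g1' borel fst = \<beta>" "distr g1' borel snd = \<alpha>"
    unfolding g1'_def using G1(2,3) by (simp_all add: distr_distr[OF _ sw] comp_def)
  obtain T1 where T1[measurable]: "T1 \<in> borel \<Otimes>\<^sub>M borel \<rightarrow>\<^sub>M borel"
    and e1: "g1' = distr (\<beta> \<Otimes>\<^sub>M unif) (borel \<Otimes>\<^sub>M borel) (\<lambda>\<omega>. (fst \<omega>, T1 \<omega>))"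
    using distr_randomization[OF g1' ed] unfolding g1'_marg by blast
  obtain T2 where T2[measurable]: "T2 \<in> borel \<Otimes>\<^sub>M borel \<rightarrow>\<^sub>M borel"
    and e2: "g2 = distr (\<beta> \<Otimes>\<^sub>M unif) (borel \<Otimes>\<^sub>M borel) (\<lambda>\<omega>. (fst \<omega>, T2 \<omega>))"
    using distr_randomization[OF G2(1) ed] unfolding G2(2) by blast
  note pa(4)[measurable_cong]
  let ?P = "\<beta> \<Otimes>\<^sub>M unif"
  have P: "prob_space ?P" by (rule prob_space_pair[OF pa(3) prob_space_unif])
  have m1: "(\<lambda>\<omega>. (fst \<omega>, T1 \<omega>)) \<in> ?P \<rightarrow>\<^sub>M borel \<Otimes>\<^sub>M borel" and m2: "(\<lambda>\<omega>. (fst \<omega>, T2 \<omega>)) \<in> ?P \<rightarrow>\<^sub>M borel \<Otimes>\<^sub>M borel"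
    by measurable
  have \<alpha>T: "\<alpha> = distr ?P borel T1"
    using g1'_marg(2) unfolding e1 by (simp add: distr_distr[OF measurable_snd m1] comp_def)
  have \<gamma>T: "\<gamma> = distr ?P borel T2"
    using G2(3) unfolding e2 by (simp add: distr_distr[OF measurable_snd m2] comp_def)
  have i1: "(\<integral>\<^sup>+\<omega>. ennreal (pnorm_pow p (T1 \<omega> - fst \<omega>)) \<partial>?P) = min_cost p \<alpha> \<beta>"
  proof -
    have "(\<integral>\<^sup>+\<omega>. ennreal (pnorm_pow p (T1 \<omega> - fst \<omega>)) \<partial>?P) = (\<integral>\<^sup>+z. ennreal (pnorm_pow p (snd z - fst z)) \<partial>g1')"
      unfolding e1 by (subst nn_integral_distr[OF m1]) auto
    also have "\<dots> = (\<integral>\<^sup>+z. ennreal (pnorm_pow p (fst z - snd z)) \<partial>g1)"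
      unfolding g1'_def by (subst nn_integral_distr[OF sw]) auto
    finally show ?thesis using c1 by (simp add: coupling_cost_def split_beta')
  qed
  have i2: "(\<integral>\<^sup>+\<omega>. ennreal (pnorm_pow p (fst \<omega> - T2 \<omega>)) \<partial>?P) = min_cost p \<beta> \<gamma>"
  proof -
    have "(\<integral>\<^sup>+\<omega>. ennreal (pnorm_pow p (fst \<omega> - T2 \<omega>)) \<partial>?P) = (\<integral>\<^sup>+z. ennreal (pnorm_pow p (fst z - snd z)) \<partial>g2)"
      unfolding e2 by (subst nn_integral_distr[OF m2]) auto
    then show ?thesis using c2 by (simp add: coupling_cost_def split_beta')
  qed
  have "min_cost p \<alpha> \<gamma> \<le> (\<integral>\<^sup>+\<omega>. ennreal (pnorm_pow p (T1 \<omega> - T2 \<omega>)) \<partial>?P)"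
    by (rule min_cost_le_maps[OF P _ _ \<alpha>T \<gamma>T]) measurable
  also have "\<dots> \<le> (\<integral>\<^sup>+\<omega>. ennreal (2 powr p) * (ennreal (pnorm_pow p (T1 \<omega> - fst \<omega>)) + ennreal (pnorm_pow p (fst \<omega> - T2 \<omega>))) \<partial>?P)"
    using p pnorm_pow_triangle[of p]
    by (intro nn_integral_mono) (simp add: ennreal_plus[symmetric] ennreal_mult[symmetric] ennreal_leI del: ennreal_plus)
  also have "\<dots> = ennreal (2 powr p) * (min_cost p \<alpha> \<beta> + min_cost p \<beta> \<gamma>)"
    by (simp add: nn_integral_cmult nn_integral_add i1 i2)
  finally show ?thesis .
qed

text \<open>Given two histories, the next pair of states is drawn from the selected optimal coupling
  of the two conditional laws. Measurability of the selection makes these choices kernels, which can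
  then be composed.\<close>

lemma triangular_optimal_couplings_nonempty:
  fixes \<mu> \<nu> :: "(nat \<Rightarrow> real ^ 'd::finite) measure"
  assumes p: "0 < p" and \<mu>: "prob_space \<mu>" "sets \<mu> = sets (path_space borel N)"
    and \<nu>: "prob_space \<nu>" "sets \<nu> = sets (path_space borel N)"
  shows "triangular_optimal_couplings p N \<mu> \<nu> \<noteq> {}"
proof -
  let ?B = "borel :: (real ^ 'd) measure"
  obtain \<kappa>\<mu> where k\<mu>: "disintegration borel N \<mu> \<kappa>\<mu>" by (rule disintegration_exists[OF \<mu>])
  obtain \<kappa>\<nu> where k\<nu>: "disintegration borel N \<nu> \<kappa>\<nu>" by (rule disintegration_exists[OF \<nu>])
  obtain Opt where O: "Opt \<in> prob_algebra borel \<Otimes>\<^sub>M prob_algebra borel \<rightarrow>\<^sub>M prob_algebra (?B \<Otimes>\<^sub>M ?B)"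
    "\<And>\<alpha> \<beta> :: (real ^ 'd) measure. \<alpha> \<in> space (prob_algebra borel) \<Longrightarrow> \<beta> \<in> space (prob_algebra borel) \<Longrightarrow>
      Opt (\<alpha>, \<beta>) \<in> optimal_couplings p \<alpha> \<beta> \<and> coupling_cost p (Opt (\<alpha>, \<beta>)) = min_cost p \<alpha> \<beta>"
    by (rule optimal_kernel[OF p, where 'd='d]) blast
  define F where "F k h = (\<lambda>i\<in>{0..<k}. fst (h i))" for k and h :: "nat \<Rightarrow> (real ^ 'd) \<times> (real ^ 'd)"
  define G where "G k h = (\<lambda>i\<in>{0..<k}. snd (h i))" for k and h :: "nat \<Rightarrow> (real ^ 'd) \<times> (real ^ 'd)"
  have F: "F k \<in> path_space (?B \<Otimes>\<^sub>M ?B) k \<rightarrow>\<^sub>M path_space borel k" for k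
    unfolding F_def by (rule measurable_map_path[OF measurable_fst])
  have G: "G k \<in> path_space (?B \<Otimes>\<^sub>M ?B) k \<rightarrow>\<^sub>M path_space borel k" for k
    unfolding G_def by (rule measurable_map_path[OF measurable_snd])
  note K = kernelsD[OF disintegrationD(1)[OF k\<mu>]] kernelsD[OF disintegrationD(1)[OF k\<nu>]]
  define \<kappa> where "\<kappa> k h = Opt (\<kappa>\<mu> k (F k h), \<kappa>\<nu> k (G k h))" for k h
  have "kernels (?B \<Otimes>\<^sub>M ?B) \<kappa>"
    unfolding kernels_def \<kappa>_def
    by (intro allI measurable_compose[OF measurable_Pair[OF measurable_compose[OF F K(1)] measurable_compose[OF G K(2)]] O(1)])
  then obtain \<Gamma> where \<Gamma>: "disintegration (?B \<Otimes>\<^sub>M ?B) N \<Gamma> \<kappa>" by (rule disintegration_of_kernels)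
  note D = disintegrationD[OF \<Gamma>]
  have sp\<Gamma>: "space \<Gamma> = space (path_space (?B \<Otimes>\<^sub>M ?B) N)" using sets_eq_imp_space_eq[OF D(3)] .
  have opt: "\<kappa> k h \<in> optimal_couplings p (\<kappa>\<mu> k (F k h)) (\<kappa>\<nu> k (G k h))" if h: "h \<in> space (path_space (?B \<Otimes>\<^sub>M ?B) k)" for k h
    unfolding \<kappa>_def
    using O(2)[OF measurable_space[OF K(1) measurable_space[OF F h]] measurable_space[OF K(2) measurable_space[OF G h]]] by blast
  have marg: "distr (\<kappa> k h) borel fst = \<kappa>\<mu> k (F k h) \<and> distr (\<kappa> k h) borel snd = \<kappa>\<nu> k (G k h)"
    if h: "h \<in> space (path_space (?B \<Otimes>\<^sub>M ?B) k)" for k h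
  proof -
    have "prob_space (\<kappa>\<mu> k (F k h))" "sets (\<kappa>\<mu> k (F k h)) = sets borel" "sets (\<kappa>\<nu> k (G k h)) = sets borel"
      using measurable_space[OF K(1) measurable_space[OF F h]] measurable_space[OF K(2) measurable_space[OF G h]]
      by (auto simp: space_prob_algebra)
    from couplings_prob_algebra(2,3)[OF this] opt[OF h] show ?thesis by (auto simp: optimal_couplings_def)
  qed
  \<comment> \<open>The first marginal of the kernel depends on the first history only, so the first
    projection of \<Gamma> has the kernels of \<mu> and hence the law \<mu>.\<close>
  have \<Gamma>F: "distr \<Gamma> (path_space borel N) (F N) = \<mu>"
    by (rule disintegration_unique_measure[OF _ k\<mu>], unfold F_def,
        rule disintegration_map[OF \<Gamma> measurable_fst disintegrationD(1)[OF k\<mu>]])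
      (use marg in \<open>simp add: F_def\<close>)
  have \<Gamma>G: "distr \<Gamma> (path_space borel N) (G N) = \<nu>"
    by (rule disintegration_unique_measure[OF _ k\<nu>], unfold G_def,
        rule disintegration_map[OF \<Gamma> measurable_snd disintegrationD(1)[OF k\<nu>]])
      (use marg in \<open>simp add: G_def\<close>)
  let ?PP = "path_space ?B N \<Otimes>\<^sub>M path_space ?B N"
  define \<pi> where "\<pi> = distr \<Gamma> ?PP (\<lambda>h. (F N h, G N h))"
  have FG: "(\<lambda>h. (F N h, G N h)) \<in> \<Gamma> \<rightarrow>\<^sub>M ?PP"
    using F[of N] G[of N] by (simp add: D(3) cong: measurable_cong_sets)
  have zip: "zip_path N \<in> ?PP \<rightarrow>\<^sub>M path_space (?B \<Otimes>\<^sub>M ?B) N"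
    unfolding zip_path_def split_beta' by measurable
  have "\<pi> \<in> couplings \<mu> \<nu>"
    by (rule couplingsI[OF \<mu>(2) \<nu>(2)])
      (simp_all add: \<pi>_def distr_distr[OF measurable_fst FG] distr_distr[OF measurable_snd FG] comp_def \<Gamma>F \<Gamma>G)
  moreover have "distr \<pi> (path_space (?B \<Otimes>\<^sub>M ?B) N) (zip_path N) = \<Gamma>"
  proof -
    have "distr \<pi> (path_space (?B \<Otimes>\<^sub>M ?B) N) (zip_path N) = distr \<Gamma> (path_space (?B \<Otimes>\<^sub>M ?B) N) (zip_path N \<circ> (\<lambda>h. (F N h, G N h)))"
      unfolding \<pi>_def by (rule distr_distr[OF zip FG])
    also have "\<dots> = distr \<Gamma> \<Gamma> (\<lambda>x. x)"
    proof (rule distr_cong)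
      fix h assume "h \<in> space \<Gamma>"
      then have "restrict h {0..<N} = h" using restrict_path_space sp\<Gamma> by metis
      then show "(zip_path N \<circ> (\<lambda>h. (F N h, G N h))) h = h"
        by (simp add: zip_path_def F_def G_def restrict_def fun_eq_iff) metis
    qed (simp_all add: D(3))
    finally show ?thesis by (simp add: distr_id)
  qed
  moreover have "AE (x, y) in \<pi>. \<forall>k<N.
        \<kappa> k (zip_path k (x, y)) \<in> optimal_couplings p (\<kappa>\<mu> k (restrict x {0..<k})) (\<kappa>\<nu> k (restrict y {0..<k}))"
  proof -
    \<comment> \<open>Optimality holds for every pair of histories here, not only almost
      surely.\<close>
    have "\<kappa> k (zip_path k (x, y)) \<in> optimal_couplings p (\<kappa>\<mu> k (restrict x {0..<k})) (\<kappa>\<nu> k (restrict y {0..<k}))" for k x y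
    proof -
      have "zip_path k (x, y) \<in> space (path_space (?B \<Otimes>\<^sub>M ?B) k)"
        by (simp add: zip_path_def space_PiM space_pair_measure)
      from opt[OF this] show ?thesis
      proof -
        have "F k (zip_path k (x, y)) = restrict x {0..<k}" "G k (zip_path k (x, y)) = restrict y {0..<k}"
          by (auto simp: F_def G_def zip_path_def restrict_def fun_eq_iff)
        then show ?thesis using opt[OF \<open>zip_path k (x, y) \<in> _\<close>] by simp
      qed
    qed
    then show ?thesis by (intro AE_I2) (simp add: split_beta')
  qed
  ultimately have "\<pi> \<in> triangular_optimal_couplings p N \<mu> \<nu>"
    unfolding triangular_optimal_couplings_def using k\<mu> k\<nu> \<Gamma> by blast
  then show ?thesis by blast
qed

lemma triangular_optimal_subset_bicausal:
  "triangular_optimal_couplings p N \<mu> \<nu> \<subseteq> bicausal_couplings N \<mu> \<nu>"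
proof
  fix \<pi> assume "\<pi> \<in> triangular_optimal_couplings p N \<mu> \<nu>"
  then obtain \<kappa>\<mu> \<kappa>\<nu> \<kappa>\<pi> where *: "\<pi> \<in> couplings \<mu> \<nu>" "disintegration borel N \<mu> \<kappa>\<mu>" "disintegration borel N \<nu> \<kappa>\<nu>"
    "disintegration (borel \<Otimes>\<^sub>M borel) N (distr \<pi> (path_space (borel \<Otimes>\<^sub>M borel) N) (zip_path N)) \<kappa>\<pi>"
    and AE: "AE (x, y) in \<pi>. \<forall>k<N. \<kappa>\<pi> k (zip_path k (x, y)) \<in>
      optimal_couplings p (\<kappa>\<mu> k (restrict x {0..<k})) (\<kappa>\<nu> k (restrict y {0..<k}))"
    unfolding triangular_optimal_couplings_def by blast
  have "AE (x, y) in \<pi>. \<forall>k<N. \<kappa>\<pi> k (zip_path k (x, y)) \<in>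
      couplings (\<kappa>\<mu> k (restrict x {0..<k})) (\<kappa>\<nu> k (restrict y {0..<k}))"
    using AE by (rule eventually_mono) (auto simp: optimal_couplings_def)
  then show "\<pi> \<in> bicausal_couplings N \<mu> \<nu>"
    unfolding bicausal_couplings_def using * by blast
qed

section \<open>Step costs of couplings of path laws\<close>

definition step_cost ::
    "real \<Rightarrow> nat \<Rightarrow> ((nat \<Rightarrow> real ^ 'd::finite) \<times> (nat \<Rightarrow> real ^ 'd)) measure \<Rightarrow> ennreal" where
  "step_cost p k \<pi> = (\<integral>\<^sup>+z. ennreal (pnorm_pow p (fst z k - snd z k)) \<partial>\<pi>)"

lemma measurable_zip_path:
  "zip_path N \<in> path_space A N \<Otimes>\<^sub>M path_space B N \<rightarrow>\<^sub>M path_space (A \<Otimes>\<^sub>M B) N"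
  unfolding zip_path_def split_beta' by measurable

lemma restrict_zip_path: "k \<le> N \<Longrightarrow> restrict (zip_path N z) {0..<k} = zip_path k z"
  by (auto simp: zip_path_def restrict_def fun_eq_iff split: prod.split)

lemma zip_path_apply: "k < N \<Longrightarrow> zip_path N z k = (fst z k, snd z k)"
  by (simp add: zip_path_def split: prod.split)

lemma measurable_step:
  "k < N \<Longrightarrow> (\<lambda>z. ennreal (pnorm_pow p (fst z k - snd z k))) \<in>
    borel_measurable (path_space borel N \<Otimes>\<^sub>M path_space (borel :: (real ^ 'd::finite) measure) N)"
  by measurable

lemma path_cost_eq:
  assumes s[measurable_cong]: "sets \<pi> = sets (path_space borel N \<Otimes>\<^sub>M path_space borel N)"
  shows "path_cost p N \<pi> = ennroot p (\<Sum>k<N. step_cost p k \<pi>)"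
proof -
  have "(\<integral>\<^sup>+(x, y). ennreal (path_pnorm_pow p N (\<lambda>k. x k - y k)) \<partial>\<pi>) =
    (\<integral>\<^sup>+z. (\<Sum>k<N. ennreal (pnorm_pow p (fst z k - snd z k))) \<partial>\<pi>)"
    by (intro nn_integral_cong) (simp add: path_pnorm_pow_def split_beta' sum_ennreal)
  also have "\<dots> = (\<Sum>k<N. step_cost p k \<pi>)"
    unfolding step_cost_def
    by (rule nn_integral_sum) (use measurable_step in \<open>simp add: s cong: measurable_cong_sets\<close>)
  finally show ?thesis by (simp add: path_cost_def)
qed

text \<open>Conditioning on the joint history before \<open>k\<close>: the cost at time
  \<open>k\<close> is the average cost of the conditional couplings.\<close>

lemma step_cost_disintegration:
  fixes \<pi> :: "((nat \<Rightarrow> real ^ 'd::finite) \<times> (nat \<Rightarrow> real ^ 'd)) measure"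
  assumes s: "sets \<pi> = sets (path_space borel N \<Otimes>\<^sub>M path_space borel N)"
    and \<kappa>: "disintegration (borel \<Otimes>\<^sub>M borel) N (distr \<pi> (path_space (borel \<Otimes>\<^sub>M borel) N) (zip_path N)) \<kappa>"
    and k: "k < N"
  shows "step_cost p k \<pi> = (\<integral>\<^sup>+z. coupling_cost p (\<kappa> k (zip_path k z)) \<partial>\<pi>)"
proof -
  let ?B = "borel :: (real ^ 'd) measure"
  let ?\<Gamma> = "distr \<pi> (path_space (?B \<Otimes>\<^sub>M ?B) N) (zip_path N)"
  note D = disintegrationD[OF \<kappa>]
  have zip: "zip_path N \<in> \<pi> \<rightarrow>\<^sub>M path_space (?B \<Otimes>\<^sub>M ?B) N"
    using measurable_zip_path by (simp add: s cong: measurable_cong_sets)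
  define c where "c w = ennreal (pnorm_pow p (fst w - snd w))" for w :: "(real ^ 'd) \<times> (real ^ 'd)"
  have c: "c \<in> borel_measurable (?B \<Otimes>\<^sub>M ?B)" unfolding c_def by measurable
  have cc: "coupling_cost p \<gamma> = (\<integral>\<^sup>+w. c w \<partial>\<gamma>)" for \<gamma> by (simp add: coupling_cost_def c_def split_beta')
  have cN: "(\<lambda>h. c (h k)) \<in> borel_measurable (path_space (?B \<Otimes>\<^sub>M ?B) N)"
  proof -
    have "k \<in> {0..<N}" using k by simp
    from measurable_compose[OF measurable_component_singleton[OF this] c] show ?thesis .
  qed
  have K: "(\<lambda>h. coupling_cost p (\<kappa> k (restrict h {0..<k}))) \<in> borel_measurable (path_space (?B \<Otimes>\<^sub>M ?B) N)"
    using k by (intro measurable_compose[OF measurable_compose[OF measurable_restrict_path kernelsD[OF D(1)]] measurable_coupling_cost]) simp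
  have "step_cost p k \<pi> = (\<integral>\<^sup>+z. c (zip_path N z k) \<partial>\<pi>)"
    by (simp add: step_cost_def zip_path_apply[OF k] c_def)
  also have "\<dots> = (\<integral>\<^sup>+h. c (h k) \<partial>?\<Gamma>)"
    by (rule nn_integral_distr[OF zip, symmetric]) (simp only: measurable_distr_eq1 cN)
  also have "\<dots> = (\<integral>\<^sup>+h. \<integral>\<^sup>+w. c w \<partial>\<kappa> k (restrict h {0..<k}) \<partial>?\<Gamma>)"
    using D(4)[OF k measurable_compose[OF measurable_snd c]] by simp
  also have "\<dots> = (\<integral>\<^sup>+h. coupling_cost p (\<kappa> k (restrict h {0..<k})) \<partial>?\<Gamma>)" by (simp only: cc)
  also have "\<dots> = (\<integral>\<^sup>+z. coupling_cost p (\<kappa> k (restrict (zip_path N z) {0..<k})) \<partial>\<pi>)"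
    by (rule nn_integral_distr[OF zip]) (simp only: measurable_distr_eq1 K)
  also have "\<dots> = (\<integral>\<^sup>+z. coupling_cost p (\<kappa> k (zip_path k z)) \<partial>\<pi>)"
    using k by (simp only: restrict_zip_path less_imp_le)
  finally show ?thesis .
qed

text \<open>The definitions of the coupling classes supply versions of the kernels that may differ
  from coupling to coupling. This allows them to be exchanged for versions fixed once and for
  all.\<close>

lemma AE_kernels_eq:
  fixes \<mu> \<nu> :: "(nat \<Rightarrow> real ^ 'd::finite) measure"
  assumes \<pi>: "\<pi> \<in> couplings \<mu> \<nu>"
    and \<mu>: "disintegration borel N \<mu> \<kappa>\<mu>" "disintegration borel N \<mu> \<kappa>\<mu>'"
    and \<nu>: "disintegration borel N \<nu> \<kappa>\<nu>" "disintegration borel N \<nu> \<kappa>\<nu>'" and k: "k < N"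
  shows "AE z in \<pi>. \<kappa>\<mu> k (restrict (fst z) {0..<k}) = \<kappa>\<mu>' k (restrict (fst z) {0..<k}) \<and>
    \<kappa>\<nu> k (restrict (snd z) {0..<k}) = \<kappa>\<nu>' k (restrict (snd z) {0..<k})"
proof -
  obtain e d where ed: "coded (borel :: (real ^ 'd) measure) e d" by (rule coded_polish) (rule that)
  have s: "sets \<pi> = sets (\<mu> \<Otimes>\<^sub>M \<nu>)" "distr \<pi> \<mu> fst = \<mu>" "distr \<pi> \<nu> snd = \<nu>"
    using \<pi> by (auto simp: couplings_def)
  have m: "fst \<in> \<pi> \<rightarrow>\<^sub>M \<mu>" "snd \<in> \<pi> \<rightarrow>\<^sub>M \<nu>" by (simp_all add: s(1) cong: measurable_cong_sets)
  have "AE x in distr \<pi> \<mu> fst. \<kappa>\<mu> k (restrict x {0..<k}) = \<kappa>\<mu>' k (restrict x {0..<k})"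
    unfolding s(2) by (rule disintegration_unique[OF ed \<mu> k])
  moreover have "AE y in distr \<pi> \<nu> snd. \<kappa>\<nu> k (restrict y {0..<k}) = \<kappa>\<nu>' k (restrict y {0..<k})"
    unfolding s(3) by (rule disintegration_unique[OF ed \<nu> k])
  ultimately show ?thesis using AE_distrD[OF m(1)] AE_distrD[OF m(2)] by (intro AE_conjI) auto
qed

text \<open>The conditional couplings are couplings of the conditional laws, hence cost at least the
  minimum.\<close>

lemma bicausal_step_cost:
  fixes \<mu> \<nu> :: "(nat \<Rightarrow> real ^ 'd::finite) measure"
  assumes \<pi>: "\<pi> \<in> bicausal_couplings N \<mu> \<nu>" and \<mu>: "disintegration borel N \<mu> \<kappa>\<mu>"
    and \<nu>: "disintegration borel N \<nu> \<kappa>\<nu>" and k: "k < N"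
  shows "(\<integral>\<^sup>+z. min_cost p (\<kappa>\<mu> k (restrict (fst z) {0..<k})) (\<kappa>\<nu> k (restrict (snd z) {0..<k})) \<partial>\<pi>) \<le> step_cost p k \<pi>"
proof -
  obtain \<kappa>\<mu>' \<kappa>\<nu>' \<kappa>\<pi> where *: "\<pi> \<in> couplings \<mu> \<nu>" "disintegration borel N \<mu> \<kappa>\<mu>'" "disintegration borel N \<nu> \<kappa>\<nu>'"
    "disintegration (borel \<Otimes>\<^sub>M borel) N (distr \<pi> (path_space (borel \<Otimes>\<^sub>M borel) N) (zip_path N)) \<kappa>\<pi>"
    and AE: "AE (x, y) in \<pi>. \<forall>k<N. \<kappa>\<pi> k (zip_path k (x, y)) \<in>
      couplings (\<kappa>\<mu>' k (restrict x {0..<k})) (\<kappa>\<nu>' k (restrict y {0..<k}))"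
    using \<pi> unfolding bicausal_couplings_def by blast
  note D = disintegrationD[OF \<mu>] disintegrationD[OF \<nu>]
  have s: "sets \<pi> = sets (path_space borel N \<Otimes>\<^sub>M path_space borel N)"
    using couplings_prob_algebra(1)[OF D(2,3) D(7) *(1)] by (simp add: space_prob_algebra)
  show ?thesis
    unfolding step_cost_disintegration[OF s *(4) k]
  proof (rule nn_integral_mono_AE)
    show "AE z in \<pi>. min_cost p (\<kappa>\<mu> k (restrict (fst z) {0..<k})) (\<kappa>\<nu> k (restrict (snd z) {0..<k}))
      \<le> coupling_cost p (\<kappa>\<pi> k (zip_path k z))"
      using AE AE_kernels_eq[OF *(1) \<mu> *(2) \<nu> *(3) k]
    proof eventually_elim
      case (elim z)
      then show ?case using k unfolding min_cost_def by (intro INF_lower) (auto simp: split_beta')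
    qed
  qed
qed

text \<open>The conditional couplings are optimal, hence cost no more than the minimum. Together
  with the bicausal bound this reduces the cost at time \<open>k\<close> to minimal costs between
  conditional laws.\<close>

lemma triangular_step_cost:
  fixes \<mu> \<nu> :: "(nat \<Rightarrow> real ^ 'd::finite) measure"
  assumes p: "0 < p" and \<pi>: "\<pi> \<in> triangular_optimal_couplings p N \<mu> \<nu>" and \<mu>: "disintegration borel N \<mu> \<kappa>\<mu>"
    and \<nu>: "disintegration borel N \<nu> \<kappa>\<nu>" and k: "k < N"
  shows "step_cost p k \<pi> \<le> (\<integral>\<^sup>+z. min_cost p (\<kappa>\<mu> k (restrict (fst z) {0..<k})) (\<kappa>\<nu> k (restrict (snd z) {0..<k})) \<partial>\<pi>)"
proof -
  obtain \<kappa>\<mu>' \<kappa>\<nu>' \<kappa>\<pi> where *: "\<pi> \<in> couplings \<mu> \<nu>" "disintegration borel N \<mu> \<kappa>\<mu>'" "disintegration borel N \<nu> \<kappa>\<nu>'"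
    "disintegration (borel \<Otimes>\<^sub>M borel) N (distr \<pi> (path_space (borel \<Otimes>\<^sub>M borel) N) (zip_path N)) \<kappa>\<pi>"
    and AE: "AE (x, y) in \<pi>. \<forall>k<N. \<kappa>\<pi> k (zip_path k (x, y)) \<in>
      optimal_couplings p (\<kappa>\<mu>' k (restrict x {0..<k})) (\<kappa>\<nu>' k (restrict y {0..<k}))"
    using \<pi> unfolding triangular_optimal_couplings_def by blast
  note D = disintegrationD[OF \<mu>] disintegrationD[OF \<nu>]
  have s: "sets \<pi> = sets (path_space borel N \<Otimes>\<^sub>M path_space borel N)"
    using couplings_prob_algebra(1)[OF D(2,3) D(7) *(1)] by (simp add: space_prob_algebra)
  show ?thesis
    unfolding step_cost_disintegration[OF s *(4) k]
  proof (rule nn_integral_mono_AE)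
    show "AE z in \<pi>. coupling_cost p (\<kappa>\<pi> k (zip_path k z)) \<le>
      min_cost p (\<kappa>\<mu> k (restrict (fst z) {0..<k})) (\<kappa>\<nu> k (restrict (snd z) {0..<k}))"
      using AE AE_kernels_eq[OF *(1) \<mu> *(2) \<nu> *(3) k]
    proof eventually_elim
      case (elim z)
      then show ?case using k unfolding min_cost_def optimal_couplings_iff[OF p]
        by (intro INF_greatest) (auto simp: split_beta')
    qed
  qed
qed

section \<open>Transfer of convergence from bicausal to triangular optimal couplings\<close>

lemma distr_pair_noise:
  assumes "prob_space P" and f: "f \<in> P \<rightarrow>\<^sub>M A"
  shows "distr (P \<Otimes>\<^sub>M unif) (A \<Otimes>\<^sub>M unif) (\<lambda>z. (f (fst z), snd z)) = distr P A f \<Otimes>\<^sub>M unif"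
proof -
  interpret U: prob_space unif by (rule prob_space_unif)
  have "distr P A f \<Otimes>\<^sub>M distr unif unif (\<lambda>x. x) = distr (P \<Otimes>\<^sub>M unif) (A \<Otimes>\<^sub>M unif) (\<lambda>(x, y). (f x, y))"
    by (rule pair_measure_distr[OF f]) (simp_all add: distr_id U.sigma_finite_measure_axioms)
  then show ?thesis by (simp add: distr_id split_beta')
qed

lemma tendsto_0_squeeze_ennreal:
  fixes F G :: "nat \<Rightarrow> ennreal"
  assumes "\<And>n. F n \<le> G n" "G \<longlonglongrightarrow> 0"
  shows "F \<longlonglongrightarrow> 0"
  using assms by (intro tendsto_sandwich[OF _ _ tendsto_const assms(2)]) auto

lemma tendsto_0_le_add_inverse:
  fixes F G :: "nat \<Rightarrow> ennreal"
  assumes "\<And>n. F n \<le> G n + ennreal (1 / real (Suc n))" "G \<longlonglongrightarrow> 0"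
  shows "F \<longlonglongrightarrow> 0"
proof (rule tendsto_0_squeeze_ennreal[OF assms(1)])
  have "(\<lambda>n. 1 / real (Suc n)) \<longlonglongrightarrow> 0" by (rule LIMSEQ_Suc[OF lim_1_over_n])
  from tendsto_add[OF assms(2) tendsto_ennrealI[OF this]]
  show "(\<lambda>n. G n + ennreal (1 / real (Suc n))) \<longlonglongrightarrow> 0" by (simp only: ennreal_0 add_0)
qed

lemma tendsto_0_cmult_add_ennreal:
  fixes F G :: "nat \<Rightarrow> ennreal"
  assumes "F \<longlonglongrightarrow> 0" "G \<longlonglongrightarrow> 0"
  shows "(\<lambda>n. ennreal c * (F n + G n)) \<longlonglongrightarrow> 0"
proof -
  have "(\<lambda>n. ennreal c * (F n + G n)) \<longlonglongrightarrow> ennreal c * (0 + 0)"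
    by (intro ennreal_tendsto_cmult tendsto_add assms) simp
  then show ?thesis by simp
qed

text \<open>Both couplings are written as functions of the first path \<open>x\<close> and a common uniform noise,
  say \<open>(x, \<xi>)\<close> and \<open>(x, \<xi>')\<close>. The conditional laws of \<open>\<mu>\<close> along \<open>\<xi>\<close> and \<open>\<xi>'\<close> are then compared
  by feeding one further noise into a fixed randomization of the kernel of \<open>\<mu>\<close>.\<close>

lemma triangular_step_tendsto:
  fixes \<mu>s :: "nat \<Rightarrow> (nat \<Rightarrow> real ^ 'd::finite) measure" and \<mu> :: "(nat \<Rightarrow> real ^ 'd) measure"
  assumes p: "0 < p" and \<mu>s: "\<And>n. \<mu>s n \<in> P_p p N" and \<mu>: "\<mu> \<in> P_p p N"
    and \<pi>: "\<And>n. \<pi> n \<in> bicausal_couplings N (\<mu>s n) \<mu>"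
    and \<gamma>: "\<And>n. \<gamma> n \<in> triangular_optimal_couplings p N (\<mu>s n) \<mu>"
    and \<pi>_lim: "\<And>j. j < N \<Longrightarrow> (\<lambda>n. step_cost p j (\<pi> n)) \<longlonglongrightarrow> 0"
    and k: "k < N" and \<gamma>_lim: "\<And>j. j < k \<Longrightarrow> (\<lambda>n. step_cost p j (\<gamma> n)) \<longlonglongrightarrow> 0"
  shows "(\<lambda>n. step_cost p k (\<gamma> n)) \<longlonglongrightarrow> 0"
proof -
  let ?B = "borel :: (real ^ 'd) measure"
  let ?S = "path_space ?B N"
  let ?H = "path_space ?B k"
  have \<mu>s': "prob_space (\<mu>s n)" "sets (\<mu>s n) = sets ?S" for n using \<mu>s[of n] by (auto simp: P_p_def)
  have \<mu>': "prob_space \<mu>" "sets \<mu> = sets ?S" and \<mu>_mom: "(\<integral>\<^sup>+x. ennreal (path_pnorm_pow p N x) \<partial>\<mu>) < \<infinity>"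
    using \<mu> by (auto simp: P_p_def)
  interpret U: prob_space unif by (rule prob_space_unif)
  have "\<exists>\<kappa>. disintegration borel N (\<mu>s n) \<kappa>" for n by (rule disintegration_exists[OF \<mu>s']) blast
  then obtain \<kappa>s where \<kappa>s: "\<And>n. disintegration borel N (\<mu>s n) (\<kappa>s n)" by metis
  obtain \<kappa> where \<kappa>: "disintegration borel N \<mu> \<kappa>" by (rule disintegration_exists[OF \<mu>'])
  note Ks = kernelsD[OF disintegrationD(1)[OF \<kappa>s]] and K = kernelsD[OF disintegrationD(1)[OF \<kappa>]]
  obtain e d where ed: "coded ?S e d" by (rule coded_path_space) (rule that)
  obtain e' d' where ed': "coded ?B e' d'" by (rule coded_polish) (rule that)
  define P where "P n = \<mu>s n \<Otimes>\<^sub>M unif" for n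
  have pP: "prob_space (P n)" for n unfolding P_def by (rule prob_space_pair[OF \<mu>s'(1) prob_space_unif])
  have sP[measurable_cong]: "sets (P n) = sets (?S \<Otimes>\<^sub>M borel)" for n
    unfolding P_def by (rule sets_pair_measure_cong) (simp_all add: \<mu>s')
  \<comment> \<open>\<open>T\<close> produces the second path of the coupling \<open>g\<close> from
    its first path and a noise.\<close>
  define rand where "rand T n g \<longleftrightarrow> T \<in> ?S \<Otimes>\<^sub>M borel \<rightarrow>\<^sub>M ?S \<and> g = distr (P n) (?S \<Otimes>\<^sub>M ?S) (\<lambda>\<omega>. (fst \<omega>, T \<omega>))"
    for T n g
  have rand_ex: "\<exists>T. rand T n g" if "g \<in> couplings (\<mu>s n) \<mu>" for n g
  proof -
    note C = couplings_prob_algebra[OF \<mu>s' \<mu>'(2) that]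
    from distr_randomization[OF C(1) ed] show ?thesis
      unfolding rand_def P_def C(2) by blast
  qed
  have rand_nn: "(\<integral>\<^sup>+z. f z \<partial>g) = (\<integral>\<^sup>+\<omega>. f (fst \<omega>, T \<omega>) \<partial>P n)"
    if r: "rand T n g" and f: "f \<in> borel_measurable (?S \<Otimes>\<^sub>M ?S)" for T n g f
  proof -
    have [measurable]: "T \<in> ?S \<Otimes>\<^sub>M borel \<rightarrow>\<^sub>M ?S" using r by (simp add: rand_def)
    have "(\<lambda>\<omega>. (fst \<omega>, T \<omega>)) \<in> P n \<rightarrow>\<^sub>M ?S \<Otimes>\<^sub>M ?S" by measurable
    moreover have "g = distr (P n) (?S \<Otimes>\<^sub>M ?S) (\<lambda>\<omega>. (fst \<omega>, T \<omega>))" using r by (simp add: rand_def)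
    ultimately show ?thesis using f by (simp add: nn_integral_distr)
  qed
  have rand_law: "T \<in> P n \<rightarrow>\<^sub>M ?S \<and> distr (P n) ?S T = \<mu>" if r: "rand T n g" and g: "g \<in> couplings (\<mu>s n) \<mu>" for T n g
  proof -
    have T[measurable]: "T \<in> ?S \<Otimes>\<^sub>M borel \<rightarrow>\<^sub>M ?S" using r by (simp add: rand_def)
    have m: "(\<lambda>\<omega>. (fst \<omega>, T \<omega>)) \<in> P n \<rightarrow>\<^sub>M ?S \<Otimes>\<^sub>M ?S" by measurable
    have "\<mu> = distr g ?S snd" using couplings_prob_algebra(3)[OF \<mu>s' \<mu>'(2) g] by simp
    also have "\<dots> = distr (P n) ?S T"
      using r by (simp add: rand_def distr_distr[OF measurable_snd m] comp_def)
    finally show ?thesis using T by (simp add: sP cong: measurable_cong_sets)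
  qed
  have \<pi>c: "\<pi> n \<in> couplings (\<mu>s n) \<mu>" for n using \<pi>[of n] by (simp add: bicausal_couplings_def)
  have \<gamma>c: "\<gamma> n \<in> couplings (\<mu>s n) \<mu>" for n using \<gamma>[of n] by (simp add: triangular_optimal_couplings_def)
  \<comment> \<open>\<open>T1\<close> plays the role of \<xi> and \<open>T2\<close> that of \<xi>'.
    They may share the noise, as only their laws and their joint laws with the first path are
    prescribed.\<close>
  obtain T1 where T1: "\<And>n. rand (T1 n) n (\<pi> n)" using rand_ex[OF \<pi>c] by metis
  obtain T2 where T2: "\<And>n. rand (T2 n) n (\<gamma> n)" using rand_ex[OF \<gamma>c] by metis
  have T1m[measurable]: "T1 n \<in> ?S \<Otimes>\<^sub>M borel \<rightarrow>\<^sub>M ?S" and T2m[measurable]: "T2 n \<in> ?S \<Otimes>\<^sub>M borel \<rightarrow>\<^sub>M ?S" for n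
    using T1[of n] T2[of n] by (auto simp: rand_def)
  have T1k: "(\<lambda>\<omega>. restrict (T1 n \<omega>) {0..<k}) \<in> P n \<rightarrow>\<^sub>M ?H" and T2k: "(\<lambda>\<omega>. restrict (T2 n \<omega>) {0..<k}) \<in> P n \<rightarrow>\<^sub>M ?H" for n
    using measurable_compose[OF conjunct1[OF rand_law[OF T1 \<pi>c]] measurable_restrict_path[OF less_imp_le[OF k]]]
      measurable_compose[OF conjunct1[OF rand_law[OF T2 \<gamma>c]] measurable_restrict_path[OF less_imp_le[OF k]]] by auto
  note T1k[measurable] T2k[measurable]
  have comp_S: "(\<lambda>x. x i) \<in> ?S \<rightarrow>\<^sub>M ?B" if "i < N" for i
    using measurable_component_singleton[of i "{0..<N}" "\<lambda>_. ?B"] that by simp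
  have T1i: "(\<lambda>\<omega>. T1 n \<omega> i) \<in> P n \<rightarrow>\<^sub>M ?B" and T2i: "(\<lambda>\<omega>. T2 n \<omega> i) \<in> P n \<rightarrow>\<^sub>M ?B"
    if "i < N" for i n
    using measurable_compose[OF conjunct1[OF rand_law[OF T1 \<pi>c]] comp_S[OF that]]
      measurable_compose[OF conjunct1[OF rand_law[OF T2 \<gamma>c]] comp_S[OF that]] by auto
  \<comment> \<open>Triangle inequality through the first path, at a time before \<open>k\<close>
    where both couplings have vanishing cost.\<close>
  have near: "(\<lambda>n. \<integral>\<^sup>+\<omega>. ennreal (pnorm_pow p (T1 n \<omega> i - T2 n \<omega> i)) \<partial>P n) \<longlonglongrightarrow> 0" if i: "i < k" for i
  proof (rule tendsto_0_squeeze_ennreal)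
    have iN: "i < N" using i k by simp
    note T1i[OF iN, measurable] T2i[OF iN, measurable]
    have fi[measurable]: "(\<lambda>\<omega>. fst \<omega> i) \<in> P n \<rightarrow>\<^sub>M ?B" for n
      using measurable_compose[OF measurable_fst comp_S[OF iN]] by (simp add: sP cong: measurable_cong_sets)
    show "(\<lambda>n. ennreal (2 powr p) * (step_cost p i (\<pi> n) + step_cost p i (\<gamma> n))) \<longlonglongrightarrow> 0"
      by (rule tendsto_0_cmult_add_ennreal[OF \<pi>_lim[OF iN] \<gamma>_lim[OF i]])
    fix n
    have 1: "step_cost p i (\<pi> n) = (\<integral>\<^sup>+\<omega>. ennreal (pnorm_pow p (T1 n \<omega> i - fst \<omega> i)) \<partial>P n)"
      unfolding step_cost_def using rand_nn[OF T1 measurable_step[OF iN], of n p] by (simp add: pnorm_pow_commute)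
    have 2: "step_cost p i (\<gamma> n) = (\<integral>\<^sup>+\<omega>. ennreal (pnorm_pow p (fst \<omega> i - T2 n \<omega> i)) \<partial>P n)"
      unfolding step_cost_def using rand_nn[OF T2 measurable_step[OF iN], of n p] by simp
    have "(\<integral>\<^sup>+\<omega>. ennreal (pnorm_pow p (T1 n \<omega> i - T2 n \<omega> i)) \<partial>P n) \<le>
      (\<integral>\<^sup>+\<omega>. ennreal (2 powr p) * (ennreal (pnorm_pow p (T1 n \<omega> i - fst \<omega> i)) + ennreal (pnorm_pow p (fst \<omega> i - T2 n \<omega> i))) \<partial>P n)"
      using p pnorm_pow_triangle[of p]
      by (intro nn_integral_mono) (simp add: ennreal_plus[symmetric] ennreal_mult[symmetric] ennreal_leI del: ennreal_plus)
    also have "\<dots> = ennreal (2 powr p) * (step_cost p i (\<pi> n) + step_cost p i (\<gamma> n))"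
      unfolding 1 2 by (simp add: nn_integral_cmult nn_integral_add)
    finally show "(\<integral>\<^sup>+\<omega>. ennreal (pnorm_pow p (T1 n \<omega> i - T2 n \<omega> i)) \<partial>P n) \<le>
      ennreal (2 powr p) * (step_cost p i (\<pi> n) + step_cost p i (\<gamma> n))" .
  qed
  obtain T where T: "T \<in> ?H \<Otimes>\<^sub>M borel \<rightarrow>\<^sub>M ?B"
    and \<kappa>T: "\<And>h. h \<in> space ?H \<Longrightarrow> \<kappa> k h = distr unif ?B (\<lambda>u. T (h, u))"
    by (rule outsource[OF K ed']) blast
  define \<rho> where "\<rho> = distr \<mu> ?H (\<lambda>x. restrict x {0..<k})"
  have r: "(\<lambda>x. restrict x {0..<k}) \<in> \<mu> \<rightarrow>\<^sub>M ?H" by (rule measurable_restrict_path'[OF \<mu>'(2) less_imp_le[OF k]])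
  have sr[measurable_cong]: "sets \<rho> = sets ?H" by (simp add: \<rho>_def)
  interpret \<rho>: prob_space \<rho> unfolding \<rho>_def by (rule prob_space.prob_space_distr[OF \<mu>'(1) r])
  \<comment> \<open>A second noise, independent of the first, drives the next state. It is carried
    along in both \<open>X1\<close> and \<open>X2\<close>, whose common law is then the law \<rho>
    of the history times \<open>unif\<close>.\<close>
  define \<Omega> where "\<Omega> n = P n \<Otimes>\<^sub>M unif" for n
  define X1 where "X1 n z = (restrict (T1 n (fst z)) {0..<k}, snd z)" for n and z :: "((nat \<Rightarrow> real ^ 'd) \<times> real) \<times> real"
  define X2 where "X2 n z = (restrict (T2 n (fst z)) {0..<k}, snd z)" for n and z :: "((nat \<Rightarrow> real ^ 'd) \<times> real) \<times> real"
  have law: "distr (\<Omega> n) (\<rho> \<Otimes>\<^sub>M unif) (\<lambda>z. (restrict (R (fst z)) {0..<k}, snd z)) = \<rho> \<Otimes>\<^sub>M unif"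
    if R: "R \<in> P n \<rightarrow>\<^sub>M ?S" "distr (P n) ?S R = \<mu>" and Rk: "(\<lambda>\<omega>. restrict (R \<omega>) {0..<k}) \<in> P n \<rightarrow>\<^sub>M ?H" for R n
  proof -
    have "distr (P n) ?H (\<lambda>\<omega>. restrict (R \<omega>) {0..<k}) = distr (distr (P n) ?S R) ?H (\<lambda>x. restrict x {0..<k})"
      using distr_distr[OF measurable_restrict_path[OF less_imp_le[OF k]] R(1)] by (simp only: comp_def)
    then have m: "distr (P n) ?H (\<lambda>\<omega>. restrict (R \<omega>) {0..<k}) = \<rho>" by (simp only: R(2) \<rho>_def)
    have "distr (\<Omega> n) (\<rho> \<Otimes>\<^sub>M unif) (\<lambda>z. (restrict (R (fst z)) {0..<k}, snd z)) =
      distr (\<Omega> n) (?H \<Otimes>\<^sub>M unif) (\<lambda>z. (restrict (R (fst z)) {0..<k}, snd z))"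
      by (rule distr_cong) (simp_all add: sr cong: sets_pair_measure_cong)
    also have "\<dots> = \<rho> \<Otimes>\<^sub>M unif"
      unfolding \<Omega>_def using distr_pair_noise[OF pP Rk] by (simp only: m)
    finally show ?thesis .
  qed
  have X1m: "X1 n \<in> \<Omega> n \<rightarrow>\<^sub>M \<rho> \<Otimes>\<^sub>M unif" and X2m: "X2 n \<in> \<Omega> n \<rightarrow>\<^sub>M \<rho> \<Otimes>\<^sub>M unif" for n
    unfolding X1_def X2_def \<Omega>_def by measurable
  interpret merging \<Omega> "\<rho> \<Otimes>\<^sub>M unif" X1 X2
  proof (rule merging.intro)
    show "prob_space (\<Omega> n)" for n unfolding \<Omega>_def by (rule prob_space_pair[OF pP prob_space_unif])
    show "distr (\<Omega> n) (\<rho> \<Otimes>\<^sub>M unif) (X1 n) = \<rho> \<Otimes>\<^sub>M unif" for n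
      unfolding X1_def[abs_def] using law[OF _ _ T1k] rand_law[OF T1 \<pi>c] by blast
    show "distr (\<Omega> n) (\<rho> \<Otimes>\<^sub>M unif) (X2 n) = \<rho> \<Otimes>\<^sub>M unif" for n
      unfolding X2_def[abs_def] using law[OF _ _ T2k] rand_law[OF T2 \<gamma>c] by blast
  qed (rule X1m, rule X2m)
  \<comment> \<open>Enough to treat the coordinates of the history and the noise separately, since
    these generate the product sigma-algebra.\<close>
  have merges: "merges A" if A: "A \<in> sets (\<rho> \<Otimes>\<^sub>M unif)" for A
  proof -
    have comp: "(\<lambda>z. fst z i) \<in> merging_algebra \<rightarrow>\<^sub>M ?B" if i: "i < k" for i
    proof (rule measurable_merging_algebra)
      have "(\<lambda>x. x i) \<in> ?H \<rightarrow>\<^sub>M ?B"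
        using measurable_component_singleton[of i "{0..<k}" "\<lambda>_. ?B"] i by simp
      then have "(\<lambda>x. x i) \<in> \<rho> \<rightarrow>\<^sub>M ?B" by (simp add: sr cong: measurable_cong_sets)
      from measurable_compose[OF measurable_fst this]
      show "(\<lambda>z. fst z i) \<in> borel_measurable (\<rho> \<Otimes>\<^sub>M unif)" .
      fix \<delta> :: real assume \<delta>: "0 < \<delta>"
      \<comment> \<open>A distance of at least \<delta> forces a cost of at least \<open>c\<close>,
        so convergence in probability follows from \<open>near\<close> by the Markov
        inequality.\<close>
      define c where "c = (\<delta> / real CARD('d)) powr p"
      have c: "0 < c" using \<delta> by (simp add: c_def)
      have iN: "i < N" using i k by simp
      note T1i[OF iN, measurable] T2i[OF iN, measurable]
      let ?D = "\<lambda>n. {\<omega> \<in> space (\<Omega> n). \<delta> \<le> dist (fst (X1 n \<omega>) i) (fst (X2 n \<omega>) i)}"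
      have Deq: "?D n = {\<omega> \<in> space (P n). \<delta> \<le> dist (T1 n \<omega> i) (T2 n \<omega> i)} \<times> UNIV" for n
        using i by (auto simp: X1_def X2_def \<Omega>_def space_pair_measure)
      have Dm: "{\<omega> \<in> space (P n). \<delta> \<le> dist (T1 n \<omega> i) (T2 n \<omega> i)} \<in> sets (P n)" for n by measurable
      have em: "emeasure (\<Omega> n) (?D n) = emeasure (P n) {\<omega> \<in> space (P n). \<delta> \<le> dist (T1 n \<omega> i) (T2 n \<omega> i)}" for n
      proof -
        have "UNIV \<in> sets unif" by simp
        from U.emeasure_pair_measure_Times[OF Dm[of n] this] show ?thesis
          using U.emeasure_space_1 unfolding Deq by (simp only: \<Omega>_def space_unif mult_1_right)
      qed
      have "(\<lambda>n. emeasure (\<Omega> n) (?D n)) \<longlonglongrightarrow> 0"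
      proof (rule tendsto_0_squeeze_ennreal)
        show "(\<lambda>n. ennreal (1 / c) * ((\<integral>\<^sup>+\<omega>. ennreal (pnorm_pow p (T1 n \<omega> i - T2 n \<omega> i)) \<partial>P n) + 0)) \<longlonglongrightarrow> 0"
          by (rule tendsto_0_cmult_add_ennreal[OF near[OF i] tendsto_const])
        fix n
        have "emeasure (P n) {\<omega> \<in> space (P n). \<delta> \<le> dist (T1 n \<omega> i) (T2 n \<omega> i)} =
          (\<integral>\<^sup>+\<omega>. indicator {\<omega> \<in> space (P n). \<delta> \<le> dist (T1 n \<omega> i) (T2 n \<omega> i)} \<omega> \<partial>P n)"
          using Dm by simp
        also have "\<dots> \<le> (\<integral>\<^sup>+\<omega>. ennreal (1 / c) * ennreal (pnorm_pow p (T1 n \<omega> i - T2 n \<omega> i)) \<partial>P n)"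
        proof (rule nn_integral_mono)
          fix \<omega>
          show "indicator {\<omega> \<in> space (P n). \<delta> \<le> dist (T1 n \<omega> i) (T2 n \<omega> i)} \<omega> \<le> ennreal (1 / c) * ennreal (pnorm_pow p (T1 n \<omega> i - T2 n \<omega> i))"
          proof (cases "\<delta> \<le> dist (T1 n \<omega> i) (T2 n \<omega> i)")
            case True
            then have "c \<le> pnorm_pow p (T1 n \<omega> i - T2 n \<omega> i)"
              unfolding c_def by (intro pnorm_pow_ge[OF p \<delta>]) (simp add: dist_norm)
            then have "1 \<le> 1 / c * pnorm_pow p (T1 n \<omega> i - T2 n \<omega> i)" using c by (simp add: field_simps)
            then have "ennreal 1 \<le> ennreal (1 / c) * ennreal (pnorm_pow p (T1 n \<omega> i - T2 n \<omega> i))"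
              using c by (simp add: ennreal_mult[symmetric] del: ennreal_1)
            then show ?thesis by (auto split: split_indicator)
          qed simp
        qed
        also have "\<dots> = ennreal (1 / c) * (\<integral>\<^sup>+\<omega>. ennreal (pnorm_pow p (T1 n \<omega> i - T2 n \<omega> i)) \<partial>P n)"
          by (rule nn_integral_cmult) measurable
        finally show "emeasure (\<Omega> n) (?D n) \<le> ennreal (1 / c) * ((\<integral>\<^sup>+\<omega>. ennreal (pnorm_pow p (T1 n \<omega> i - T2 n \<omega> i)) \<partial>P n) + 0)"
          unfolding em by simp
      qed
      then have "(\<lambda>n. ennreal (measure (\<Omega> n) (?D n))) \<longlonglongrightarrow> ennreal 0"
        using prob_\<Omega> by (simp add: finite_measure.emeasure_eq_measure[OF prob_space.finite_measure])
      then show "(\<lambda>n. measure (\<Omega> n) (?D n)) \<longlonglongrightarrow> 0"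
        by (subst (asm) tendsto_ennreal_iff) auto
    qed
    \<comment> \<open>The noise component is the same in \<open>X1\<close> and \<open>X2\<close>, so
      the distance is 0.\<close>
    have "snd \<in> borel_measurable merging_algebra"
      by (rule measurable_merging_algebra) (auto simp: X1_def X2_def)
    moreover have "fst \<in> merging_algebra \<rightarrow>\<^sub>M ?H"
    proof -
      have "(\<lambda>z. fst z) \<in> merging_algebra \<rightarrow>\<^sub>M ?H"
      proof (rule measurable_PiM_single')
        show "(\<lambda>z. fst z i) \<in> merging_algebra \<rightarrow>\<^sub>M ?B" if "i \<in> {0..<k}" for i using comp that by simp
        show "(\<lambda>z i. fst z i) \<in> space merging_algebra \<rightarrow> (\<Pi>\<^sub>E i\<in>{0..<k}. space ?B)"
          using sets_eq_imp_space_eq[OF sr] by (auto simp: space_pair_measure space_PiM)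
      qed
      then show ?thesis by simp
    qed
    ultimately have "(\<lambda>z. (fst z, snd z)) \<in> merging_algebra \<rightarrow>\<^sub>M ?H \<Otimes>\<^sub>M borel" by (rule measurable_Pair[rotated])
    then have "(\<lambda>z. z) \<in> merging_algebra \<rightarrow>\<^sub>M \<rho> \<Otimes>\<^sub>M unif"
      by (simp add: sr cong: measurable_cong_sets sets_pair_measure_cong)
    from measurable_sets[OF this A] have "A \<inter> space (\<rho> \<Otimes>\<^sub>M unif) \<in> sets merging_algebra" by simp
    then show ?thesis using sets.sets_into_space[OF A] by (simp add: sets_merging_algebra Int_absorb2)
  qed
  have T': "T \<in> borel_measurable (\<rho> \<Otimes>\<^sub>M unif)" using T by (simp add: sr cong: measurable_cong_sets sets_pair_measure_cong)
  \<comment> \<open>The \<open>p\<close>-th moment of \<open>T\<close> is the \<open>p\<close>-th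
    moment of the state at time \<open>k\<close> under \<mu>, which is finite because \<mu> lies in
    \<open>P_p p N\<close>.\<close>
  have coord: "(\<lambda>n. \<integral>\<^sup>+z. ennreal (\<bar>T (X1 n z) $ j - T (X2 n z) $ j\<bar> powr p) \<partial>\<Omega> n) \<longlonglongrightarrow> 0" for j
  proof (rule Lp_merging[OF merges _ _ p])
    show Tj[measurable]: "(\<lambda>z. T z $ j) \<in> borel_measurable (\<rho> \<Otimes>\<^sub>M unif)"
    proof -
      have "(\<lambda>v :: real ^ 'd. v $ j) \<in> borel_measurable borel" by measurable
      from measurable_compose[OF T' this] show ?thesis .
    qed
    define g where "g v = ennreal (\<bar>v $ j\<bar> powr p)" for v :: "real ^ 'd"
    have g[measurable]: "g \<in> borel_measurable borel" unfolding g_def by measurable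
    have gT: "(\<lambda>z. g (T z)) \<in> borel_measurable (\<rho> \<Otimes>\<^sub>M unif)" by (rule measurable_compose[OF T' g])
    have "(\<integral>\<^sup>+z. g (T z) \<partial>(\<rho> \<Otimes>\<^sub>M unif)) = (\<integral>\<^sup>+h. \<integral>\<^sup>+u. g (T (h, u)) \<partial>unif \<partial>\<rho>)"
      by (rule U.nn_integral_fst[OF gT, symmetric])
    also have "\<dots> = (\<integral>\<^sup>+h. \<integral>\<^sup>+v. g v \<partial>\<kappa> k h \<partial>\<rho>)"
    proof (rule nn_integral_cong)
      fix h assume "h \<in> space \<rho>"
      then have h: "h \<in> space ?H" using sets_eq_imp_space_eq[OF sr] by simp
      have "(\<lambda>u. T (h, u)) \<in> unif \<rightarrow>\<^sub>M ?B" using measurable_compose_Pair1[OF h T] by (simp cong: measurable_cong_sets)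
      from nn_integral_distr[OF this, of g] show "(\<integral>\<^sup>+u. g (T (h, u)) \<partial>unif) = (\<integral>\<^sup>+v. g v \<partial>\<kappa> k h)"
        unfolding \<kappa>T[OF h] using g by simp
    qed
    also have "\<dots> = (\<integral>\<^sup>+x. \<integral>\<^sup>+v. g v \<partial>\<kappa> k (restrict x {0..<k}) \<partial>\<mu>)"
      unfolding \<rho>_def
    proof (rule nn_integral_distr[OF r])
      show "(\<lambda>h. \<integral>\<^sup>+v. g v \<partial>\<kappa> k h) \<in> borel_measurable (distr \<mu> ?H (\<lambda>x. restrict x {0..<k}))"
        using measurable_compose[OF measurable_prob_algebraD[OF K] nn_integral_measurable_subprob_algebra[OF g]] by simp
    qed
    also have "\<dots> = (\<integral>\<^sup>+x. g (x k) \<partial>\<mu>)"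
      using disintegrationD(4)[OF \<kappa> k measurable_compose[OF measurable_snd g]] by simp
    also have "\<dots> \<le> (\<integral>\<^sup>+x. ennreal (path_pnorm_pow p N x) \<partial>\<mu>)"
    proof (intro nn_integral_mono)
      fix x
      have "\<bar>x k $ j\<bar> powr p \<le> pnorm_pow p (x k)" unfolding pnorm_pow_def by (rule member_le_sum) auto
      also have "\<dots> \<le> path_pnorm_pow p N x" unfolding path_pnorm_pow_def using k by (intro member_le_sum) auto
      finally show "g (x k) \<le> ennreal (path_pnorm_pow p N x)" by (simp add: g_def ennreal_leI)
    qed
    also note \<mu>_mom
    finally show "(\<integral>\<^sup>+z. ennreal (\<bar>T z $ j\<bar> powr p) \<partial>(\<rho> \<Otimes>\<^sub>M unif)) < \<infinity>" by (simp add: g_def)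
  qed
  define Jn where "Jn n = (\<integral>\<^sup>+z. ennreal (pnorm_pow p (T (X1 n z) - T (X2 n z))) \<partial>\<Omega> n)" for n
  have J_lim: "Jn \<longlonglongrightarrow> 0"
  proof -
    have TX: "(\<lambda>z. T (X1 n z)) \<in> \<Omega> n \<rightarrow>\<^sub>M ?B" "(\<lambda>z. T (X2 n z)) \<in> \<Omega> n \<rightarrow>\<^sub>M ?B" for n
      using measurable_compose[OF X1m T'] measurable_compose[OF X2m T'] by auto
    have "Jn n = (\<Sum>j\<in>UNIV. \<integral>\<^sup>+z. ennreal (\<bar>T (X1 n z) $ j - T (X2 n z) $ j\<bar> powr p) \<partial>\<Omega> n)" for n
    proof -
      have "Jn n = (\<integral>\<^sup>+z. (\<Sum>j\<in>UNIV. ennreal (\<bar>T (X1 n z) $ j - T (X2 n z) $ j\<bar> powr p)) \<partial>\<Omega> n)"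
        unfolding Jn_def pnorm_pow_def by (intro nn_integral_cong) (simp add: sum_ennreal)
      also have "\<dots> = (\<Sum>j\<in>UNIV. \<integral>\<^sup>+z. ennreal (\<bar>T (X1 n z) $ j - T (X2 n z) $ j\<bar> powr p) \<partial>\<Omega> n)"
      proof (rule nn_integral_sum)
        fix j
        have "(\<lambda>v :: real ^ 'd. v $ j) \<in> borel_measurable borel" by measurable
        from measurable_compose[OF TX(1)[of n] this] measurable_compose[OF TX(2)[of n] this]
        show "(\<lambda>z. ennreal (\<bar>T (X1 n z) $ j - T (X2 n z) $ j\<bar> powr p)) \<in> borel_measurable (\<Omega> n)"
          by measurable
      qed
      finally show ?thesis .
    qed
    then have "Jn = (\<lambda>n. \<Sum>j\<in>UNIV. \<integral>\<^sup>+z. ennreal (\<bar>T (X1 n z) $ j - T (X2 n z) $ j\<bar> powr p) \<partial>\<Omega> n)" by blast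
    then show ?thesis using coord by (simp only: tendsto_null_sum)
  qed
  have W_meas: "(\<lambda>\<omega>. min_cost p (\<kappa>s n k (restrict (fst \<omega>) {0..<k})) (\<kappa> k (restrict (T1 n \<omega>) {0..<k}))) \<in> borel_measurable (P n)"
    "(\<lambda>\<omega>. min_cost p (\<kappa> k (restrict (T1 n \<omega>) {0..<k})) (\<kappa> k (restrict (T2 n \<omega>) {0..<k}))) \<in> borel_measurable (P n)"
    for n
  proof -
    have "(\<lambda>\<omega>. restrict (fst \<omega>) {0..<k}) \<in> ?S \<Otimes>\<^sub>M borel \<rightarrow>\<^sub>M ?H"
      by (rule measurable_compose[OF measurable_fst measurable_restrict_path[OF less_imp_le[OF k]]])
    then have f: "(\<lambda>\<omega>. restrict (fst \<omega>) {0..<k}) \<in> P n \<rightarrow>\<^sub>M ?H" by (simp add: sP cong: measurable_cong_sets)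
    show "(\<lambda>\<omega>. min_cost p (\<kappa>s n k (restrict (fst \<omega>) {0..<k})) (\<kappa> k (restrict (T1 n \<omega>) {0..<k}))) \<in> borel_measurable (P n)"
      by (rule measurable_min_cost[OF p measurable_compose[OF f Ks] measurable_compose[OF T1k K]])
    show "(\<lambda>\<omega>. min_cost p (\<kappa> k (restrict (T1 n \<omega>) {0..<k})) (\<kappa> k (restrict (T2 n \<omega>) {0..<k}))) \<in> borel_measurable (P n)"
      by (rule measurable_min_cost[OF p measurable_compose[OF T1k K] measurable_compose[OF T2k K]])
  qed
  have WS: "(\<lambda>z. min_cost p (\<kappa>s n k (restrict (fst z) {0..<k})) (\<kappa> k (restrict (snd z) {0..<k}))) \<in> borel_measurable (?S \<Otimes>\<^sub>M ?S)" for n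
    by (rule measurable_min_cost[OF p
        measurable_compose[OF measurable_compose[OF measurable_fst measurable_restrict_path[OF less_imp_le[OF k]]] Ks]
        measurable_compose[OF measurable_compose[OF measurable_snd measurable_restrict_path[OF less_imp_le[OF k]]] K]])
  \<comment> \<open>For a fixed first noise, feeding the same second noise into the two histories
    couples the two conditional laws of \<mu>.\<close>
  have W_le: "(\<integral>\<^sup>+\<omega>. min_cost p (\<kappa> k (restrict (T1 n \<omega>) {0..<k})) (\<kappa> k (restrict (T2 n \<omega>) {0..<k})) \<partial>P n) \<le> Jn n" for n
  proof -
    have J_meas: "(\<lambda>z. ennreal (pnorm_pow p (T (X1 n z) - T (X2 n z)))) \<in> borel_measurable (P n \<Otimes>\<^sub>M unif)"
      using measurable_compose[OF X1m T'] measurable_compose[OF X2m T'] unfolding \<Omega>_def by measurable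
    have "(\<integral>\<^sup>+\<omega>. min_cost p (\<kappa> k (restrict (T1 n \<omega>) {0..<k})) (\<kappa> k (restrict (T2 n \<omega>) {0..<k})) \<partial>P n) \<le>
      (\<integral>\<^sup>+\<omega>. \<integral>\<^sup>+v. ennreal (pnorm_pow p (T (X1 n (\<omega>, v)) - T (X2 n (\<omega>, v)))) \<partial>unif \<partial>P n)"
    proof (rule nn_integral_mono)
      fix \<omega> assume w: "\<omega> \<in> space (P n)"
      note h1 = measurable_space[OF T1k w] and h2 = measurable_space[OF T2k w]
      have "(\<lambda>u. T (restrict (T1 n \<omega>) {0..<k}, u)) \<in> unif \<rightarrow>\<^sub>M ?B" "(\<lambda>u. T (restrict (T2 n \<omega>) {0..<k}, u)) \<in> unif \<rightarrow>\<^sub>M ?B"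
        using measurable_compose_Pair1[OF h1 T] measurable_compose_Pair1[OF h2 T] by (simp_all cong: measurable_cong_sets)
      from min_cost_le_maps[OF prob_space_unif this \<kappa>T[OF h1] \<kappa>T[OF h2], of p]
      show "min_cost p (\<kappa> k (restrict (T1 n \<omega>) {0..<k})) (\<kappa> k (restrict (T2 n \<omega>) {0..<k})) \<le>
        (\<integral>\<^sup>+v. ennreal (pnorm_pow p (T (X1 n (\<omega>, v)) - T (X2 n (\<omega>, v)))) \<partial>unif)"
        by (simp only: X1_def X2_def fst_conv snd_conv)
    qed
    also have "\<dots> = Jn n" unfolding Jn_def \<Omega>_def by (rule U.nn_integral_fst[OF J_meas])
    finally show ?thesis .
  qed
  show ?thesis
  proof (rule tendsto_0_squeeze_ennreal)
    show "(\<lambda>n. ennreal (2 powr p) * (step_cost p k (\<pi> n) + Jn n)) \<longlonglongrightarrow> 0"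
      by (rule tendsto_0_cmult_add_ennreal[OF \<pi>_lim[OF k] J_lim])
    fix n
    have "step_cost p k (\<gamma> n) \<le> (\<integral>\<^sup>+z. min_cost p (\<kappa>s n k (restrict (fst z) {0..<k})) (\<kappa> k (restrict (snd z) {0..<k})) \<partial>\<gamma> n)"
      by (rule triangular_step_cost[OF p \<gamma> \<kappa>s \<kappa> k])
    also have "\<dots> = (\<integral>\<^sup>+\<omega>. min_cost p (\<kappa>s n k (restrict (fst \<omega>) {0..<k})) (\<kappa> k (restrict (T2 n \<omega>) {0..<k})) \<partial>P n)"
      using rand_nn[OF T2 WS, of n n] by simp
    \<comment> \<open>The intermediate law is the conditional law of \<mu> along \<open>T1\<close>:
      the bicausal coupling controls its distance to the conditional law of \<open>\<mu>s n\<close>,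
      and merging controls its distance to the conditional law along \<open>T2\<close>.\<close>
    also have "\<dots> \<le> (\<integral>\<^sup>+\<omega>. ennreal (2 powr p) * (min_cost p (\<kappa>s n k (restrict (fst \<omega>) {0..<k})) (\<kappa> k (restrict (T1 n \<omega>) {0..<k}))
       + min_cost p (\<kappa> k (restrict (T1 n \<omega>) {0..<k})) (\<kappa> k (restrict (T2 n \<omega>) {0..<k}))) \<partial>P n)"
    proof (rule nn_integral_mono)
      fix \<omega> assume w: "\<omega> \<in> space (P n)"
      then have "fst \<omega> \<in> space ?S" using sets_eq_imp_space_eq[OF sP] by (auto simp: space_pair_measure)
      from measurable_space[OF Ks measurable_space[OF measurable_restrict_path[OF less_imp_le[OF k]] this]]
      show "min_cost p (\<kappa>s n k (restrict (fst \<omega>) {0..<k})) (\<kappa> k (restrict (T2 n \<omega>) {0..<k})) \<le>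
        ennreal (2 powr p) * (min_cost p (\<kappa>s n k (restrict (fst \<omega>) {0..<k})) (\<kappa> k (restrict (T1 n \<omega>) {0..<k}))
       + min_cost p (\<kappa> k (restrict (T1 n \<omega>) {0..<k})) (\<kappa> k (restrict (T2 n \<omega>) {0..<k})))"
        by (rule min_cost_triangle[OF p _ measurable_space[OF K measurable_space[OF T1k w]] measurable_space[OF K measurable_space[OF T2k w]]])
    qed
    also have "\<dots> = ennreal (2 powr p) * ((\<integral>\<^sup>+\<omega>. min_cost p (\<kappa>s n k (restrict (fst \<omega>) {0..<k})) (\<kappa> k (restrict (T1 n \<omega>) {0..<k})) \<partial>P n)
       + (\<integral>\<^sup>+\<omega>. min_cost p (\<kappa> k (restrict (T1 n \<omega>) {0..<k})) (\<kappa> k (restrict (T2 n \<omega>) {0..<k})) \<partial>P n))"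
      using W_meas[of n] by (simp add: nn_integral_cmult nn_integral_add)
    also have "\<dots> \<le> ennreal (2 powr p) * (step_cost p k (\<pi> n) + Jn n)"
    proof (intro mult_left_mono add_mono W_le)
      have "(\<integral>\<^sup>+\<omega>. min_cost p (\<kappa>s n k (restrict (fst \<omega>) {0..<k})) (\<kappa> k (restrict (T1 n \<omega>) {0..<k})) \<partial>P n) =
        (\<integral>\<^sup>+z. min_cost p (\<kappa>s n k (restrict (fst z) {0..<k})) (\<kappa> k (restrict (snd z) {0..<k})) \<partial>\<pi> n)"
        using rand_nn[OF T1 WS, of n n] by simp
      also have "\<dots> \<le> step_cost p k (\<pi> n)" by (rule bicausal_step_cost[OF \<pi> \<kappa>s \<kappa> k])
      finally show "(\<integral>\<^sup>+\<omega>. min_cost p (\<kappa>s n k (restrict (fst \<omega>) {0..<k})) (\<kappa> k (restrict (T1 n \<omega>) {0..<k})) \<partial>P n)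
        \<le> step_cost p k (\<pi> n)" .
    qed simp
    finally show "step_cost p k (\<gamma> n) \<le> ennreal (2 powr p) * (step_cost p k (\<pi> n) + Jn n)" .
  qed
qed

lemma path_cost_tendsto_0_iff:
  fixes \<pi> :: "nat \<Rightarrow> ((nat \<Rightarrow> real ^ 'd::finite) \<times> (nat \<Rightarrow> real ^ 'd)) measure"
  assumes p: "0 < p" and s: "\<And>n. sets (\<pi> n) = sets (path_space borel N \<Otimes>\<^sub>M path_space borel N)"
  shows "(\<lambda>n. path_cost p N (\<pi> n)) \<longlonglongrightarrow> 0 \<longleftrightarrow> (\<forall>k<N. (\<lambda>n. step_cost p k (\<pi> n)) \<longlonglongrightarrow> 0)"
proof -
  have "(\<lambda>n. \<Sum>k<N. step_cost p k (\<pi> n)) \<longlonglongrightarrow> 0 \<longleftrightarrow> (\<forall>k<N. (\<lambda>n. step_cost p k (\<pi> n)) \<longlonglongrightarrow> 0)"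
  proof
    assume *: "(\<lambda>n. \<Sum>k<N. step_cost p k (\<pi> n)) \<longlonglongrightarrow> 0"
    show "\<forall>k<N. (\<lambda>n. step_cost p k (\<pi> n)) \<longlonglongrightarrow> 0"
      by (intro allI impI tendsto_0_squeeze_ennreal[OF _ *] member_le_sum) auto
  next
    assume "\<forall>k<N. (\<lambda>n. step_cost p k (\<pi> n)) \<longlonglongrightarrow> 0"
    then show "(\<lambda>n. \<Sum>k<N. step_cost p k (\<pi> n)) \<longlonglongrightarrow> 0" by (intro tendsto_null_sum) simp
  qed
  then show ?thesis by (simp add: path_cost_eq[OF s] tendsto_ennroot_0_iff[OF p])
qed

theorem theorem1p11:
  fixes N :: nat and p :: real
    and \<mu>s :: "nat \<Rightarrow> (nat \<Rightarrow> real ^ 'd::finite) measure"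
    and \<mu> :: "(nat \<Rightarrow> real ^ 'd) measure"
  assumes "N \<ge> 1" and "p \<ge> 1"
    and "\<And>n. \<mu>s n \<in> P_p p N" and "\<mu> \<in> P_p p N"
  shows "(\<lambda>n. KR p N (\<mu>s n) \<mu>) \<longlonglongrightarrow> 0 \<longleftrightarrow> (\<lambda>n. AW p N (\<mu>s n) \<mu>) \<longlonglongrightarrow> 0"
proof -
  have p: "0 < p" using assms(2) by simp
  have \<mu>s: "prob_space (\<mu>s n)" "sets (\<mu>s n) = sets (path_space borel N)" for n
    using assms(3)[of n] by (auto simp: P_p_def)
  have \<mu>: "prob_space \<mu>" "sets \<mu> = sets (path_space borel N)" using assms(4) by (auto simp: P_p_def)
  have ne: "triangular_optimal_couplings p N (\<mu>s n) \<mu> \<noteq> {}" for n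
    by (rule triangular_optimal_couplings_nonempty[OF p \<mu>s \<mu>])
  have s: "sets g = sets (path_space borel N \<Otimes>\<^sub>M path_space borel N)" if "g \<in> couplings (\<mu>s n) \<mu>" for g n
    using couplings_prob_algebra(1)[OF \<mu>s \<mu>(2) that] by (simp add: space_prob_algebra)
  show ?thesis
  proof
    assume KR: "(\<lambda>n. KR p N (\<mu>s n) \<mu>) \<longlonglongrightarrow> 0"
    show "(\<lambda>n. AW p N (\<mu>s n) \<mu>) \<longlonglongrightarrow> 0"
    proof (rule tendsto_0_squeeze_ennreal[OF _ KR])
      fix n
      obtain g where g: "g \<in> triangular_optimal_couplings p N (\<mu>s n) \<mu>" using ne[of n] by blast
      then have "AW p N (\<mu>s n) \<mu> \<le> path_cost p N g"
        unfolding AW_def using triangular_optimal_subset_bicausal by (intro INF_lower) blast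
      also have "\<dots> \<le> KR p N (\<mu>s n) \<mu>" unfolding KR_def using g by (rule SUP_upper)
      finally show "AW p N (\<mu>s n) \<mu> \<le> KR p N (\<mu>s n) \<mu>" .
    qed
  next
    assume AW: "(\<lambda>n. AW p N (\<mu>s n) \<mu>) \<longlonglongrightarrow> 0"
    \<comment> \<open>Almost optimal couplings with a slack that tends to 0. If the infimum is
      infinite any bicausal coupling will do, and one exists because triangular optimal ones
      do.\<close>
    have "\<exists>g\<in>bicausal_couplings N (\<mu>s n) \<mu>. path_cost p N g \<le> AW p N (\<mu>s n) \<mu> + ennreal (1 / real (Suc n))" for n
    proof (cases "AW p N (\<mu>s n) \<mu> = \<infinity>")
      case True
      then show ?thesis using ne[of n] triangular_optimal_subset_bicausal by fastforce
    next
      case False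
      then have "AW p N (\<mu>s n) \<mu> < AW p N (\<mu>s n) \<mu> + ennreal (1 / real (Suc n))"
        by (simp add: ennreal_add_left_cancel_less[of _ 0, simplified] less_top)
      then obtain g where "g \<in> bicausal_couplings N (\<mu>s n) \<mu>" "path_cost p N g < AW p N (\<mu>s n) \<mu> + ennreal (1 / real (Suc n))"
        by (subst (asm) AW_def) (auto simp: INF_less_iff)
      then show ?thesis by (intro bexI[of _ g]) auto
    qed
    then obtain \<pi> where \<pi>: "\<And>n. \<pi> n \<in> bicausal_couplings N (\<mu>s n) \<mu>"
      and \<pi>_le: "\<And>n. path_cost p N (\<pi> n) \<le> AW p N (\<mu>s n) \<mu> + ennreal (1 / real (Suc n))" by metis
    have "(\<lambda>n. path_cost p N (\<pi> n)) \<longlonglongrightarrow> 0"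
      by (rule tendsto_0_le_add_inverse[OF \<pi>_le AW])
    moreover have "sets (\<pi> n) = sets (path_space borel N \<Otimes>\<^sub>M path_space borel N)" for n
      using s[of "\<pi> n" n] \<pi>[of n] by (simp add: bicausal_couplings_def)
    ultimately have \<pi>_lim: "\<And>k. k < N \<Longrightarrow> (\<lambda>n. step_cost p k (\<pi> n)) \<longlonglongrightarrow> 0"
      using path_cost_tendsto_0_iff[where \<pi>=\<pi> and N=N, OF p] by blast
    have lim: "(\<lambda>n. path_cost p N (\<gamma> n)) \<longlonglongrightarrow> 0" if \<gamma>: "\<And>n. \<gamma> n \<in> triangular_optimal_couplings p N (\<mu>s n) \<mu>" for \<gamma>
    proof -
      have "k < N \<Longrightarrow> (\<lambda>n. step_cost p k (\<gamma> n)) \<longlonglongrightarrow> 0" for k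
      \<comment> \<open>Convergence at the earlier times brings the histories together, which is
        what the next time is deduced from; at time 0 there is no history to compare.\<close>
      proof (induction k rule: less_induct)
        case (less k)
        show ?case
          by (rule triangular_step_tendsto[OF p assms(3,4) \<pi> \<gamma> \<pi>_lim less.prems less.IH]) (use less.prems in auto)
      qed
      moreover have "sets (\<gamma> n) = sets (path_space borel N \<Otimes>\<^sub>M path_space borel N)" for n
        using s[of "\<gamma> n" n] \<gamma>[of n] by (simp add: triangular_optimal_couplings_def)
      ultimately show ?thesis using path_cost_tendsto_0_iff[where \<pi>=\<gamma> and N=N, OF p] by blast
    qed
    show "(\<lambda>n. KR p N (\<mu>s n) \<mu>) \<longlonglongrightarrow> 0"
    proof (rule tendsto_0_ennreal_le[where c=1])
      fix \<epsilon> :: real assume \<epsilon>: "0 < \<epsilon>"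
      \<comment> \<open>The supremum need not be attained. For each \<open>n\<close> a coupling is
        chosen that costs more than \<epsilon> whenever the supremum does; convergence along this
        one sequence then bounds the supremum.\<close>
      have "\<exists>g\<in>triangular_optimal_couplings p N (\<mu>s n) \<mu>. ennreal \<epsilon> < KR p N (\<mu>s n) \<mu> \<longrightarrow> ennreal \<epsilon> < path_cost p N g" for n
        using ne[of n] unfolding KR_def less_SUP_iff by blast
      then obtain \<gamma> where \<gamma>: "\<And>n. \<gamma> n \<in> triangular_optimal_couplings p N (\<mu>s n) \<mu>"
        and far: "\<And>n. ennreal \<epsilon> < KR p N (\<mu>s n) \<mu> \<Longrightarrow> ennreal \<epsilon> < path_cost p N (\<gamma> n)" by metis
      have "\<forall>\<^sub>F n in sequentially. path_cost p N (\<gamma> n) < ennreal \<epsilon>"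
        using \<epsilon> by (intro order_tendstoD(2)[OF lim[OF \<gamma>]]) simp
      then show "\<forall>\<^sub>F n in sequentially. KR p N (\<mu>s n) \<mu> \<le> ennreal (1 * \<epsilon>)"
        by eventually_elim (use far in \<open>force simp: not_less[symmetric]\<close>)
    qed simp
  qed
qed

end
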